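(* Let $p\in S(A)$ be finitely satisfiable in $A$. Then the following are equivalent: (i) $p$ is Shelah-stable; (ii) every coheir of $p$ over $\mathfrak{C}$ (i.e. every global extension of $p$ finitely satisfiable in $A$) is definable over $A$; (iii) some coheir of $p$ over some $(|A|+|T|)^+$-saturated model containing $A$ is definable over $A$.
   Context: $T$ is a complete dependent (NIP) theory, $T=T^{eq}$, working in a monster model $\mathfrak{C}$. A type over $B$ is finitely satisfiable in $A$ if every formula in it is satisfied by a tuple from $A$; for $A\subseteq B$, an extension of $p\in S(A)$ to $B$ which is finitely satisfiable in $A$ is called a coheir of $p$ over $B$. A type over $B$ is definable over $A$ if for each $\varphi(x,y)$ there is a formula $d\varphi(y)$ over $A$ with $\varphi(x,b)$ in the type iff $\models d\varphi(b)$, for $b\in B$. A sequence is indiscernible over $A$ if the type over $A$ of increasing $k$-tuples depends only on $k$; an indiscernible set over $A$ if the type over $A$ of any $k$ distinct elements depends only on $k$. $p\in S(A)$ is Shelah-stable if there is an infinite sequence $(a_i)$ of realizations of $p$, indiscernible over $A$, with each $\mathrm{tp}(a_i/A\cup\{a_j:j<i\})$ finitely satisfiable in $A$, which is an indiscernible set over $A$. *)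

theory Defs
  imports Main
begin

unbundle cardinal_syntax

section \<open>Many-sorted first-order logic\<close>

text \<open>
  Variables are de Bruijn indices. A list \<open>ss\<close> of sorts is a context: variable \<open>i\<close> has sort
  \<open>ss ! i\<close>, and a quantifier binds variable \<open>0\<close> of its scope. A formula \<open>\<phi>(x,y)\<close> with \<open>x\<close>
  of sorts \<open>ss\<close> and \<open>y\<close> of sorts \<open>ts\<close> is a formula in the context \<open>ss @ ts\<close>; it is evaluated
  at \<open>a @ b\<close>.
\<close>

datatype 'f trm = Var nat | App 'f "'f trm list"

datatype ('s, 'f, 'r) fm =
    Eq "'f trm" "'f trm"
  | Rel 'r "'f trm list"
  | Neg "('s, 'f, 'r) fm"
  | Conj "('s, 'f, 'r) fm" "('s, 'f, 'r) fm"
  | Ex 's "('s, 'f, 'r) fm"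

text \<open>
  All elements of the type \<open>'s\<close> are sorts of the language. A symbol mapped to \<open>None\<close> does not
  belong to the language.
\<close>

record ('s, 'f, 'r) language =
  fun_sig :: "'f \<Rightarrow> ('s list \<times> 's) option"
  rel_sig :: "'r \<Rightarrow> 's list option"

inductive has_sort :: "('s, 'f, 'r) language \<Rightarrow> 's list \<Rightarrow> 'f trm \<Rightarrow> 's \<Rightarrow> bool"
  for L :: "('s, 'f, 'r) language" and ss :: "'s list" where
  has_sort_Var: "i < length ss \<Longrightarrow> has_sort L ss (Var i) (ss ! i)"
| has_sort_App: "fun_sig L f = Some (us, s) \<Longrightarrow> list_all2 (has_sort L ss) ts us
    \<Longrightarrow> has_sort L ss (App f ts) s"

primrec wff :: "('s, 'f, 'r) language \<Rightarrow> 's list \<Rightarrow> ('s, 'f, 'r) fm \<Rightarrow> bool" where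
  "wff L ss (Eq t u) \<longleftrightarrow> (\<exists>s. has_sort L ss t s \<and> has_sort L ss u s)"
| "wff L ss (Rel r ts) \<longleftrightarrow> (\<exists>us. rel_sig L r = Some us \<and> list_all2 (has_sort L ss) ts us)"
| "wff L ss (Neg \<phi>) \<longleftrightarrow> wff L ss \<phi>"
| "wff L ss (Conj \<phi> \<psi>) \<longleftrightarrow> wff L ss \<phi> \<and> wff L ss \<psi>"
| "wff L ss (Ex s \<phi>) \<longleftrightarrow> wff L (s # ss) \<phi>"

text \<open>The cardinal \<open>|T|\<close> is the cardinality of this set.\<close>

definition L_formulas :: "('s, 'f, 'r) language \<Rightarrow> ('s, 'f, 'r) fm set" where
  "L_formulas L = {\<phi>. \<exists>ss. wff L ss \<phi>}"

text \<open>
  The sorts of a structure are disjoint subsets of one universe. Only the values of \<open>sort_of\<close>,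
  \<open>fun_int\<close> and \<open>rel_int\<close> on the universe matter, so a substructure is given by restricting
  \<open>universe\<close>.
\<close>

record ('s, 'f, 'r, 'm) struct =
  universe :: "'m set"
  sort_of :: "'m \<Rightarrow> 's"
  fun_int :: "'f \<Rightarrow> 'm list \<Rightarrow> 'm"
  rel_int :: "'r \<Rightarrow> 'm list \<Rightarrow> bool"

definition tuples :: "('s, 'f, 'r, 'm) struct \<Rightarrow> 'm set \<Rightarrow> 's list \<Rightarrow> 'm list set" where
  "tuples M X ss = {a. set a \<subseteq> X \<and> map (sort_of M) a = ss}"

definition is_structure :: "('s, 'f, 'r) language \<Rightarrow> ('s, 'f, 'r, 'm) struct \<Rightarrow> bool" where
  "is_structure L M \<longleftrightarrow>
     (\<forall>s. \<exists>m\<in>universe M. sort_of M m = s) \<and>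
     (\<forall>f us s. fun_sig L f = Some (us, s) \<longrightarrow>
        (\<forall>a\<in>tuples M (universe M) us. fun_int M f a \<in> universe M \<and> sort_of M (fun_int M f a) = s))"

primrec eval_trm :: "('s, 'f, 'r, 'm) struct \<Rightarrow> 'm list \<Rightarrow> 'f trm \<Rightarrow> 'm" where
  "eval_trm M e (Var i) = e ! i"
| "eval_trm M e (App f ts) = fun_int M f (map (eval_trm M e) ts)"

primrec sat :: "('s, 'f, 'r, 'm) struct \<Rightarrow> 'm list \<Rightarrow> ('s, 'f, 'r) fm \<Rightarrow> bool" where
  "sat M e (Eq t u) \<longleftrightarrow> eval_trm M e t = eval_trm M e u"
| "sat M e (Rel r ts) \<longleftrightarrow> rel_int M r (map (eval_trm M e) ts)"
| "sat M e (Neg \<phi>) \<longleftrightarrow> \<not> sat M e \<phi>"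
| "sat M e (Conj \<phi> \<psi>) \<longleftrightarrow> sat M e \<phi> \<and> sat M e \<psi>"
| "sat M e (Ex s \<phi>) \<longleftrightarrow> (\<exists>m\<in>universe M. sort_of M m = s \<and> sat M (m # e) \<phi>)"

text \<open>Consistency of a complete theory comes from its having a model, see \<open>monster_model\<close>.\<close>

definition complete_theory :: "('s, 'f, 'r) language \<Rightarrow> ('s, 'f, 'r) fm set \<Rightarrow> bool" where
  "complete_theory L T \<longleftrightarrow>
     (\<forall>\<phi>\<in>T. wff L [] \<phi>) \<and> (\<forall>\<phi>. wff L [] \<phi> \<longrightarrow> \<phi> \<in> T \<or> Neg \<phi> \<in> T)"

definition models :: "('s, 'f, 'r, 'm) struct \<Rightarrow> ('s, 'f, 'r) fm set \<Rightarrow> bool" where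
  "models M T \<longleftrightarrow> (\<forall>\<phi>\<in>T. sat M [] \<phi>)"

definition elementary_submodel ::
  "('s, 'f, 'r) language \<Rightarrow> ('s, 'f, 'r, 'm) struct \<Rightarrow> ('s, 'f, 'r, 'm) struct \<Rightarrow> bool" where
  "elementary_submodel L N M \<longleftrightarrow>
     (\<exists>X\<subseteq>universe M. N = M\<lparr>universe := X\<rparr>) \<and> is_structure L N \<and>
     (\<forall>ss \<phi>. \<forall>a\<in>tuples M (universe N) ss. wff L ss \<phi> \<longrightarrow> (sat N a \<phi> \<longleftrightarrow> sat M a \<phi>))"

section \<open>Types\<close>

text \<open>
  A formula \<open>\<phi>(x,b)\<close> with parameters is the pair of an \<open>L\<close>-formula \<open>\<phi>(x,y)\<close> and a tuple \<open>b\<close>.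
  Types are in a finite tuple of variables of sorts \<open>ss\<close>.
\<close>

definition formulas_over ::
  "('s, 'f, 'r) language \<Rightarrow> ('s, 'f, 'r, 'm) struct \<Rightarrow> 's list \<Rightarrow> 'm set
    \<Rightarrow> (('s, 'f, 'r) fm \<times> 'm list) set" where
  "formulas_over L M ss B = {(\<phi>, b). set b \<subseteq> B \<and> wff L (ss @ map (sort_of M) b) \<phi>}"

definition complete_types ::
  "('s, 'f, 'r) language \<Rightarrow> ('s, 'f, 'r, 'm) struct \<Rightarrow> 's list \<Rightarrow> 'm set
    \<Rightarrow> (('s, 'f, 'r) fm \<times> 'm list) set set" where
  "complete_types L M ss B =
     {p. p \<subseteq> formulas_over L M ss B \<and>
         (\<forall>F\<subseteq>p. finite F \<longrightarrow> (\<exists>a\<in>tuples M (universe M) ss. \<forall>(\<phi>, b)\<in>F. sat M (a @ b) \<phi>)) \<and>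
         (\<forall>(\<phi>, b)\<in>formulas_over L M ss B. (\<phi>, b) \<in> p \<or> (Neg \<phi>, b) \<in> p)}"

definition tp ::
  "('s, 'f, 'r) language \<Rightarrow> ('s, 'f, 'r, 'm) struct \<Rightarrow> 'm list \<Rightarrow> 'm set
    \<Rightarrow> (('s, 'f, 'r) fm \<times> 'm list) set" where
  "tp L M a B = {(\<phi>, b) \<in> formulas_over L M (map (sort_of M) a) B. sat M (a @ b) \<phi>}"

definition realizes ::
  "('s, 'f, 'r, 'm) struct \<Rightarrow> 's list \<Rightarrow> 'm list \<Rightarrow> (('s, 'f, 'r) fm \<times> 'm list) set \<Rightarrow> bool" where
  "realizes M ss a p \<longleftrightarrow> a \<in> tuples M (universe M) ss \<and> (\<forall>(\<phi>, b)\<in>p. sat M (a @ b) \<phi>)"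

definition finitely_satisfiable_in ::
  "('s, 'f, 'r, 'm) struct \<Rightarrow> 's list \<Rightarrow> (('s, 'f, 'r) fm \<times> 'm list) set \<Rightarrow> 'm set \<Rightarrow> bool" where
  "finitely_satisfiable_in M ss q A \<longleftrightarrow> (\<forall>(\<phi>, b)\<in>q. \<exists>a\<in>tuples M A ss. sat M (a @ b) \<phi>)"

definition coheir ::
  "('s, 'f, 'r) language \<Rightarrow> ('s, 'f, 'r, 'm) struct \<Rightarrow> 's list \<Rightarrow> 'm set
    \<Rightarrow> (('s, 'f, 'r) fm \<times> 'm list) set \<Rightarrow> 'm set \<Rightarrow> (('s, 'f, 'r) fm \<times> 'm list) set \<Rightarrow> bool" where
  "coheir L M ss A p B q \<longleftrightarrow>
     A \<subseteq> B \<and> q \<in> complete_types L M ss B \<and> p \<subseteq> q \<and> finitely_satisfiable_in M ss q A"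

definition definable_over ::
  "('s, 'f, 'r) language \<Rightarrow> ('s, 'f, 'r, 'm) struct \<Rightarrow> 's list \<Rightarrow> 'm set
    \<Rightarrow> (('s, 'f, 'r) fm \<times> 'm list) set \<Rightarrow> 'm set \<Rightarrow> bool" where
  "definable_over L M ss B q A \<longleftrightarrow>
     (\<forall>ts \<phi>. wff L (ss @ ts) \<phi> \<longrightarrow>
        (\<exists>(d, c)\<in>formulas_over L M ts A.
           \<forall>b\<in>tuples M B ts. (\<phi>, b) \<in> q \<longleftrightarrow> sat M (b @ c) d))"

section \<open>The monster model\<close>

definition saturated :: "'k rel \<Rightarrow> ('s, 'f, 'r) language \<Rightarrow> ('s, 'f, 'r, 'm) struct \<Rightarrow> bool" where
  "saturated \<kappa> L M \<longleftrightarrow>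
     (\<forall>B\<subseteq>universe M. |B| <o \<kappa> \<longrightarrow>
        (\<forall>s. \<forall>p\<in>complete_types L M [s] B. \<exists>a. realizes M [s] a p))"

definition partial_elementary_map ::
  "('s, 'f, 'r) language \<Rightarrow> ('s, 'f, 'r, 'm) struct \<Rightarrow> 'm set \<Rightarrow> ('m \<Rightarrow> 'm) \<Rightarrow> bool" where
  "partial_elementary_map L M B g \<longleftrightarrow>
     (\<forall>m\<in>B. g m \<in> universe M \<and> sort_of M (g m) = sort_of M m) \<and>
     (\<forall>ss \<phi>. \<forall>b\<in>tuples M B ss. wff L ss \<phi> \<longrightarrow> (sat M (map g b) \<phi> \<longleftrightarrow> sat M b \<phi>))"

definition automorphism ::
  "('s, 'f, 'r) language \<Rightarrow> ('s, 'f, 'r, 'm) struct \<Rightarrow> ('m \<Rightarrow> 'm) \<Rightarrow> bool" where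
  "automorphism L M \<sigma> \<longleftrightarrow>
     bij_betw \<sigma> (universe M) (universe M) \<and>
     (\<forall>m\<in>universe M. sort_of M (\<sigma> m) = sort_of M m) \<and>
     (\<forall>f us s. fun_sig L f = Some (us, s) \<longrightarrow>
        (\<forall>a\<in>tuples M (universe M) us. \<sigma> (fun_int M f a) = fun_int M f (map \<sigma> a))) \<and>
     (\<forall>r us. rel_sig L r = Some us \<longrightarrow>
        (\<forall>a\<in>tuples M (universe M) us. rel_int M r (map \<sigma> a) \<longleftrightarrow> rel_int M r a))"

definition strongly_homogeneous ::
  "'k rel \<Rightarrow> ('s, 'f, 'r) language \<Rightarrow> ('s, 'f, 'r, 'm) struct \<Rightarrow> bool" where
  "strongly_homogeneous \<kappa> L M \<longleftrightarrow>
     (\<forall>B\<subseteq>universe M. \<forall>g. |B| <o \<kappa> \<and> partial_elementary_map L M B g \<longrightarrow>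
        (\<exists>\<sigma>. automorphism L M \<sigma> \<and> (\<forall>m\<in>B. \<sigma> m = g m)))"

text \<open>
  Quantifying over subsets of the type of \<open>\<kappa>\<close> reaches every cardinal below \<open>\<kappa>\<close>.
\<close>

definition strong_limit :: "'k rel \<Rightarrow> bool" where
  "strong_limit \<kappa> \<longleftrightarrow>
     Card_order \<kappa> \<and> natLeq <o \<kappa> \<and> (\<forall>X :: 'k set. |X| <o \<kappa> \<longrightarrow> |Pow X| <o \<kappa>)"

text \<open>
  The cardinal \<open>\<kappa>\<close> bounds smallness: a set of parameters or a submodel is small if its
  cardinality is less than \<open>\<kappa>\<close>. Being a strong limit, \<open>\<kappa>\<close> leaves room for small \<open>\<lambda>\<close>-saturated
  elementary submodels for every \<open>\<lambda> < \<kappa>\<close>.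
\<close>

definition monster_model ::
  "'k rel \<Rightarrow> ('s, 'f, 'r) language \<Rightarrow> ('s, 'f, 'r) fm set \<Rightarrow> ('s, 'f, 'r, 'm) struct \<Rightarrow> bool" where
  "monster_model \<kappa> L T M \<longleftrightarrow>
     strong_limit \<kappa> \<and> |L_formulas L| <o \<kappa> \<and>
     is_structure L M \<and> models M T \<and> saturated \<kappa> L M \<and> strongly_homogeneous \<kappa> L M"

text \<open>
  The next two are properties of the complete theory \<open>T\<close>, read off in its monster model \<open>M\<close>.
  \<open>T\<close> is dependent if no formula \<open>\<phi>(x,y)\<close> shatters an infinite family of tuples.
\<close>

definition dependent :: "('s, 'f, 'r) language \<Rightarrow> ('s, 'f, 'r, 'm) struct \<Rightarrow> bool" where
  "dependent L M \<longleftrightarrow>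
     \<not> (\<exists>ss ts \<phi> (a :: nat \<Rightarrow> 'm list) (b :: nat set \<Rightarrow> 'm list).
          wff L (ss @ ts) \<phi> \<and>
          (\<forall>i. a i \<in> tuples M (universe M) ss) \<and> (\<forall>I. b I \<in> tuples M (universe M) ts) \<and>
          (\<forall>i I. sat M (a i @ b I) \<phi> \<longleftrightarrow> i \<in> I))"

text \<open>
  \<open>T = T\<^sup>e\<^sup>q\<close>: for every equivalence relation \<open>E\<close> on a finite product of sorts which is definable
  without parameters, the quotient sort is already present. That is, there is a sort \<open>s\<close> and a
  formula \<open>\<pi>\<close> without parameters which defines (the graph of) a map from the product onto the
  sort \<open>s\<close> whose fibres are the \<open>E\<close>-classes.
\<close>

definition eq_closed :: "('s, 'f, 'r) language \<Rightarrow> ('s, 'f, 'r, 'm) struct \<Rightarrow> bool" where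
  "eq_closed L M \<longleftrightarrow>
     (\<forall>ss E. wff L (ss @ ss) E \<and>
        equiv (tuples M (universe M) ss)
          {(a, b). a \<in> tuples M (universe M) ss \<and> b \<in> tuples M (universe M) ss \<and> sat M (a @ b) E}
      \<longrightarrow> (\<exists>s \<pi> h. wff L (ss @ [s]) \<pi> \<and>
            h ` tuples M (universe M) ss = {m \<in> universe M. sort_of M m = s} \<and>
            (\<forall>a\<in>tuples M (universe M) ss. \<forall>m\<in>universe M. sort_of M m = s \<longrightarrow>
               (sat M (a @ [m]) \<pi> \<longleftrightarrow> h a = m)) \<and>
            (\<forall>a\<in>tuples M (universe M) ss. \<forall>b\<in>tuples M (universe M) ss.
               h a = h b \<longleftrightarrow> sat M (a @ b) E)))"

section \<open>Indiscernibility and Shelah-stability\<close>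

definition indiscernible_sequence ::
  "('s, 'f, 'r) language \<Rightarrow> ('s, 'f, 'r, 'm) struct \<Rightarrow> 'm set \<Rightarrow> (nat \<Rightarrow> 'm list) \<Rightarrow> bool" where
  "indiscernible_sequence L M A a \<longleftrightarrow>
     (\<forall>is js. length is = length js \<and> sorted_wrt (<) is \<and> sorted_wrt (<) js \<longrightarrow>
        tp L M (concat (map a is)) A = tp L M (concat (map a js)) A)"

definition indiscernible_set ::
  "('s, 'f, 'r) language \<Rightarrow> ('s, 'f, 'r, 'm) struct \<Rightarrow> 'm set \<Rightarrow> (nat \<Rightarrow> 'm list) \<Rightarrow> bool" where
  "indiscernible_set L M A a \<longleftrightarrow>
     (\<forall>is js. length is = length js \<and> distinct is \<and> distinct js \<longrightarrow>
        tp L M (concat (map a is)) A = tp L M (concat (map a js)) A)"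

definition Shelah_stable ::
  "('s, 'f, 'r) language \<Rightarrow> ('s, 'f, 'r, 'm) struct \<Rightarrow> 's list \<Rightarrow> 'm set
    \<Rightarrow> (('s, 'f, 'r) fm \<times> 'm list) set \<Rightarrow> bool" where
  "Shelah_stable L M ss A p \<longleftrightarrow>
     (\<exists>a :: nat \<Rightarrow> 'm list.
        (\<forall>i. realizes M ss (a i) p) \<and>
        indiscernible_sequence L M A a \<and>
        (\<forall>i. finitely_satisfiable_in M ss (tp L M (a i) (A \<union> (\<Union>j<i. set (a j)))) A) \<and>
        indiscernible_set L M A a)"

end

theory Submission
  imports Defs "HOL-Library.Multiset"
begin

text \<open>
  Let \<open>q\<close> be a type finitely satisfiable in \<open>A\<close>. A Morley list of \<open>q\<close> is a list in which each element
  realizes \<open>q\<close> over \<open>A\<close> and its predecessors; finite satisfiability makes its type over \<open>A\<close> depend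
  on its length only. If \<open>q\<close> is moreover definable over \<open>A\<close>, a realization of \<open>q\<close> over \<open>B\<close> still
  realizes \<open>q\<close> after adding to \<open>B\<close> any tuple whose type is finitely satisfiable in \<open>A\<close>. Hence a
  Morley list stays one under permutations, and Morley sequences are indiscernible sets.

  Conversely, an indiscernible set as in Shelah-stability is a Morley sequence of a global coheir
  \<open>r\<close>, and dependence turns membership in \<open>r\<close> into a majority vote along Morley lists, so \<open>r\<close> is
  definable. By the commutation above, every Morley list of another coheir \<open>q\<close> of \<open>p\<close> is, read with
  its last element first, a Morley list of \<open>r\<close>, so the same vote defines \<open>q\<close>.
\<close>

section \<open>Renaming of variables\<close>

text \<open>The coheir \<open>r\<close> obtained from the indiscernible set need not be the given
  \<open>q\<close>, and nothing is known at first about Morley sequences of \<open>q\<close>.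
  Commutation is therefore proved between a definable coheir and an arbitrary one; it transfers to
  \<open>q\<close> the types over \<open>A\<close> of Morley lists of \<open>r\<close>, and with
  them the vote. The length of the list that votes comes from dependence: for some k, no parameter b
  splits 2k terms of the indiscernible set into k first terms with one truth value and k last terms
  with the other. If k members of a Morley list of length 2k voted against the type, k further
  realizations over b would complete such a splitting. Condition (iii) provides a type on a small
  model only, so all notions are relative to a domain \<open>N\<close>, and Morley lists are built
  inside \<open>N\<close> by its saturation. Conversely, a model as in (iii) has to be found below
  \<open>\<kappa>\<close>: closing \<open>A\<close> under realizations of types over sets of size
  |A| + |T| yields one of size at most 2^(|A| + |T|), which is small because \<open>\<kappa>\<close>
  is a strong limit.\<close>

primrec rename_trm :: "(nat \<Rightarrow> nat) \<Rightarrow> 'f trm \<Rightarrow> 'f trm" where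
  "rename_trm r (Var i) = Var (r i)"
| "rename_trm r (App f ts) = App f (map (rename_trm r) ts)"

text \<open>Variables are only ever replaced by variables. Constants are entries of the parameter
  tuple at the end of the environment, so exchanging a variable for a constant is a renaming
  too.\<close>

primrec rename :: "(nat \<Rightarrow> nat) \<Rightarrow> ('s, 'f, 'r) fm \<Rightarrow> ('s, 'f, 'r) fm" where
  "rename r (Eq t u) = Eq (rename_trm r t) (rename_trm r u)"
| "rename r (Rel R ts) = Rel R (map (rename_trm r) ts)"
| "rename r (Neg \<phi>) = Neg (rename r \<phi>)"
| "rename r (Conj \<phi> \<psi>) = Conj (rename r \<phi>) (rename r \<psi>)"
| "rename r (Ex s \<phi>) = Ex s (rename (case_nat 0 (Suc \<circ> r)) \<phi>)"

lemma has_sort_rename: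
  assumes "has_sort L ss t s" and "\<And>i. i < length ss \<Longrightarrow> r i < length ss' \<and> ss' ! r i = ss ! i"
  shows "has_sort L ss' (rename_trm r t) s"
  using assms(1)
proof induct
  case (has_sort_Var i)
  then show ?case using assms(2)[of i] has_sort.has_sort_Var[of "r i" ss' L] by simp
next
  case (has_sort_App f us s ts)
  have "list_all2 (has_sort L ss') (map (rename_trm r) ts) us"
    using has_sort_App(2) unfolding list.rel_map by (rule list.rel_mono_strong) simp
  then show ?case using has_sort_App(1) by (simp add: has_sort.has_sort_App)
qed

lemma wff_rename:
  "wff L ss \<phi> \<Longrightarrow> (\<And>i. i < length ss \<Longrightarrow> r i < length ss' \<and> ss' ! r i = ss ! i)
    \<Longrightarrow> wff L ss' (rename r \<phi>)"
proof (induct \<phi> arbitrary: ss ss' r)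
  case (Eq t u)
  then obtain s where s: "has_sort L ss t s" "has_sort L ss u s" by auto
  have "has_sort L ss' (rename_trm r t) s" "has_sort L ss' (rename_trm r u) s"
    by (rule has_sort_rename[OF s(1) Eq(2)] has_sort_rename[OF s(2) Eq(2)], assumption)+
  then show ?case by auto
next
  case (Rel R ts)
  then obtain us where us: "rel_sig L R = Some us" "list_all2 (has_sort L ss) ts us" by auto
  have "list_all2 (has_sort L ss') (map (rename_trm r) ts) us"
    using us(2) unfolding list.rel_map
    by (rule list.rel_mono_strong) (rule has_sort_rename[OF _ Rel(2)])
  then show ?case using us by auto
next
  case (Ex s \<phi>)
  have "wff L (s # ss') (rename (case_nat 0 (Suc \<circ> r)) \<phi>)"
    by (rule Ex(1)[of "s # ss"]) (use Ex(2,3) in \<open>auto split: nat.split\<close>)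
  then show ?case by simp
next
  case (Neg \<phi>)
  then show ?case by simp
next
  case (Conj \<phi>1 \<phi>2)
  from Conj(1)[OF _ Conj(4)] Conj(2)[OF _ Conj(4)] Conj(3) show ?case by simp
qed

lemma eval_rename:
  assumes "has_sort L ss t s" and "\<And>i. i < length ss \<Longrightarrow> e' ! r i = e ! i"
  shows "eval_trm M e' (rename_trm r t) = eval_trm M e t"
  using assms(1)
proof induct
  case (has_sort_Var i)
  then show ?case using assms(2) by simp
next
  case (has_sort_App f us s ts)
  have "eval_trm M e' (rename_trm r t) = eval_trm M e t" if "t \<in> set ts" for t
    using has_sort_App(2) that by (auto simp: list_all2_conv_all_nth in_set_conv_nth)
  then have "map (eval_trm M e' \<circ> rename_trm r) ts = map (eval_trm M e) ts"
    by simp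
  then show ?case by (simp del: map_eq_conv)
qed

lemma sat_rename:
  "wff L ss \<phi> \<Longrightarrow> (\<And>i. i < length ss \<Longrightarrow> e' ! r i = e ! i)
    \<Longrightarrow> sat M e' (rename r \<phi>) \<longleftrightarrow> sat M e \<phi>"
proof (induct \<phi> arbitrary: ss e e' r)
  case (Eq t u)
  then obtain s where s: "has_sort L ss t s" "has_sort L ss u s" by auto
  have "eval_trm M e' (rename_trm r t) = eval_trm M e t"
    "eval_trm M e' (rename_trm r u) = eval_trm M e u"
    by (rule eval_rename[OF s(1) Eq(2)] eval_rename[OF s(2) Eq(2)], assumption)+
  then show ?case by simp
next
  case (Rel R ts)
  then obtain us where us: "list_all2 (has_sort L ss) ts us" by auto
  have "eval_trm M e' (rename_trm r t) = eval_trm M e t" if "t \<in> set ts" for t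
  proof -
    have "\<exists>s. has_sort L ss t s"
      using us that by (metis in_set_conv_nth list_all2_conv_all_nth)
    then show ?thesis using eval_rename[where ss = ss and e = e, OF _ Rel(2)] by blast
  qed
  then have "map (eval_trm M e' \<circ> rename_trm r) ts = map (eval_trm M e) ts"
    by simp
  then show ?case by (simp del: map_eq_conv)
next
  case (Ex s \<phi>)
  have "sat M (m # e') (rename (case_nat 0 (Suc \<circ> r)) \<phi>) \<longleftrightarrow> sat M (m # e) \<phi>" for m
    by (rule Ex(1)[of "s # ss"]) (use Ex(2,3) in \<open>auto split: nat.split\<close>)
  then show ?case by simp
next
  case (Neg \<phi>)
  then show ?case by (metis rename.simps(3) sat.simps(3) wff.simps(3))
next
  case (Conj \<phi>1 \<phi>2)
  have "sat M e' (rename r \<phi>1) \<longleftrightarrow> sat M e \<phi>1" "sat M e' (rename r \<phi>2) \<longleftrightarrow> sat M e \<phi>2"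
    using Conj(1)[of ss e' r e] Conj(2)[of ss e' r e] Conj(3,4) by auto
  then show ?case by simp
qed

section \<open>Definable predicates\<close>

lemma tuples_iff: "a \<in> tuples M X ss \<longleftrightarrow> set a \<subseteq> X \<and> map (sort_of M) a = ss"
  by (simp add: tuples_def)

lemma tuples_length: "a \<in> tuples M X ss \<Longrightarrow> length a = length ss"
  by (auto simp: tuples_def)

lemma tuples_append: "a \<in> tuples M X ss \<Longrightarrow> b \<in> tuples M X ts \<Longrightarrow> a @ b \<in> tuples M X (ss @ ts)"
  by (auto simp: tuples_def)

lemma tuples_mono: "a \<in> tuples M X ss \<Longrightarrow> X \<subseteq> Y \<Longrightarrow> a \<in> tuples M Y ss"
  by (auto simp: tuples_def)

lemma formulas_over_iff:
  "(\<phi>, b) \<in> formulas_over L M ss B \<longleftrightarrow> set b \<subseteq> B \<and> wff L (ss @ map (sort_of M) b) \<phi>"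
  by (simp add: formulas_over_def)

text \<open>Arguments are carried out with predicates instead of formulas, so that the order of
  variables and the choice of the parameter tuple stay hidden behind closure properties.\<close>

definition definable_pred ::
  "('s, 'f, 'r) language \<Rightarrow> ('s, 'f, 'r, 'm) struct \<Rightarrow> 'm set \<Rightarrow> 's list \<Rightarrow> ('m list \<Rightarrow> bool) \<Rightarrow> bool"
  where
  "definable_pred L M B ss P \<longleftrightarrow>
     (\<exists>(\<phi>, b)\<in>formulas_over L M ss B. \<forall>a\<in>tuples M (universe M) ss. sat M (a @ b) \<phi> \<longleftrightarrow> P a)"

lemma definable_predI:
  assumes "set b \<subseteq> B" "wff L (ss @ map (sort_of M) b) \<phi>"
    "\<And>a. a \<in> tuples M (universe M) ss \<Longrightarrow> sat M (a @ b) \<phi> \<longleftrightarrow> P a"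
  shows "definable_pred L M B ss P"
  using assms unfolding definable_pred_def formulas_over_def by auto

lemma definable_predE:
  assumes "definable_pred L M B ss P"
  obtains \<phi> b where "set b \<subseteq> B" "wff L (ss @ map (sort_of M) b) \<phi>"
    "\<And>a. a \<in> tuples M (universe M) ss \<Longrightarrow> sat M (a @ b) \<phi> \<longleftrightarrow> P a"
  using assms unfolding definable_pred_def formulas_over_def by auto

lemma definable_sat: "wff L ss \<phi> \<Longrightarrow> definable_pred L M B ss (\<lambda>a. sat M a \<phi>)"
  by (rule definable_predI[of "[]"]) auto

lemma definable_mono: "definable_pred L M B ss P \<Longrightarrow> B \<subseteq> B' \<Longrightarrow> definable_pred L M B' ss P"
  by (erule definable_predE, rule definable_predI) auto

lemma definable_cong:
  "definable_pred L M B ss P \<Longrightarrow> (\<And>a. a \<in> tuples M (universe M) ss \<Longrightarrow> P a \<longleftrightarrow> P' a)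
    \<Longrightarrow> definable_pred L M B ss P'"
  by (erule definable_predE, rule definable_predI) auto

text \<open>The formula itself is unchanged: \<open>(a @ b) @ c\<close> is
  \<open>a @ (b @ c)\<close>, so the last variables turn into the first parameters.\<close>

lemma definable_section:
  assumes "definable_pred L M B (ss @ ts) P" "b \<in> tuples M B ts" "B \<subseteq> universe M"
  shows "definable_pred L M B ss (\<lambda>a. P (a @ b))"
proof -
  obtain \<phi> c where c: "set c \<subseteq> B" "wff L ((ss @ ts) @ map (sort_of M) c) \<phi>"
    "\<And>a. a \<in> tuples M (universe M) (ss @ ts) \<Longrightarrow> sat M (a @ c) \<phi> \<longleftrightarrow> P a"
    using assms(1) unfolding definable_pred_def formulas_over_def by auto
  show ?thesis
  proof (rule definable_predI[of "b @ c"])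
    fix a assume "a \<in> tuples M (universe M) ss"
    then have "a @ b \<in> tuples M (universe M) (ss @ ts)"
      using assms by (auto intro: tuples_append tuples_mono)
    from c(3)[OF this] show "sat M (a @ b @ c) \<phi> = P (a @ b)" by simp
  qed (use assms c in \<open>auto simp: tuples_iff\<close>)
qed

text \<open>
  Substituting into each variable of \<open>P\<close> either a variable of the new context or a constant
  from \<open>B\<close>.
\<close>

lemma definable_reindex:
  assumes P: "definable_pred L M B us P"
    and g: "\<And>e. e \<in> tuples M (universe M) ss \<Longrightarrow> g e \<in> tuples M (universe M) us"
    and co: "\<And>i. i < length us \<Longrightarrow>
      (\<exists>j<length ss. ss ! j = us ! i \<and> (\<forall>e\<in>tuples M (universe M) ss. g e ! i = e ! j)) \<or>
      (\<exists>m\<in>B. sort_of M m = us ! i \<and> (\<forall>e\<in>tuples M (universe M) ss. g e ! i = m))"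
  shows "definable_pred L M B ss (\<lambda>e. P (g e))"
proof -
  obtain \<phi> b where b: "set b \<subseteq> B" "wff L (us @ map (sort_of M) b) \<phi>"
    "\<And>a. a \<in> tuples M (universe M) us \<Longrightarrow> sat M (a @ b) \<phi> \<longleftrightarrow> P a"
    using P unfolding definable_pred_def formulas_over_def by auto
  \<comment> \<open>\<open>K m i\<close> says that the constant \<open>m\<close> may be put for
    variable \<open>i\<close>. The chosen constants form the list \<open>d\<close>, placed before
    the old parameters \<open>b\<close>; the renaming \<open>r\<close> then points into the context
    \<open>ss\<close>, into \<open>d\<close> or into \<open>b\<close>.\<close>
  define K where "K m i \<longleftrightarrow> m \<in> B \<and> sort_of M m = us ! i \<and>
    (\<forall>e\<in>tuples M (universe M) ss. g e ! i = m)" for m i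
  define c where "c i = (SOME m. K m i)" for i
  define d where "d = map c (filter (\<lambda>i. \<exists>m. K m i) [0..<length us])"
  have c: "K (c i) i" if "\<exists>m. K m i" for i
    using someI_ex[OF that] unfolding c_def .
  have len: "length e = length ss" "length (g e) = length us"
    if "e \<in> tuples M (universe M) ss" for e
    using that g by (auto dest: tuples_length)
  have "\<exists>k<length (ss @ map (sort_of M) (d @ b)).
      (ss @ map (sort_of M) (d @ b)) ! k = (us @ map (sort_of M) b) ! i \<and>
      (\<forall>e\<in>tuples M (universe M) ss. (e @ d @ b) ! k = (g e @ b) ! i)"
    if i: "i < length (us @ map (sort_of M) b)" for i
  proof (cases "i < length us")
    case False
    then obtain i' where i': "i = length us + i'" by (metis le_add_diff_inverse not_less)
    show ?thesis using i i' len
      by (intro exI[of _ "length ss + length d + i'"]) (simp add: nth_append)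
  next
    case iu: True
    from co[OF iu] show ?thesis
    proof (elim disjE exE bexE conjE)
      fix j assume "j < length ss" "ss ! j = us ! i"
        "\<forall>e\<in>tuples M (universe M) ss. g e ! i = e ! j"
      then show ?thesis using iu len
        by (intro exI[of _ j]) (auto simp: nth_append)
    next
      fix m assume "m \<in> B" "sort_of M m = us ! i"
        "\<forall>e\<in>tuples M (universe M) ss. g e ! i = m"
      then have ex: "\<exists>m. K m i" unfolding K_def by blast
      then have "c i \<in> set d" using iu unfolding d_def by auto
      then obtain k where k: "k < length d" "d ! k = c i" by (auto simp: in_set_conv_nth)
      show ?thesis
        by (rule exI[of _ "length ss + k"])
          (use iu k len c[OF ex] in \<open>auto simp: nth_append K_def\<close>)
    qed
  qed
  then obtain r where r: "\<And>i. i < length (us @ map (sort_of M) b) \<Longrightarrow>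
      r i < length (ss @ map (sort_of M) (d @ b)) \<and>
      (ss @ map (sort_of M) (d @ b)) ! r i = (us @ map (sort_of M) b) ! i \<and>
      (\<forall>e\<in>tuples M (universe M) ss. (e @ d @ b) ! r i = (g e @ b) ! i)"
    by metis
  show ?thesis
  proof (rule definable_predI[of "d @ b"])
    show "set (d @ b) \<subseteq> B" using b c by (auto simp: d_def K_def)
    show "wff L (ss @ map (sort_of M) (d @ b)) (rename r \<phi>)"
      by (rule wff_rename[OF b(2)]) (use r in blast)
    fix e assume e: "e \<in> tuples M (universe M) ss"
    have "sat M (e @ d @ b) (rename r \<phi>) \<longleftrightarrow> sat M (g e @ b) \<phi>"
      by (rule sat_rename[OF b(2)]) (use r e in blast)
    then show "sat M (e @ d @ b) (rename r \<phi>) = P (g e)"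
      using b(3)[OF g[OF e]] by simp
  qed
qed

lemma definable_swap:
  assumes "definable_pred L M B (ss @ us) P"
  shows "definable_pred L M B (us @ ss) (\<lambda>e. P (drop (length us) e @ take (length us) e))"
proof (rule definable_reindex[OF assms])
  fix e assume "e \<in> tuples M (universe M) (us @ ss)"
  then show "drop (length us) e @ take (length us) e \<in> tuples M (universe M) (ss @ us)"
    by (auto simp: tuples_iff drop_map[symmetric] take_map[symmetric]
        dest!: in_set_dropD in_set_takeD)
next
  fix i assume i: "i < length (ss @ us)"
  show "(\<exists>j<length (us @ ss). (us @ ss) ! j = (ss @ us) ! i \<and>
      (\<forall>e\<in>tuples M (universe M) (us @ ss). (drop (length us) e @ take (length us) e) ! i = e ! j)) \<or>
      (\<exists>m\<in>B. sort_of M m = (ss @ us) ! i \<and>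
      (\<forall>e\<in>tuples M (universe M) (us @ ss). (drop (length us) e @ take (length us) e) ! i = m))"
    by (rule disjI1, rule exI[of _ "if i < length ss then length us + i else i - length ss"])
      (use i in \<open>auto simp: nth_append dest!: tuples_length\<close>)
qed

lemma definable_left_section:
  assumes "definable_pred L M B (ss @ us) P" "a \<in> tuples M B ss" "B \<subseteq> universe M"
  shows "definable_pred L M B us (\<lambda>e. P (a @ e))"
  using definable_section[OF definable_swap[OF assms(1)] assms(2,3)]
  by (rule definable_cong) (auto dest: tuples_length)

text \<open>Converse of sectioning: a parameter of the formula that occurs in \<open>c\<close> is
  read off from a chosen position \<open>ix\<close> of \<open>c\<close> and thereby becomes a
  variable. This turns truth over \<open>B\<close> and \<open>c\<close> into a property over
  \<open>B\<close> of a tuple extended by \<open>c\<close>.\<close>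

lemma definable_unsection:
  assumes P: "definable_pred L M (B \<union> set c) ss P" and c: "c \<in> tuples M (universe M) us"
    and B: "B \<subseteq> universe M"
  obtains P' where "definable_pred L M B (ss @ us) P'"
    "\<And>a. a \<in> tuples M (universe M) ss \<Longrightarrow> P a \<longleftrightarrow> P' (a @ c)"
proof -
  obtain \<phi> b where b: "set b \<subseteq> B \<union> set c" "wff L (ss @ map (sort_of M) b) \<phi>"
    "\<And>a. a \<in> tuples M (universe M) ss \<Longrightarrow> sat M (a @ b) \<phi> \<longleftrightarrow> P a"
    using P unfolding definable_pred_def formulas_over_def by auto
  have "\<exists>k. m \<in> set c \<longrightarrow> k < length c \<and> c ! k = m" for m
    by (auto simp: in_set_conv_nth)
  then obtain ix where ix: "\<And>m. m \<in> set c \<Longrightarrow> ix m < length c \<and> c ! ix m = m" by metis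
  define g where "g e = take (length ss) e @
      map (\<lambda>m. if m \<in> set c then e ! (length ss + ix m) else m) b" for e
  have len: "length c = length us" using c by (simp add: tuples_length)
  have us: "us = map (sort_of M) c" using c by (simp add: tuples_iff)
  show thesis
  proof
    show "definable_pred L M B (ss @ us) (\<lambda>e. sat M (g e) \<phi>)"
    proof (rule definable_reindex[OF definable_sat[OF b(2)]])
      fix e assume e: "e \<in> tuples M (universe M) (ss @ us)"
      then have le: "length e = length ss + length us" by (simp add: tuples_length)
      have s: "map (sort_of M) e = ss @ us" using e by (simp add: tuples_iff)
      have "sort_of M (e ! (length ss + ix m)) = sort_of M m" if "m \<in> set c" for m
      proof -
        have "sort_of M (e ! (length ss + ix m)) = map (sort_of M) e ! (length ss + ix m)"
          using ix[OF that] le len by simp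
        also have "\<dots> = sort_of M m" using ix[OF that] unfolding s by (simp add: us)
        finally show ?thesis .
      qed
      moreover have "e ! (length ss + ix m) \<in> universe M" if "m \<in> set c" for m
        using e ix[OF that] le len by (auto simp: tuples_iff subset_eq)
      ultimately show "g e \<in> tuples M (universe M) (ss @ map (sort_of M) b)"
        using e b(1) B s by (auto simp: g_def tuples_iff take_map[symmetric] dest!: in_set_takeD)
    next
      fix i assume i: "i < length (ss @ map (sort_of M) b)"
      let ?m = "b ! (i - length ss)"
      have ge: "\<forall>e\<in>tuples M (universe M) (ss @ us). g e ! i =
         (if i < length ss then e ! i else if ?m \<in> set c then e ! (length ss + ix ?m) else ?m)"
        using i by (auto simp: g_def nth_append dest!: tuples_length)
      show "(\<exists>j<length (ss @ us). (ss @ us) ! j = (ss @ map (sort_of M) b) ! i \<and>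
         (\<forall>e\<in>tuples M (universe M) (ss @ us). g e ! i = e ! j)) \<or>
         (\<exists>m\<in>B. sort_of M m = (ss @ map (sort_of M) b) ! i \<and>
         (\<forall>e\<in>tuples M (universe M) (ss @ us). g e ! i = m))"
      proof (cases "i < length ss \<or> ?m \<in> set c")
        case True
        then show ?thesis using ge ix[of ?m] i
          by (intro disjI1 exI[of _ "if i < length ss then i else length ss + ix ?m"])
            (auto simp: nth_append us)
      next
        case False
        then have "?m \<in> set b" using i by auto
        then show ?thesis using ge i False b(1)
          by (intro disjI2 bexI[of _ ?m]) (auto simp: nth_append)
      qed
    qed
    fix a assume a: "a \<in> tuples M (universe M) ss"
    then have "g (a @ c) = a @ b"
      using ix by (auto simp: g_def tuples_length nth_append intro!: map_idI)
    then show "P a \<longleftrightarrow> sat M (g (a @ c)) \<phi>" using b(3)[OF a] by simp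
  qed
qed

lemma definable_not: "definable_pred L M B ss P \<Longrightarrow> definable_pred L M B ss (\<lambda>a. \<not> P a)"
  by (erule definable_predE, rule_tac \<phi> = "Neg \<phi>" in definable_predI) auto

lemma definable_conj:
  assumes P: "definable_pred L M B ss P" and Q: "definable_pred L M B ss Q" and B: "B \<subseteq> universe M"
  shows "definable_pred L M B ss (\<lambda>a. P a \<and> Q a)"
proof -
  obtain \<phi> b where b: "set b \<subseteq> B" "wff L (ss @ map (sort_of M) b) \<phi>"
    "\<And>a. a \<in> tuples M (universe M) ss \<Longrightarrow> sat M (a @ b) \<phi> \<longleftrightarrow> P a"
    using P unfolding definable_pred_def formulas_over_def by auto
  obtain \<psi> c where c: "set c \<subseteq> B" "wff L (ss @ map (sort_of M) c) \<psi>"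
    "\<And>a. a \<in> tuples M (universe M) ss \<Longrightarrow> sat M (a @ c) \<psi> \<longleftrightarrow> Q a"
    using Q unfolding definable_pred_def formulas_over_def by auto
  let ?r = "\<lambda>i. if i < length ss then i else length b + i"
  have "wff L (ss @ map (sort_of M) (b @ c)) (rename id \<phi>)"
    by (rule wff_rename[OF b(2)]) (auto simp: nth_append)
  moreover have "wff L (ss @ map (sort_of M) (b @ c)) (rename ?r \<psi>)"
    by (rule wff_rename[OF c(2)]) (auto simp: nth_append)
  moreover have "sat M (a @ b @ c) (rename id \<phi>) \<longleftrightarrow> P a" "sat M (a @ b @ c) (rename ?r \<psi>) \<longleftrightarrow> Q a"
    if a: "a \<in> tuples M (universe M) ss" for a
  proof -
    have l: "length a = length ss" using a by (rule tuples_length)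
    have "sat M (a @ b @ c) (rename id \<phi>) \<longleftrightarrow> sat M (a @ b) \<phi>"
      by (rule sat_rename[OF b(2)]) (auto simp: nth_append l)
    then show "sat M (a @ b @ c) (rename id \<phi>) \<longleftrightarrow> P a" using b(3)[OF a] by simp
    have "sat M (a @ b @ c) (rename ?r \<psi>) \<longleftrightarrow> sat M (a @ c) \<psi>"
      by (rule sat_rename[OF c(2)]) (auto simp: nth_append l)
    then show "sat M (a @ b @ c) (rename ?r \<psi>) \<longleftrightarrow> Q a" using c(3)[OF a] by simp
  qed
  ultimately show ?thesis
    using b(1) c(1)
    by (intro definable_predI[of "b @ c" _ _ _ _ "Conj (rename id \<phi>) (rename ?r \<psi>)"]) auto
qed

lemma definable_True: "definable_pred L M B ss (\<lambda>a. True)"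
proof (rule definable_predI[of "[]"])
  fix s :: 'a
  \<comment> \<open>There is no constant for truth, and the context \<open>ss\<close> may be empty,
    so the tautology uses a variable of its own, bound by a quantifier.\<close>
  show "wff L (ss @ map (sort_of M) []) (Neg (Ex s (Neg (Eq (Var 0) (Var 0)))))"
    using has_sort_Var[of 0 "s # ss" L] by auto
qed auto

lemma definable_Ball:
  assumes "finite I" "\<And>i. i \<in> I \<Longrightarrow> definable_pred L M B ss (P i)" "B \<subseteq> universe M"
  shows "definable_pred L M B ss (\<lambda>a. \<forall>i\<in>I. P i a)"
  using assms(1,2)
proof (induct rule: finite_induct)
  case empty
  show ?case by (simp add: definable_True)
next
  case (insert i I)
  then have "definable_pred L M B ss (\<lambda>a. P i a \<and> (\<forall>i\<in>I. P i a))"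
    by (intro definable_conj assms(3)) auto
  then show ?case by (rule definable_cong) auto
qed

lemma definable_Bex:
  assumes "finite I" "\<And>i. i \<in> I \<Longrightarrow> definable_pred L M B ss (P i)" "B \<subseteq> universe M"
  shows "definable_pred L M B ss (\<lambda>a. \<exists>i\<in>I. P i a)"
proof -
  have "definable_pred L M B ss (\<lambda>a. \<not> (\<forall>i\<in>I. \<not> P i a))"
    using assms by (intro definable_not definable_Ball) auto
  then show ?thesis by simp
qed

lemma definable_Ex:
  assumes "definable_pred L M B (ts @ ss) P"
  shows "definable_pred L M B ss (\<lambda>a. \<exists>b\<in>tuples M (universe M) ts. P (b @ a))"
  using assms
proof (induct ts arbitrary: P)
  case Nil
  then show ?case by (simp add: tuples_iff)
next
  case (Cons t ts)
  obtain \<phi> c where c: "set c \<subseteq> B" "wff L ((t # ts @ ss) @ map (sort_of M) c) \<phi>"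
    "\<And>a. a \<in> tuples M (universe M) (t # ts @ ss) \<Longrightarrow> sat M (a @ c) \<phi> \<longleftrightarrow> P a"
    using Cons(2) unfolding definable_pred_def formulas_over_def by auto
  let ?P = "\<lambda>e. \<exists>m\<in>universe M. sort_of M m = t \<and> P (m # e)"
  have "definable_pred L M B (ts @ ss) ?P"
  proof (rule definable_predI[OF c(1)])
    show "wff L ((ts @ ss) @ map (sort_of M) c) (Ex t \<phi>)" using c(2) by simp
    fix e assume "e \<in> tuples M (universe M) (ts @ ss)"
    then have "m # e \<in> tuples M (universe M) (t # ts @ ss)"
      if "m \<in> universe M" "sort_of M m = t" for m
      using that by (auto simp: tuples_iff)
    then show "sat M (e @ c) (Ex t \<phi>) = ?P e" using c(3) by fastforce
  qed
  from Cons(1)[OF this] show ?case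
  proof (rule definable_cong)
    fix a
    have "b \<in> tuples M (universe M) (t # ts) \<longleftrightarrow>
      (\<exists>m b'. b = m # b' \<and> m \<in> universe M \<and> sort_of M m = t \<and> b' \<in> tuples M (universe M) ts)" for b
      by (cases b) (auto simp: tuples_iff)
    then show "(\<exists>b\<in>tuples M (universe M) ts. \<exists>m\<in>universe M. sort_of M m = t \<and> P (m # b @ a)) \<longleftrightarrow>
      (\<exists>b\<in>tuples M (universe M) (t # ts). P (b @ a))"
      by (metis (no_types, opaque_lifting) append_Cons)
  qed
qed

lemma tp_eq_iff:
  assumes "u \<in> tuples M (universe M) us" "v \<in> tuples M (universe M) us"
  shows "tp L M u B = tp L M v B \<longleftrightarrow> (\<forall>P. definable_pred L M B us P \<longrightarrow> (P u \<longleftrightarrow> P v))"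
    (is "?l \<longleftrightarrow> ?r")
proof
  have s: "map (sort_of M) u = us" "map (sort_of M) v = us" using assms by (auto simp: tuples_iff)
  show ?r if l: ?l
  proof (intro allI impI)
    fix P assume "definable_pred L M B us P"
    then obtain \<phi> b where b: "set b \<subseteq> B" "wff L (us @ map (sort_of M) b) \<phi>"
      "\<And>a. a \<in> tuples M (universe M) us \<Longrightarrow> sat M (a @ b) \<phi> \<longleftrightarrow> P a"
      unfolding definable_pred_def formulas_over_def by auto
    have "(\<phi>, b) \<in> tp L M u B \<longleftrightarrow> (\<phi>, b) \<in> tp L M v B" using l by simp
    then show "P u \<longleftrightarrow> P v" using b assms s by (auto simp: tp_def formulas_over_iff)
  qed
  show ?l if r: ?r
  proof -
    have "sat M (u @ b) \<phi> \<longleftrightarrow> sat M (v @ b) \<phi>" if "(\<phi>, b) \<in> formulas_over L M us B" for \<phi> b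
    proof -
      have "definable_pred L M B us (\<lambda>a. sat M (a @ b) \<phi>)"
        by (rule definable_predI[of b]) (use that in \<open>auto simp: formulas_over_iff\<close>)
      then show ?thesis using r by blast
    qed
    then show ?thesis by (auto simp: tp_def s)
  qed
qed

section \<open>Compactness\<close>

text \<open>Zorn's lemma: a finite subset of the union of a chain already lies in a member of the
  chain. Maximality is recorded as a finite obstruction to adding any further element, the form
  needed to show completeness.\<close>

lemma exists_maximal_finite_character:
  assumes "G \<subseteq> U" and "\<forall>F\<subseteq>G. finite F \<longrightarrow> P F"
  shows "\<exists>q. G \<subseteq> q \<and> q \<subseteq> U \<and> (\<forall>F\<subseteq>q. finite F \<longrightarrow> P F) \<and>
    (\<forall>x\<in>U. x \<notin> q \<longrightarrow> (\<exists>F\<subseteq>q. finite F \<and> \<not> P (insert x F)))"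
proof -
  define S where "S = {q. G \<subseteq> q \<and> q \<subseteq> U \<and> (\<forall>F\<subseteq>q. finite F \<longrightarrow> P F)}"
  have "\<exists>q\<in>S. \<forall>q'\<in>S. q \<subseteq> q' \<longrightarrow> q' = q"
  proof (rule subset_Zorn_nonempty)
    show "S \<noteq> {}" using assms unfolding S_def by blast
    fix \<C> assume C: "\<C> \<noteq> {}" "subset.chain S \<C>"
    then have CS: "\<C> \<subseteq> S" by (simp add: subset_chain_def)
    have "P F" if F: "F \<subseteq> \<Union>\<C>" "finite F" for F
    proof -
      obtain q where "q \<in> \<C>" "F \<subseteq> q"
        using finite_subset_Union_chain[OF F(2,1) C] by blast
      then show ?thesis using CS F(2) unfolding S_def by blast
    qed
    moreover have "\<Union>\<C> \<subseteq> U" "G \<subseteq> \<Union>\<C>" using C(1) CS unfolding S_def by blast+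
    ultimately show "\<Union>\<C> \<in> S" unfolding S_def by blast
  qed
  then obtain q where q: "q \<in> S" and max: "\<And>q'. q' \<in> S \<Longrightarrow> q \<subseteq> q' \<Longrightarrow> q' = q" by blast
  show ?thesis
  proof (rule exI[of _ q], intro conjI ballI impI)
    show "G \<subseteq> q" "q \<subseteq> U" "\<forall>F\<subseteq>q. finite F \<longrightarrow> P F" using q by (auto simp: S_def)
    fix x assume x: "x \<in> U" "x \<notin> q"
    have "insert x q \<notin> S" using max[of "insert x q"] x(2) by blast
    then obtain F where F: "F \<subseteq> insert x q" "finite F" "\<not> P F"
      using q x(1) unfolding S_def by blast
    then have "x \<in> F" using q unfolding S_def by blast
    then have "insert x (F - {x}) = F" by blast
    then show "\<exists>F\<subseteq>q. finite F \<and> \<not> P (insert x F)"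
      using F by (intro exI[of _ "F - {x}"]) auto
  qed
qed

text \<open>Witnesses are confined to a set \<open>X\<close>: all tuples give ordinary completions,
  tuples of \<open>A\<close> give coheirs. If a maximal set omitted both \<open>\<phi>\<close> and
  its negation, the two finite obstructions would have a common witness in \<open>X\<close>, and
  that witness satisfies one of the two formulas.\<close>

lemma complete_types_extend:
  assumes \<Gamma>: "\<Gamma> \<subseteq> formulas_over L M ss B" and X: "X \<subseteq> tuples M (universe M) ss"
    and fin: "\<And>F. F \<subseteq> \<Gamma> \<Longrightarrow> finite F \<Longrightarrow> \<exists>a\<in>X. \<forall>(\<phi>, b)\<in>F. sat M (a @ b) \<phi>"
  shows "\<exists>q. q \<in> complete_types L M ss B \<and> \<Gamma> \<subseteq> q \<and>
    (\<forall>F\<subseteq>q. finite F \<longrightarrow> (\<exists>a\<in>X. \<forall>(\<phi>, b)\<in>F. sat M (a @ b) \<phi>))"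
proof -
  have fin': "\<forall>F\<subseteq>\<Gamma>. finite F \<longrightarrow> (\<exists>a\<in>X. \<forall>(\<phi>, b)\<in>F. sat M (a @ b) \<phi>)"
    using fin by simp
  from exists_maximal_finite_character[where
      P = "\<lambda>F. \<exists>a\<in>X. \<forall>(\<phi>, b)\<in>F. sat M (a @ b) \<phi>", OF \<Gamma> fin']
  obtain q where q: "\<Gamma> \<subseteq> q" "q \<subseteq> formulas_over L M ss B"
    and qf': "\<forall>F\<subseteq>q. finite F \<longrightarrow> (\<exists>a\<in>X. \<forall>(\<phi>, b)\<in>F. sat M (a @ b) \<phi>)"
    and add': "\<forall>x\<in>formulas_over L M ss B. x \<notin> q \<longrightarrow>
      (\<exists>F\<subseteq>q. finite F \<and> \<not> (\<exists>a\<in>X. \<forall>(\<phi>, b)\<in>insert x F. sat M (a @ b) \<phi>))"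
    by (elim exE conjE) (rule that)
  note qf = qf'[rule_format] and add = add'[rule_format]
  have "(\<phi>, b) \<in> q \<or> (Neg \<phi>, b) \<in> q" if \<phi>: "(\<phi>, b) \<in> formulas_over L M ss B" for \<phi> b
  proof (rule ccontr)
    assume n: "\<not> ?thesis"
    have N\<phi>: "(Neg \<phi>, b) \<in> formulas_over L M ss B" using \<phi> by (simp add: formulas_over_iff)
    from n have n': "(\<phi>, b) \<notin> q" "(Neg \<phi>, b) \<notin> q" by auto
    from add[OF \<phi> n'(1)] obtain F where F: "F \<subseteq> q" "finite F"
      "\<not> (\<exists>a\<in>X. \<forall>(\<phi>, b)\<in>insert (\<phi>, b) F. sat M (a @ b) \<phi>)" by (elim exE conjE)
    from add[OF N\<phi> n'(2)] obtain G where G: "G \<subseteq> q" "finite G"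
      "\<not> (\<exists>a\<in>X. \<forall>(\<phi>, b)\<in>insert (Neg \<phi>, b) G. sat M (a @ b) \<phi>)" by (elim exE conjE)
    have "F \<union> G \<subseteq> q" "finite (F \<union> G)" using F G by auto
    from qf[OF this] obtain a where a: "a \<in> X" "\<forall>(\<phi>, b)\<in>F \<union> G. sat M (a @ b) \<phi>" by (rule bexE)
    then have FG: "\<forall>(\<phi>, b)\<in>F. sat M (a @ b) \<phi>" "\<forall>(\<phi>, b)\<in>G. sat M (a @ b) \<phi>" by auto
    show False
    proof (cases "sat M (a @ b) \<phi>")
      case True
      then have "\<forall>(\<phi>, b)\<in>insert (\<phi>, b) F. sat M (a @ b) \<phi>" using FG(1) by simp
      then show False using F(3) a(1) by metis
    next
      case False
      then have "\<forall>(\<phi>, b)\<in>insert (Neg \<phi>, b) G. sat M (a @ b) \<phi>" using FG(2) by simp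
      then show False using G(3) a(1) by metis
    qed
  qed
  moreover have "\<exists>a\<in>tuples M (universe M) ss. \<forall>(\<phi>, b)\<in>F. sat M (a @ b) \<phi>"
    if "F \<subseteq> q" "finite F" for F
    using qf[OF that] X by (meson subsetD)
  ultimately have "q \<in> complete_types L M ss B"
    using q(2) unfolding complete_types_def by (intro CollectI conjI ballI allI impI) auto
  then show ?thesis using q(1) qf' by (intro exI[of _ q] conjI)
qed

lemma sat_finite_conj:
  assumes "finite F" "F \<subseteq> formulas_over L M ss B" "B \<subseteq> universe M"
  shows "definable_pred L M B ss (\<lambda>a. \<forall>(\<phi>, b)\<in>F. sat M (a @ b) \<phi>)"
proof -
  have "definable_pred L M B ss (\<lambda>a. sat M (a @ snd x) (fst x))" if "x \<in> F" for x
  proof -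
    have "(fst x, snd x) \<in> formulas_over L M ss B" using that assms(2) by auto
    then show ?thesis
      unfolding formulas_over_iff by (intro definable_predI[of "snd x" _ _ _ _ "fst x"]) auto
  qed
  from definable_Ball[OF assms(1) this assms(3)] show ?thesis
    by (rule definable_cong) (auto simp: case_prod_beta)
qed

lemma set_ordLess_Cinfinite: "Cinfinite \<kappa> \<Longrightarrow> |set a| <o \<kappa>"
  by (rule Cfinite_ordLess_Cinfinite)
    (simp_all add: cfinite_def Field_card_of card_of_card_order_on)

lemma Cinfinite_Un_set:
  assumes "Cinfinite \<kappa>" "|B| <o \<kappa>"
  shows "|B \<union> set a| <o \<kappa>"
proof -
  have "|set a| <o \<kappa>" using assms(1) by (rule set_ordLess_Cinfinite)
  then show ?thesis
    using card_of_Un_ordLess_infinite_Field[of \<kappa> B "set a"] assms unfolding cinfinite_def by blast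
qed

text \<open>\<open>saturated\<close> speaks of one variable only, so a tuple is realized by
  induction on its length: the tail is chosen first, then the head over \<open>B\<close> and the
  tail.\<close>

lemma saturated_tuple:
  assumes sat: "saturated \<kappa> L M" and inf: "Cinfinite \<kappa>"
    and B: "B \<subseteq> universe M" "|B| <o \<kappa>"
    and \<Gamma>: "\<Gamma> \<subseteq> formulas_over L M ss B"
    and fin: "\<And>F. F \<subseteq> \<Gamma> \<Longrightarrow> finite F \<Longrightarrow>
      \<exists>a\<in>tuples M (universe M) ss. \<forall>(\<phi>, b)\<in>F. sat M (a @ b) \<phi>"
  shows "\<exists>a. realizes M ss a \<Gamma>"
  using B \<Gamma> fin
proof (induct ss arbitrary: \<Gamma>)
  case Nil
  have "\<forall>(\<phi>, b)\<in>\<Gamma>. sat M b \<phi>"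
  proof clarify
    fix \<phi> b assume "(\<phi>, b) \<in> \<Gamma>"
    then have "\<exists>a\<in>tuples M (universe M) []. \<forall>(\<phi>, b)\<in>{(\<phi>, b)}. sat M (a @ b) \<phi>"
      by (intro Nil(4)) auto
    then show "sat M b \<phi>" by (simp add: tuples_iff)
  qed
  then show ?case by (auto simp: realizes_def tuples_iff)
next
  case (Cons s ss)
  have "\<exists>q. q \<in> complete_types L M (s # ss) B \<and> \<Gamma> \<subseteq> q \<and> (\<forall>F\<subseteq>q. finite F \<longrightarrow>
    (\<exists>a\<in>tuples M (universe M) (s # ss). \<forall>(\<phi>, b)\<in>F. sat M (a @ b) \<phi>))"
    using Cons(4) order_refl Cons(5) by (rule complete_types_extend)
  then obtain q where q: "q \<in> complete_types L M (s # ss) B" "\<Gamma> \<subseteq> q" by (elim exE conjE)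
  have qs: "q \<subseteq> formulas_over L M (s # ss) B" using q(1) by (simp add: complete_types_def)
  have qf: "\<exists>a\<in>tuples M (universe M) (s # ss). \<forall>(\<phi>, b)\<in>F. sat M (a @ b) \<phi>"
    if "F \<subseteq> q" "finite F" for F
    using q(1) that by (simp add: complete_types_def)
  define H where "H a F \<longleftrightarrow> (\<forall>(\<phi>, b)\<in>F. sat M (a @ b) \<phi>)" for a F
  have H_Un: "H a (\<Union>\<F>) \<longleftrightarrow> (\<forall>F\<in>\<F>. H a F)" for a \<F> unfolding H_def by blast
  \<comment> \<open>\<open>\<Delta>\<close> collects what finitely many formulas of \<open>q\<close>
    force about the tail. It is the trace of \<open>q\<close> on the variables \<open>ss\<close>,
    that is, \<open>q\<close> with its first variable quantified away.\<close>
  define \<Delta> where "\<Delta> = {x \<in> formulas_over L M ss B. \<exists>F\<subseteq>q. finite F \<and>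
    (\<forall>m a'. m # a' \<in> tuples M (universe M) (s # ss) \<longrightarrow> H (m # a') F \<longrightarrow> H a' {x})}"
  have "\<exists>a'. realizes M ss a' \<Delta>"
  proof (rule Cons(1)[OF Cons(2,3)])
    show "\<Delta> \<subseteq> formulas_over L M ss B" by (auto simp: \<Delta>_def)
    fix F assume F: "F \<subseteq> \<Delta>" "finite F"
    have "\<forall>x\<in>F. \<exists>G. G \<subseteq> q \<and> finite G \<and>
      (\<forall>m a'. m # a' \<in> tuples M (universe M) (s # ss) \<longrightarrow> H (m # a') G \<longrightarrow> H a' {x})"
      using F(1) unfolding \<Delta>_def by blast
    from bchoice[OF this] obtain G where G: "\<forall>x\<in>F. G x \<subseteq> q \<and> finite (G x) \<and>
      (\<forall>m a'. m # a' \<in> tuples M (universe M) (s # ss) \<longrightarrow> H (m # a') (G x) \<longrightarrow> H a' {x})" ..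
    have "\<Union>(G ` F) \<subseteq> q" "finite (\<Union>(G ` F))" using G F(2) by auto
    from qf[OF this] obtain a where a: "a \<in> tuples M (universe M) (s # ss)" "H a (\<Union>(G ` F))"
      unfolding H_def by (rule bexE)
    then obtain m a' where m: "a = m # a'" "a' \<in> tuples M (universe M) ss"
      by (cases a) (auto simp: tuples_iff)
    have "H a' {x}" if x: "x \<in> F" for x
      using G x a unfolding m(1) H_Un by blast
    then have "H a' F" by (auto simp: H_def)
    then show "\<exists>a'\<in>tuples M (universe M) ss. \<forall>(\<phi>, b)\<in>F. sat M (a' @ b) \<phi>"
      using m(2) unfolding H_def by (rule bexI)
  qed
  then obtain a' where a': "a' \<in> tuples M (universe M) ss" and Ha': "H a' \<Delta>"
    unfolding realizes_def H_def by (elim exE conjE)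
  have s': "map (sort_of M) a' = ss" using a' by (simp add: tuples_iff)
  let ?\<Gamma> = "(\<lambda>(\<phi>, b). (\<phi>, a' @ b)) ` q"
  have B': "B \<union> set a' \<subseteq> universe M" using Cons(2) a' by (auto simp: tuples_iff)
  have "?\<Gamma> \<subseteq> formulas_over L M [s] (B \<union> set a')"
  proof clarify
    fix \<phi> b assume "(\<phi>, b) \<in> q"
    then have "(\<phi>, b) \<in> formulas_over L M (s # ss) B" using qs by blast
    then show "(\<phi>, a' @ b) \<in> formulas_over L M [s] (B \<union> set a')"
      using s' by (auto simp: formulas_over_iff)
  qed
  moreover have "\<exists>a\<in>tuples M (universe M) [s]. H a F" if F: "F \<subseteq> ?\<Gamma>" "finite F" for F
  proof -
    from finite_subset_image[OF F(2,1)]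
    obtain G where G: "G \<subseteq> q" "finite G" "F = (\<lambda>(\<phi>, b). (\<phi>, a' @ b)) ` G"
      by (elim exE conjE)
    \<comment> \<open>That some head satisfies \<open>G\<close> is a formula about the tail and
      follows from \<open>G\<close>, so it belongs to \<open>\<Delta>\<close> and holds at
      \<open>a'\<close>.\<close>
    let ?E = "\<lambda>e. \<exists>m\<in>tuples M (universe M) [s]. H (m @ e) G"
    have "definable_pred L M B ([s] @ ss) (\<lambda>e. H e G)"
      unfolding H_def using sat_finite_conj[of G L M "s # ss" B] G qs Cons(2) by auto
    then have "definable_pred L M B ss ?E" by (rule definable_Ex)
    then obtain \<psi> c where c: "set c \<subseteq> B" "wff L (ss @ map (sort_of M) c) \<psi>"
      "\<And>a. a \<in> tuples M (universe M) ss \<Longrightarrow> sat M (a @ c) \<psi> \<longleftrightarrow> ?E a"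
      unfolding definable_pred_def formulas_over_def by auto
    have "H e {(\<psi>, c)}" if e: "m # e \<in> tuples M (universe M) (s # ss)" "H (m # e) G" for m e
    proof -
      have "e \<in> tuples M (universe M) ss" "[m] \<in> tuples M (universe M) [s]" "H ([m] @ e) G"
        using e by (auto simp: tuples_iff)
      then have "sat M (e @ c) \<psi>" using c(3) by blast
      then show ?thesis by (simp add: H_def)
    qed
    then have "(\<psi>, c) \<in> \<Delta>" using G c(1,2) unfolding \<Delta>_def formulas_over_def by blast
    then have "?E a'" using Ha' c(3)[OF a'] by (auto simp: H_def)
    then show ?thesis unfolding G(3) by (auto simp: H_def)
  qed
  ultimately have "\<exists>r. r \<in> complete_types L M [s] (B \<union> set a') \<and> ?\<Gamma> \<subseteq> r \<and>
    (\<forall>F\<subseteq>r. finite F \<longrightarrow> (\<exists>a\<in>tuples M (universe M) [s]. H a F))"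
    unfolding H_def by (rule complete_types_extend[OF _ order_refl])
  then obtain r where r: "r \<in> complete_types L M [s] (B \<union> set a')" "?\<Gamma> \<subseteq> r"
    by (elim exE conjE)
  have "\<exists>a. realizes M [s] a r"
    using sat[unfolded saturated_def, rule_format, OF B' Cinfinite_Un_set[OF inf Cons(3)] r(1)] .
  then obtain a where a: "realizes M [s] a r" ..
  have "realizes M (s # ss) (a @ a') \<Gamma>"
    unfolding realizes_def
  proof (intro conjI ballI, safe)
    show "a @ a' \<in> tuples M (universe M) (s # ss)"
      using a a' by (auto simp: realizes_def tuples_iff)
    fix \<phi> b assume "(\<phi>, b) \<in> \<Gamma>"
    then have "(\<phi>, b) \<in> q" using q(2) by blast
    then have "(\<phi>, a' @ b) \<in> ?\<Gamma>" by (rule image_eqI[rotated]) simp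
    then have "(\<phi>, a' @ b) \<in> r" using r(2) by (rule subsetD[rotated])
    then show "sat M ((a @ a') @ b) \<phi>" using a by (auto simp: realizes_def)
  qed
  then show ?case by blast
qed

lemma definable_compact:
  assumes sat: "saturated \<kappa> L M" and inf: "Cinfinite \<kappa>"
    and B: "B \<subseteq> universe M" "|B| <o \<kappa>"
    and def: "\<And>P. P \<in> \<P> \<Longrightarrow> definable_pred L M B ss P"
    and fin: "\<And>\<F>. \<F> \<subseteq> \<P> \<Longrightarrow> finite \<F> \<Longrightarrow> \<exists>a\<in>tuples M (universe M) ss. \<forall>P\<in>\<F>. P a"
  shows "\<exists>a\<in>tuples M (universe M) ss. \<forall>P\<in>\<P>. P a"
proof -
  let ?rep = "\<lambda>P x. x \<in> formulas_over L M ss B \<and>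
    (\<forall>a\<in>tuples M (universe M) ss. sat M (a @ snd x) (fst x) \<longleftrightarrow> P a)"
  have "\<forall>P\<in>\<P>. \<exists>x. ?rep P x"
    using def unfolding definable_pred_def by (simp add: Bex_def split_beta)
  then obtain f where f: "\<forall>P\<in>\<P>. ?rep P (f P)" by metis
  have "\<exists>a. realizes M ss a (f ` \<P>)"
  proof (rule saturated_tuple[OF sat inf B])
    show "f ` \<P> \<subseteq> formulas_over L M ss B" using f by auto
    fix F assume F: "F \<subseteq> f ` \<P>" "finite F"
    then obtain \<F> where G: "\<F> \<subseteq> \<P>" "finite \<F>" "F = f ` \<F>"
      using finite_subset_image[OF F(2,1)] by blast
    obtain a where "a \<in> tuples M (universe M) ss" "\<forall>P\<in>\<F>. P a" using fin[OF G(1,2)] by blast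
    then show "\<exists>a\<in>tuples M (universe M) ss. \<forall>(\<phi>, b)\<in>F. sat M (a @ b) \<phi>"
      using f G by (intro bexI[of _ a]) (auto simp: case_prod_beta)
  qed
  then obtain a where a: "a \<in> tuples M (universe M) ss"
    "\<And>P. P \<in> \<P> \<Longrightarrow> sat M (a @ snd (f P)) (fst (f P))"
    by (auto simp: realizes_def case_prod_beta)
  then show ?thesis using f by blast
qed

text \<open>
  Compactness is applied twice: \<open>D\<close> is a union of \<open>A\<close>-definable sets, and finitely many of
  these suffice.
\<close>

lemma definable_of_invariant:
  assumes sat: "saturated \<kappa> L M" and inf: "Cinfinite \<kappa>"
    and B: "B \<subseteq> universe M" "|B| <o \<kappa>" and A: "A \<subseteq> B"
    and D: "definable_pred L M B ss D"
    and inv: "\<And>u v. u \<in> tuples M (universe M) ss \<Longrightarrow> v \<in> tuples M (universe M) ss \<Longrightarrow>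
      tp L M u A = tp L M v A \<Longrightarrow> D u \<Longrightarrow> D v"
  shows "definable_pred L M A ss D"
proof -
  let ?T = "tuples M (universe M) ss"
  have AU: "A \<subseteq> universe M" using A B by blast
  have open_D: "\<exists>\<theta>. definable_pred L M A ss \<theta> \<and> \<theta> u \<and> (\<forall>v\<in>?T. \<theta> v \<longrightarrow> D v)"
    if u: "u \<in> ?T" "D u" for u
  proof (rule ccontr)
    assume n: "\<not> ?thesis"
    \<comment> \<open>A common solution would have the type of \<open>u\<close> over
      \<open>A\<close> and lie outside \<open>D\<close>, against \<open>inv\<close>. Finite parts
      are solvable because the conjunction of finitely many \<open>\<theta>\<close> true of
      \<open>u\<close> does not imply \<open>D\<close>.\<close>
    let ?P = "insert (\<lambda>v. \<not> D v) {\<theta>. definable_pred L M A ss \<theta> \<and> \<theta> u}"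
    have "\<exists>v\<in>?T. \<forall>P\<in>?P. P v"
    proof (rule definable_compact[OF sat inf B])
      fix P assume "P \<in> ?P"
      then show "definable_pred L M B ss P"
        using definable_not[OF D] definable_mono[OF _ A] by blast
    next
      fix \<F> assume F: "\<F> \<subseteq> ?P" "finite \<F>"
      define \<theta> where "\<theta> v \<longleftrightarrow> (\<forall>P\<in>\<F> - {\<lambda>v. \<not> D v}. P v)" for v
      have "definable_pred L M A ss \<theta>" unfolding \<theta>_def
        by (rule definable_Ball[OF _ _ AU]) (use F in auto)
      moreover have "\<theta> u" using F(1) by (auto simp: \<theta>_def)
      ultimately obtain v where "v \<in> ?T" "\<theta> v" "\<not> D v" using n by blast
      then show "\<exists>v\<in>?T. \<forall>P\<in>\<F>. P v" by (auto simp: \<theta>_def)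
    qed
    then obtain v where v: "v \<in> ?T" "\<forall>P\<in>?P. P v" by (rule bexE)
    have Dv: "\<not> D v" using bspec[OF v(2), of "\<lambda>v. \<not> D v"] by simp
    have \<theta>: "\<theta> v" if "definable_pred L M A ss \<theta>" "\<theta> u" for \<theta>
      using bspec[OF v(2), of \<theta>] that by simp
    have "P u \<longleftrightarrow> P v" if P: "definable_pred L M A ss P" for P
      using \<theta>[OF P] \<theta>[OF definable_not[OF P]] by argo
    then have "tp L M u A = tp L M v A" unfolding tp_eq_iff[OF u(1) v(1)] by simp
    from inv[OF u(1) v(1) this u(2)] show False using Dv by simp
  qed
  let ?\<Theta> = "{\<theta>. definable_pred L M A ss \<theta> \<and> (\<forall>v\<in>?T. \<theta> v \<longrightarrow> D v)}"
  \<comment> \<open>A common solution would lie in \<open>D\<close> but in no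
    \<open>A\<close>-definable subset of \<open>D\<close>, against \<open>open_D\<close>. So some
    finite part has none, and its finitely many \<open>\<theta>\<close> cover
    \<open>D\<close>.\<close>
  let ?P = "insert D ((\<lambda>\<theta> v. \<not> \<theta> v) ` ?\<Theta>)"
  have "\<exists>\<F>\<subseteq>?P. finite \<F> \<and> \<not> (\<exists>v\<in>?T. \<forall>P\<in>\<F>. P v)"
  proof (rule ccontr)
    assume n: "\<not> ?thesis"
    have "\<exists>v\<in>?T. \<forall>P\<in>?P. P v"
    proof (rule definable_compact[OF sat inf B])
      fix P assume "P \<in> ?P"
      then consider "P = D" | \<theta> where "definable_pred L M A ss \<theta>" "P = (\<lambda>v. \<not> \<theta> v)"
        by blast
      then show "definable_pred L M B ss P"
        by cases (auto simp: D intro!: definable_not definable_mono[OF _ A])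
    next
      fix \<F> assume "\<F> \<subseteq> ?P" "finite \<F>"
      with n show "\<exists>v\<in>?T. \<forall>P\<in>\<F>. P v" by meson
    qed
    then obtain v where v: "v \<in> ?T" "\<forall>P\<in>?P. P v" by (rule bexE)
    have "D v" using v(2) by simp
    then obtain \<theta> where \<theta>: "\<theta> \<in> ?\<Theta>" "\<theta> v" using open_D[OF v(1)] by blast
    then have "(\<lambda>v. \<not> \<theta> v) \<in> ?P" by blast
    from bspec[OF v(2) this] \<theta>(2) show False by simp
  qed
  then obtain \<F> where F: "\<F> \<subseteq> ?P" "finite \<F>" "\<not> (\<exists>v\<in>?T. \<forall>P\<in>\<F>. P v)" by blast
  have "\<F> - {D} \<subseteq> (\<lambda>\<theta> v. \<not> \<theta> v) ` ?\<Theta>" using F(1) by blast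
  from finite_subset_image[OF finite_Diff[OF F(2)] this]
  obtain G where G: "G \<subseteq> ?\<Theta>" "finite G" "\<F> - {D} = (\<lambda>\<theta> v. \<not> \<theta> v) ` G"
    by (elim exE conjE)
  have G': "definable_pred L M A ss \<theta>" "\<forall>v\<in>?T. \<theta> v \<longrightarrow> D v" if "\<theta> \<in> G" for \<theta>
    using subsetD[OF G(1) that] by auto
  have "definable_pred L M A ss (\<lambda>v. \<exists>\<theta>\<in>G. \<theta> v)"
    by (rule definable_Bex[where P = "\<lambda>\<theta>. \<theta>", OF G(2) G'(1) AU])
  then show ?thesis
  proof (rule definable_cong)
    fix v assume v: "v \<in> ?T"
    show "(\<exists>\<theta>\<in>G. \<theta> v) \<longleftrightarrow> D v"
    proof
      assume Dv: "D v"
      have "\<exists>P\<in>\<F>. \<not> P v"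
      proof (rule ccontr)
        assume "\<not> ?thesis"
        then have "\<forall>P\<in>\<F>. P v" by simp
        then have "\<exists>v\<in>?T. \<forall>P\<in>\<F>. P v" using v by (rule bexI)
        with F(3) show False by (rule notE)
      qed
      then obtain P where P: "P \<in> \<F>" "\<not> P v" by (rule bexE)
      have "P \<noteq> D"
      proof
        assume "P = D"
        then show False using P(2) Dv by simp
      qed
      then have "P \<in> \<F> - {D}" using P(1) by simp
      then obtain \<theta> where \<theta>: "P = (\<lambda>v. \<not> \<theta> v)" "\<theta> \<in> G" unfolding G(3) by (rule imageE)
      have "\<theta> v" using P(2) unfolding \<theta>(1) by simp
      then show "\<exists>\<theta>\<in>G. \<theta> v" using \<theta>(2) by (rule bexI[where P = "\<lambda>\<theta>. \<theta> v"])
    next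
      assume "\<exists>\<theta>\<in>G. \<theta> v"
      then obtain \<theta> where \<theta>: "\<theta> \<in> G" "\<theta> v" by auto
      from bspec[OF G'(2)[OF \<theta>(1)] v] \<theta>(2) show "D v" by simp
    qed
  qed
qed

section \<open>Types finitely satisfiable in a set\<close>

text \<open>The domain \<open>N\<close> of the type is kept apart from the structure
  \<open>M\<close> in which all formulas are evaluated. It will be the universe of \<open>M\<close>
  for global coheirs, the universe of a submodel for a coheir on a small model, and \<open>A\<close>
  or \<open>A\<close> with finitely many terms of a sequence for types yet to be extended.\<close>

locale fs_type =
  fixes L :: "('s, 'f, 'r) language" and M :: "('s, 'f, 'r, 'm) struct"
    and ss :: "'s list" and A N :: "'m set" and q :: "(('s, 'f, 'r) fm \<times> 'm list) set"
  assumes A_N: "A \<subseteq> N" and N_U: "N \<subseteq> universe M"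
    and q_type: "q \<in> complete_types L M ss N"
    and q_fs: "finitely_satisfiable_in M ss q A"
begin

text \<open>Membership in \<open>q\<close> for predicates, whatever formula presents them: by
  \<open>in_type_iff\<close> any formula over \<open>N\<close> that presents the predicate may be
  consulted.\<close>

definition in_type :: "('m list \<Rightarrow> bool) \<Rightarrow> bool" where
  "in_type P \<longleftrightarrow> (\<exists>(\<phi>, b)\<in>q. \<forall>a\<in>tuples M (universe M) ss. sat M (a @ b) \<phi> \<longleftrightarrow> P a)"

lemma A_U: "A \<subseteq> universe M" using A_N N_U by blast

lemma in_typeI:
  "(\<phi>, b) \<in> q \<Longrightarrow> (\<And>a. a \<in> tuples M (universe M) ss \<Longrightarrow> sat M (a @ b) \<phi> \<longleftrightarrow> P a) \<Longrightarrow> in_type P"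
  unfolding in_type_def by (intro bexI[of _ "(\<phi>, b)"]) auto

lemma in_typeD:
  assumes "in_type P"
  shows "\<exists>\<phi> b. (\<phi>, b) \<in> q \<and> (\<forall>a\<in>tuples M (universe M) ss. sat M (a @ b) \<phi> \<longleftrightarrow> P a)"
proof -
  from assms obtain x where x: "x \<in> q"
    "case x of (\<phi>, b) \<Rightarrow> \<forall>a\<in>tuples M (universe M) ss. sat M (a @ b) \<phi> \<longleftrightarrow> P a"
    unfolding in_type_def by (rule bexE)
  show ?thesis by (rule exI[of _ "fst x"], rule exI[of _ "snd x"]) (use x in \<open>auto simp: case_prod_beta\<close>)
qed

lemma in_type_cong:
  assumes "\<And>a. a \<in> tuples M (universe M) ss \<Longrightarrow> P a \<longleftrightarrow> P' a"
  shows "in_type P \<longleftrightarrow> in_type P'"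
  unfolding in_type_def using assms by (intro bex_cong refl) (auto simp: case_prod_beta)

lemma q_finite:
  assumes "F \<subseteq> q" "finite F"
  obtains a where "a \<in> tuples M (universe M) ss" "\<And>\<phi> b. (\<phi>, b) \<in> F \<Longrightarrow> sat M (a @ b) \<phi>"
proof -
  have "\<exists>a\<in>tuples M (universe M) ss. \<forall>(\<phi>, b)\<in>F. sat M (a @ b) \<phi>"
    using q_type assms by (simp add: complete_types_def)
  then obtain a where a: "a \<in> tuples M (universe M) ss" "\<forall>(\<phi>, b)\<in>F. sat M (a @ b) \<phi>" by (rule bexE)
  show thesis by (rule that[OF a(1)]) (use a(2) in auto)
qed

lemma q_complete: "(\<phi>, b) \<in> formulas_over L M ss N \<Longrightarrow> (\<phi>, b) \<in> q \<or> (Neg \<phi>, b) \<in> q"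
  using q_type unfolding complete_types_def by auto

lemma q_formulas: "q \<subseteq> formulas_over L M ss N"
  using q_type unfolding complete_types_def by auto

lemma in_type_fs:
  assumes "in_type P"
  obtains a where "a \<in> tuples M A ss" "P a"
proof -
  from in_typeD[OF assms] obtain \<phi> b where b: "(\<phi>, b) \<in> q"
    "\<forall>a\<in>tuples M (universe M) ss. sat M (a @ b) \<phi> \<longleftrightarrow> P a" by (elim exE conjE)
  have "\<exists>a\<in>tuples M A ss. sat M (a @ b) \<phi>"
    using q_fs b(1) unfolding finitely_satisfiable_in_def by auto
  then obtain a where a: "a \<in> tuples M A ss" "sat M (a @ b) \<phi>" by (rule bexE)
  show thesis using that[OF a(1)] a(2) bspec[OF b(2) tuples_mono[OF a(1) A_U]] by simp
qed

lemma in_type_iff: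
  assumes "(\<phi>, b) \<in> formulas_over L M ss N"
    and "\<And>a. a \<in> tuples M (universe M) ss \<Longrightarrow> sat M (a @ b) \<phi> \<longleftrightarrow> P a"
  shows "in_type P \<longleftrightarrow> (\<phi>, b) \<in> q"
proof
  assume "in_type P"
  from in_typeD[OF this] obtain \<psi> c where c: "(\<psi>, c) \<in> q"
    "\<forall>a\<in>tuples M (universe M) ss. sat M (a @ c) \<psi> \<longleftrightarrow> P a" by (elim exE conjE)
  show "(\<phi>, b) \<in> q"
  proof (rule ccontr)
    assume "(\<phi>, b) \<notin> q"
    then have "{(\<psi>, c), (Neg \<phi>, b)} \<subseteq> q" using q_complete[OF assms(1)] c(1) by simp
    then obtain a where a: "a \<in> tuples M (universe M) ss"
      and "\<And>\<chi> d. (\<chi>, d) \<in> {(\<psi>, c), (Neg \<phi>, b)} \<Longrightarrow> sat M (a @ d) \<chi>"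
      using q_finite[of "{(\<psi>, c), (Neg \<phi>, b)}"] by (metis finite.emptyI finite.insertI)
    from this(2)[of \<psi> c] this(2)[of "Neg \<phi>" b] show False
      using assms(2)[OF a] bspec[OF c(2) a] by simp
  qed
next
  assume "(\<phi>, b) \<in> q"
  then show "in_type P" using assms(2) by (rule in_typeI)
qed

lemma in_type_not:
  assumes "definable_pred L M N ss P"
  shows "in_type (\<lambda>a. \<not> P a) \<longleftrightarrow> \<not> in_type P"
proof -
  obtain \<phi> b where b: "set b \<subseteq> N" "wff L (ss @ map (sort_of M) b) \<phi>"
    "\<And>a. a \<in> tuples M (universe M) ss \<Longrightarrow> sat M (a @ b) \<phi> \<longleftrightarrow> P a"
    using assms unfolding definable_pred_def formulas_over_def by auto
  then have f: "(\<phi>, b) \<in> formulas_over L M ss N" "(Neg \<phi>, b) \<in> formulas_over L M ss N"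
    by (auto simp: formulas_over_iff)
  have "in_type P \<longleftrightarrow> (\<phi>, b) \<in> q" using f(1) b(3) by (rule in_type_iff)
  moreover have "in_type (\<lambda>a. \<not> P a) \<longleftrightarrow> (Neg \<phi>, b) \<in> q"
    using f(2) by (rule in_type_iff) (simp add: b(3))
  moreover have "\<not> ((\<phi>, b) \<in> q \<and> (Neg \<phi>, b) \<in> q)"
  proof
    assume "(\<phi>, b) \<in> q \<and> (Neg \<phi>, b) \<in> q"
    then obtain a where "\<And>\<chi> d. (\<chi>, d) \<in> {(\<phi>, b), (Neg \<phi>, b)} \<Longrightarrow> sat M (a @ d) \<chi>"
      using q_finite[of "{(\<phi>, b), (Neg \<phi>, b)}"] by (metis empty_subsetI finite.emptyI finite.insertI insert_subset)
    from this[of \<phi> b] this[of "Neg \<phi>" b] show False by simp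
  qed
  ultimately show ?thesis using q_complete[OF f(1)] by blast
qed

lemma in_type_conj:
  assumes P: "definable_pred L M N ss P" "in_type P" and P': "definable_pred L M N ss P'" "in_type P'"
  shows "in_type (\<lambda>a. P a \<and> P' a)"
proof (rule ccontr)
  assume n: "\<not> ?thesis"
  have "definable_pred L M N ss (\<lambda>a. P a \<and> P' a)" using P(1) P'(1) N_U by (rule definable_conj)
  from in_type_not[OF this] n have "in_type (\<lambda>a. \<not> (P a \<and> P' a))" by simp
  from in_typeD[OF this] obtain \<phi> b where b: "(\<phi>, b) \<in> q"
    "\<forall>a\<in>tuples M (universe M) ss. sat M (a @ b) \<phi> \<longleftrightarrow> \<not> (P a \<and> P' a)" by (elim exE conjE)
  from in_typeD[OF P(2)] obtain \<psi> c where c: "(\<psi>, c) \<in> q"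
    "\<forall>a\<in>tuples M (universe M) ss. sat M (a @ c) \<psi> \<longleftrightarrow> P a" by (elim exE conjE)
  from in_typeD[OF P'(2)] obtain \<chi> d where d: "(\<chi>, d) \<in> q"
    "\<forall>a\<in>tuples M (universe M) ss. sat M (a @ d) \<chi> \<longleftrightarrow> P' a" by (elim exE conjE)
  have "{(\<phi>, b), (\<psi>, c), (\<chi>, d)} \<subseteq> q" using b c d by simp
  then obtain a where a: "a \<in> tuples M (universe M) ss"
    and s: "\<And>\<theta> e. (\<theta>, e) \<in> {(\<phi>, b), (\<psi>, c), (\<chi>, d)} \<Longrightarrow> sat M (a @ e) \<theta>"
    using q_finite[of "{(\<phi>, b), (\<psi>, c), (\<chi>, d)}"] by (metis finite.emptyI finite.insertI)
  from s[of \<phi> b] s[of \<psi> c] s[of \<chi> d] show False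
    using bspec[OF b(2) a] bspec[OF c(2) a] bspec[OF d(2) a] by simp
qed

text \<open>The working form of finite satisfiability: predicates told apart by the type are told
  apart by a tuple of \<open>A\<close>, because the conjunction of \<open>P\<close> with the
  negation of \<open>P'\<close> again belongs to the type.\<close>

lemma in_type_differ:
  assumes "definable_pred L M N ss P" "in_type P" "definable_pred L M N ss P'" "\<not> in_type P'"
  obtains a where "a \<in> tuples M A ss" "P a" "\<not> P' a"
proof -
  have "in_type (\<lambda>a. P a \<and> \<not> P' a)"
    using assms by (intro in_type_conj definable_not) (auto simp: in_type_not)
  then obtain a where "a \<in> tuples M A ss" "P a \<and> \<not> P' a" by (rule in_type_fs)
  then show thesis using that by simp
qed

text \<open>\<open>finitely_satisfiable_in\<close> concerns one formula at a time; closure of the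
  type under conjunction makes a single tuple of \<open>A\<close> serve a finite set.\<close>

lemma q_finite_in_A:
  assumes "finite F" "F \<subseteq> q"
  shows "\<exists>a\<in>tuples M A ss. \<forall>(\<phi>, b)\<in>F. sat M (a @ b) \<phi>"
proof -
  have "definable_pred L M N ss (\<lambda>a. \<forall>(\<phi>, b)\<in>F. sat M (a @ b) \<phi>) \<and>
    in_type (\<lambda>a. \<forall>(\<phi>, b)\<in>F. sat M (a @ b) \<phi>)"
    using assms
  proof (induct F rule: finite_induct)
    case empty
    have T: "definable_pred L M N ss (\<lambda>a. True)" by (rule definable_True)
    have "\<not> in_type (\<lambda>a. \<not> True)" by (auto elim: in_type_fs)
    then show ?case using in_type_not[OF T] T by simp
  next
    case (insert x F)
    obtain \<phi> b where x: "x = (\<phi>, b)" by (cases x)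
    have q: "(\<phi>, b) \<in> q" using insert x by simp
    then have "(\<phi>, b) \<in> formulas_over L M ss N" using q_formulas by blast
    then have "definable_pred L M N ss (\<lambda>a. sat M (a @ b) \<phi>)"
      unfolding formulas_over_iff by (intro definable_predI[of b]) auto
    moreover have "in_type (\<lambda>a. sat M (a @ b) \<phi>)" using q by (rule in_typeI) simp
    moreover have "definable_pred L M N ss (\<lambda>a. \<forall>(\<phi>, b)\<in>F. sat M (a @ b) \<phi>)"
      "in_type (\<lambda>a. \<forall>(\<phi>, b)\<in>F. sat M (a @ b) \<phi>)" using insert by auto
    ultimately show ?case
      using definable_conj[OF _ _ N_U] in_type_conj by (simp add: x)
  qed
  then have "in_type (\<lambda>a. \<forall>(\<phi>, b)\<in>F. sat M (a @ b) \<phi>)" ..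
  then obtain a where "a \<in> tuples M A ss" "\<forall>(\<phi>, b)\<in>F. sat M (a @ b) \<phi>" by (rule in_type_fs)
  then show ?thesis by (intro bexI[of _ a])
qed

text \<open>The realization has to lie in \<open>N\<close>: it joins the parameters for the next
  one, and \<open>q\<close> decides only formulas over \<open>N\<close>.\<close>

definition realizes_on :: "'m set \<Rightarrow> 'm list \<Rightarrow> bool" where
  "realizes_on B x \<longleftrightarrow> x \<in> tuples M N ss \<and>
     (\<forall>P. definable_pred L M B ss P \<longrightarrow> in_type P \<longrightarrow> P x)"

lemma realizes_onD:
  assumes "realizes_on B x" "definable_pred L M B ss P" "in_type P"
  shows "P x"
  using assms(1)[unfolded realizes_on_def, THEN conjunct2, rule_format, OF assms(2,3)] .

lemma realizes_on_tuple: "realizes_on B x \<Longrightarrow> x \<in> tuples M N ss"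
  by (simp add: realizes_on_def)

lemma realizes_on_iff:
  assumes "realizes_on B x" "B \<subseteq> N" "definable_pred L M B ss P"
  shows "P x \<longleftrightarrow> in_type P"
proof -
  from realizes_onD[OF assms(1,3)] realizes_onD[OF assms(1) definable_not[OF assms(3)]]
  show ?thesis unfolding in_type_not[OF definable_mono[OF assms(3,2)]] by argo
qed

lemma realizes_on_mono: "realizes_on B x \<Longrightarrow> B' \<subseteq> B \<Longrightarrow> realizes_on B' x"
  unfolding realizes_on_def using definable_mono[of L M B' ss _ B] by meson

primrec morley :: "'m set \<Rightarrow> 'm list list \<Rightarrow> bool" where
  "morley B [] \<longleftrightarrow> True"
| "morley B (x # xs) \<longleftrightarrow> realizes_on B x \<and> morley (B \<union> set x) xs"

lemma morley_append:
  "morley B (xs @ ys) \<longleftrightarrow> morley B xs \<and> morley (B \<union> set (concat xs)) ys"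
  by (induct xs arbitrary: B) (auto simp: Un_assoc)

lemma morley_mono: "morley B xs \<Longrightarrow> B' \<subseteq> B \<Longrightarrow> morley B' xs"
proof (induct xs arbitrary: B B')
  case (Cons x xs)
  have "B' \<union> set x \<subseteq> B \<union> set x" using Cons(3) by blast
  then show ?case using Cons(1)[of "B \<union> set x"] Cons(2) realizes_on_mono[OF _ Cons(3)] by simp
qed simp

lemma morley_tuples: "morley B xs \<Longrightarrow> x \<in> set xs \<Longrightarrow> x \<in> tuples M N ss"
  by (induct xs arbitrary: B) (auto simp: realizes_on_def)

lemma morley_concat:
  "morley B xs \<Longrightarrow> concat xs \<in> tuples M N (concat (replicate (length xs) ss))"
proof (induct xs arbitrary: B)
  case Nil
  then show ?case by (simp add: tuples_iff)
next
  case (Cons x xs)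
  then have "x \<in> tuples M N ss" "concat xs \<in> tuples M N (concat (replicate (length xs) ss))"
    by (auto simp: realizes_on_def)
  then show ?case using tuples_append by fastforce
qed

text \<open>A type finitely satisfiable in \<open>A\<close> is invariant over \<open>A\<close>: if
  it separated \<open>u\<close> from \<open>v\<close>, some \<open>a\<close> from \<open>A\<close>
  would do so, and \<open>P (a @ y)\<close> is a predicate of \<open>y\<close> definable over
  \<open>A\<close>.\<close>

lemma in_type_invariant:
  assumes u: "u \<in> tuples M N us" and v: "v \<in> tuples M N us" and t: "tp L M u A = tp L M v A"
    and P: "definable_pred L M A (ss @ us) P"
  shows "in_type (\<lambda>x. P (x @ u)) \<longleftrightarrow> in_type (\<lambda>x. P (x @ v))"
proof -
  have "in_type (\<lambda>x. P (x @ v))" if Pu: "in_type (\<lambda>x. P (x @ u))"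
    and u: "u \<in> tuples M N us" and v: "v \<in> tuples M N us" and t: "tp L M u A = tp L M v A" for u v
  proof (rule ccontr)
    assume n: "\<not> in_type (\<lambda>x. P (x @ v))"
    have d: "definable_pred L M N ss (\<lambda>x. P (x @ w))" if "w \<in> tuples M N us" for w
      using definable_mono[OF P A_N] that N_U by (rule definable_section)
    obtain a where a: "a \<in> tuples M A ss" "P (a @ u)" "\<not> P (a @ v)"
      using d[OF u] Pu d[OF v] n by (rule in_type_differ)
    have "definable_pred L M A us (\<lambda>y. P (a @ y))"
      using P a(1) A_U by (rule definable_left_section)
    moreover have "u \<in> tuples M (universe M) us" "v \<in> tuples M (universe M) us"
      using u v N_U by (auto intro: tuples_mono)
    ultimately show False using t a tp_eq_iff by blast
  qed
  then show ?thesis using assms by metis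
qed

text \<open>Induction from the right. What holds of the last element together with its predecessors
  is decided by \<open>q\<close> at the tuple of predecessors, and by invariance this decision
  depends only on the type of that tuple over \<open>A\<close>.\<close>

lemma morley_unique:
  assumes "morley A xs" "morley A ys" "length xs = length ys"
  shows "tp L M (concat xs) A = tp L M (concat ys) A"
  using assms
proof (induct xs arbitrary: ys rule: rev_induct)
  case (snoc x xs)
  obtain ys' y where ys: "ys = ys' @ [y]" "length ys' = length xs"
    using snoc(4) by (cases ys rule: rev_cases) auto
  let ?us = "concat (replicate (length xs) ss)"
  have m: "morley A xs" "morley A ys'" using snoc(2,3) ys by (auto simp: morley_append)
  have r: "realizes_on (A \<union> set (concat xs)) x" "realizes_on (A \<union> set (concat ys')) y"
    using snoc(2,3) ys by (auto simp: morley_append)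
  have c: "concat xs \<in> tuples M N ?us" "concat ys' \<in> tuples M N ?us"
    using morley_concat[OF m(1)] morley_concat[OF m(2)] ys by auto
  have xy: "x \<in> tuples M N ss" "y \<in> tuples M N ss" using r by (auto simp: realizes_on_def)
  have IH: "tp L M (concat xs) A = tp L M (concat ys') A" using snoc(1)[OF m] ys by simp
  have "P (concat xs @ x) \<longleftrightarrow> P (concat ys' @ y)" if P: "definable_pred L M A (?us @ ss) P" for P
  proof -
    \<comment> \<open>In the concatenation the new element stands last, while the variables of the
      type come first in a formula; \<open>?P\<close> exchanges the two groups.\<close>
    let ?P = "\<lambda>e. P (drop (length ss) e @ take (length ss) e)"
    have P': "definable_pred L M A (ss @ ?us) ?P" using P by (rule definable_swap)
    have ev: "P (concat zs @ z) \<longleftrightarrow> in_type (\<lambda>z. ?P (z @ concat zs))"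
      if c: "concat zs \<in> tuples M N ?us" and r: "realizes_on (A \<union> set (concat zs)) z" for zs z
    proof -
      have sub: "A \<union> set (concat zs) \<subseteq> N" using c A_N by (auto simp: tuples_iff)
      have "concat zs \<in> tuples M (A \<union> set (concat zs)) ?us" using c by (auto simp: tuples_iff)
      moreover have "definable_pred L M (A \<union> set (concat zs)) (ss @ ?us) ?P"
        using P' by (rule definable_mono) blast
      ultimately have "definable_pred L M (A \<union> set (concat zs)) ss (\<lambda>z. ?P (z @ concat zs))"
        using sub N_U by (intro definable_section) auto
      note i = realizes_on_iff[OF r sub this]
      have "length z = length ss" using realizes_on_tuple[OF r] by (rule tuples_length)
      then have "P (concat zs @ z) \<longleftrightarrow> ?P (z @ concat zs)" by simp
      also note i
      finally show ?thesis .
    qed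
    show ?thesis
      unfolding ev[OF c(1) r(1)] ev[OF c(2) r(2)] using c IH P' by (rule in_type_invariant)
  qed
  moreover have "concat xs @ x \<in> tuples M (universe M) (?us @ ss)"
    "concat ys' @ y \<in> tuples M (universe M) (?us @ ss)"
    using c xy N_U by (auto intro!: tuples_append intro: tuples_mono)
  ultimately show ?case by (simp add: ys tp_eq_iff)
qed simp

lemma realizes_on_fs:
  assumes "B \<subseteq> N" "realizes_on B x"
  shows "\<And>P. definable_pred L M B ss P \<Longrightarrow> P x \<Longrightarrow> \<exists>a\<in>tuples M A ss. P a"
proof -
  fix P assume "definable_pred L M B ss P" "P x"
  then have "in_type P" using assms realizes_on_iff by blast
  then obtain a where "a \<in> tuples M A ss" "P a" by (rule in_type_fs)
  then show "\<exists>a\<in>tuples M A ss. P a" by (rule bexI[rotated])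
qed

end

section \<open>Definable types and their commutation with coheirs\<close>

context fs_type
begin

definition definable_type :: bool where
  "definable_type \<longleftrightarrow> (\<forall>ts \<phi>. wff L (ss @ ts) \<phi> \<longrightarrow> (\<exists>D. definable_pred L M A ts D \<and>
     (\<forall>b\<in>tuples M N ts. in_type (\<lambda>a. sat M (a @ b) \<phi>) \<longleftrightarrow> D b)))"

lemma in_type_sat:
  assumes "wff L (ss @ ts) \<phi>" "b \<in> tuples M N ts"
  shows "in_type (\<lambda>a. sat M (a @ b) \<phi>) \<longleftrightarrow> (\<phi>, b) \<in> q"
  by (rule in_type_iff) (use assms in \<open>auto simp: formulas_over_iff tuples_iff\<close>)

lemma definable_over_iff: "definable_over L M ss N q A \<longleftrightarrow> definable_type"
proof -
  have "(\<exists>(d, c)\<in>formulas_over L M ts A. \<forall>b\<in>tuples M N ts. (\<phi>, b) \<in> q \<longleftrightarrow> sat M (b @ c) d) \<longleftrightarrow>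
    (\<exists>D. definable_pred L M A ts D \<and>
      (\<forall>b\<in>tuples M N ts. in_type (\<lambda>a. sat M (a @ b) \<phi>) \<longleftrightarrow> D b))" (is "?l \<longleftrightarrow> ?r")
    if \<phi>: "wff L (ss @ ts) \<phi>" for ts \<phi>
  proof
    assume ?l
    then obtain x where x: "x \<in> formulas_over L M ts A"
      "case x of (d, c) \<Rightarrow> \<forall>b\<in>tuples M N ts. (\<phi>, b) \<in> q \<longleftrightarrow> sat M (b @ c) d" by (rule bexE)
    obtain d c where dc: "x = (d, c)" by (cases x)
    have "definable_pred L M A ts (\<lambda>b. sat M (b @ c) d)"
      by (rule definable_predI[of c]) (use x dc in \<open>auto simp: formulas_over_iff\<close>)
    then show ?r using x(2) dc in_type_sat[OF \<phi>]
      by (intro exI[of _ "\<lambda>b. sat M (b @ c) d"]) auto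
  next
    assume ?r
    then obtain D where D: "definable_pred L M A ts D"
      "\<forall>b\<in>tuples M N ts. in_type (\<lambda>a. sat M (a @ b) \<phi>) \<longleftrightarrow> D b" by (elim exE conjE)
    obtain d c where c: "set c \<subseteq> A" "wff L (ts @ map (sort_of M) c) d"
      "\<And>a. a \<in> tuples M (universe M) ts \<Longrightarrow> sat M (a @ c) d \<longleftrightarrow> D a"
      using D(1) unfolding definable_pred_def formulas_over_def by auto
    have "(\<phi>, b) \<in> q \<longleftrightarrow> sat M (b @ c) d" if "b \<in> tuples M N ts" for b
      using in_type_sat[OF \<phi> that] bspec[OF D(2) that] c(3)[OF tuples_mono[OF that N_U]] by simp
    then show ?l using c(1,2) by (intro bexI[of _ "(d, c)"]) (auto simp: formulas_over_iff)
  qed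
  then show ?thesis unfolding definable_over_def definable_type_def by (intro all_cong1) simp
qed

text \<open>The parameters \<open>b\<close> of the formula join the second group of variables. The
  definition over \<open>A\<close> of the enlarged formula, with \<open>b\<close> put back, is a
  definition over \<open>B\<close>.\<close>

lemma definable_type_over:
  assumes def: definable_type and B: "A \<subseteq> B" "B \<subseteq> N"
    and P: "definable_pred L M B (ss @ us) P"
  shows "\<exists>D. definable_pred L M B us D \<and> (\<forall>c\<in>tuples M N us. in_type (\<lambda>a. P (a @ c)) \<longleftrightarrow> D c)"
proof -
  have BU: "B \<subseteq> universe M" using B N_U by blast
  obtain \<phi> b where b: "set b \<subseteq> B" "wff L ((ss @ us) @ map (sort_of M) b) \<phi>"
    and P': "\<And>a. a \<in> tuples M (universe M) (ss @ us) \<Longrightarrow> sat M (a @ b) \<phi> \<longleftrightarrow> P a"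
    using P unfolding definable_pred_def formulas_over_def by auto
  let ?ts = "us @ map (sort_of M) b"
  have "wff L (ss @ ?ts) \<phi>" using b(2) by simp
  from def[unfolded definable_type_def, rule_format, OF this]
  obtain D where D: "definable_pred L M A ?ts D"
    "\<forall>b\<in>tuples M N ?ts. in_type (\<lambda>a. sat M (a @ b) \<phi>) \<longleftrightarrow> D b" by (elim exE conjE)
  have bt: "b \<in> tuples M B (map (sort_of M) b)" using b(1) by (simp add: tuples_iff)
  have "definable_pred L M B us (\<lambda>c. D (c @ b))"
    using definable_mono[OF D(1) B(1)] bt BU by (rule definable_section)
  moreover have "in_type (\<lambda>a. P (a @ c)) \<longleftrightarrow> D (c @ b)" if c: "c \<in> tuples M N us" for c
  proof -
    have "c @ b \<in> tuples M N ?ts" using c tuples_mono[OF bt B(2)] by (rule tuples_append)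
    from bspec[OF D(2) this] have "in_type (\<lambda>a. sat M (a @ c @ b) \<phi>) \<longleftrightarrow> D (c @ b)" .
    moreover have "in_type (\<lambda>a. P (a @ c)) \<longleftrightarrow> in_type (\<lambda>a. sat M (a @ c @ b) \<phi>)"
    proof (rule in_type_cong)
      fix a assume "a \<in> tuples M (universe M) ss"
      from P'[OF tuples_append[OF this tuples_mono[OF c N_U]]]
      show "P (a @ c) \<longleftrightarrow> sat M (a @ c @ b) \<phi>" by simp
    qed
    ultimately show ?thesis by simp
  qed
  ultimately show ?thesis by (intro exI[of _ "\<lambda>c. D (c @ b)"]) simp
qed

text \<open>
  A type definable over and finitely satisfiable in \<open>A\<close> commutes with every type finitely
  satisfiable in \<open>A\<close>.
\<close>

lemma realizes_on_add:
  assumes def: definable_type and B: "A \<subseteq> B" "B \<subseteq> N"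
    and x: "realizes_on B x" and c: "c \<in> tuples M N us"
    and fs: "\<And>P. definable_pred L M (B \<union> set x) us P \<Longrightarrow> P c \<Longrightarrow> \<exists>a\<in>tuples M A us. P a"
  shows "realizes_on (B \<union> set c) x"
  unfolding realizes_on_def
proof (intro conjI allI impI)
  show xN: "x \<in> tuples M N ss" using x by (rule realizes_on_tuple)
  fix P assume P: "definable_pred L M (B \<union> set c) ss P" "in_type P"
  have BU: "B \<subseteq> universe M" using B N_U by blast
  have cU: "c \<in> tuples M (universe M) us" using c N_U by (rule tuples_mono)
  obtain P' where P': "definable_pred L M B (ss @ us) P'"
    and PP': "\<And>a. a \<in> tuples M (universe M) ss \<Longrightarrow> P a \<longleftrightarrow> P' (a @ c)"
    using definable_unsection[OF P(1) cU BU] by metis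
  obtain D where D: "definable_pred L M B us D"
    "\<forall>c\<in>tuples M N us. in_type (\<lambda>a. P' (a @ c)) \<longleftrightarrow> D c"
    using definable_type_over[OF def B P'] by (elim exE conjE)
  have "in_type (\<lambda>a. P' (a @ c))" using P(2) in_type_cong[of P, OF PP'] by simp
  then have Dc: "D c" using bspec[OF D(2) c] by simp
  show "P x"
  proof (rule ccontr)
    assume "\<not> P x"
    then have n: "\<not> P' (x @ c)" using PP' tuples_mono[OF xN N_U] by simp
    have BxU: "B \<union> set x \<subseteq> universe M" using BU xN N_U by (auto simp: tuples_iff)
    have xt: "x \<in> tuples M (B \<union> set x) ss" using xN by (simp add: tuples_iff)
    have "definable_pred L M (B \<union> set x) us (\<lambda>y. P' (x @ y))"
      using definable_mono[OF P' Un_upper1] xt BxU by (rule definable_left_section)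
    \<comment> \<open>Both \<open>D\<close> and the failure at \<open>x\<close> are conditions on
      \<open>c\<close> over \<open>B\<close> and \<open>x\<close>, hence shared by some
      \<open>a\<close> from \<open>A\<close>. Then \<open>D a\<close> places the predicate at
      \<open>a\<close> in \<open>q\<close>, while \<open>x\<close>, which realizes \<open>q\<close>
      over \<open>B\<close> and so over \<open>a\<close>, fails it.\<close>
    then have "definable_pred L M (B \<union> set x) us (\<lambda>y. D y \<and> \<not> P' (x @ y))"
      by (intro definable_conj definable_not definable_mono[OF D(1) Un_upper1] BxU)
    from fs[OF this] Dc n obtain a where a: "a \<in> tuples M A us" "D a" "\<not> P' (x @ a)" by auto
    have "definable_pred L M B ss (\<lambda>z. P' (z @ a))"
      using P' tuples_mono[OF a(1) B(1)] BU by (rule definable_section)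
    moreover have "in_type (\<lambda>z. P' (z @ a))"
      using bspec[OF D(2) tuples_mono[OF a(1) A_N]] a(2) by simp
    ultimately have "P' (x @ a)" by (rule realizes_onD[OF x])
    with a(3) show False ..
  qed
qed

text \<open>Moves \<open>c\<close> in front of the whole list, one application of
  \<open>realizes_on_add\<close> for each entry. Of \<open>c\<close> only the finite satisfiability
  of its type over \<open>B\<close> and the list is asked, so it may come from a different
  coheir.\<close>

lemma morley_add:
  assumes def: definable_type and c: "c \<in> tuples M N us"
  shows "A \<subseteq> B \<Longrightarrow> B \<subseteq> N \<Longrightarrow> morley B xs \<Longrightarrow>
    (\<And>P. definable_pred L M (B \<union> set (concat xs)) us P \<Longrightarrow> P c \<Longrightarrow> \<exists>a\<in>tuples M A us. P a) \<Longrightarrow>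
    morley (B \<union> set c) xs"
proof (induct xs arbitrary: B)
  case (Cons x xs)
  have x: "realizes_on B x" "morley (B \<union> set x) xs" using Cons(4) by auto
  have "realizes_on (B \<union> set c) x"
  proof (rule realizes_on_add[OF def Cons(2,3) x(1) c])
    fix P assume "definable_pred L M (B \<union> set x) us P" "P c"
    then show "\<exists>a\<in>tuples M A us. P a"
      by (intro Cons(5)[of P]) (auto elim: definable_mono)
  qed
  moreover have "morley (B \<union> set x \<union> set c) xs"
  proof (rule Cons(1)[OF _ _ x(2)])
    show "A \<subseteq> B \<union> set x" using Cons(2) by blast
    show "B \<union> set x \<subseteq> N" using Cons(3) realizes_on_tuple[OF x(1)] by (simp add: tuples_iff)
    fix P assume "definable_pred L M (B \<union> set x \<union> set (concat xs)) us P" "P c"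
    then show "\<exists>a\<in>tuples M A us. P a" by (intro Cons(5)[of P]) (simp_all add: Un_assoc)
  qed
  ultimately show ?case by (simp add: Un_ac)
qed simp

text \<open>Induction on the target list: its first entry \<open>y\<close> is carried to the front
  past the entries \<open>us\<close> preceding it. As a realization of \<open>q\<close> over them it
  has a type finitely satisfiable in \<open>A\<close>, so \<open>morley_add\<close> applies; the
  entries \<open>vs\<close> behind it already have \<open>y\<close> among their parameters.\<close>

lemma morley_perm:
  assumes def: definable_type
  shows "A \<subseteq> B \<Longrightarrow> B \<subseteq> N \<Longrightarrow> morley B xs \<Longrightarrow> mset xs = mset ys \<Longrightarrow> morley B ys"
proof (induct ys arbitrary: B xs)
  case (Cons y ys)
  have "y \<in> set xs" using Cons(5) by (metis list.set_intros(1) mset_eq_setD)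
  then obtain us vs where xs: "xs = us @ y # vs" by (metis split_list)
  have m: "morley B us" "realizes_on (B \<union> set (concat us)) y"
    "morley (B \<union> set (concat us) \<union> set y) vs"
    using Cons(4) by (auto simp: xs morley_append)
  have yN: "y \<in> tuples M N ss" using m(2) by (rule realizes_on_tuple)
  have "set x \<subseteq> N" if "x \<in> set us" for x
    using morley_tuples[OF m(1) that] by (simp add: tuples_iff)
  then have usN: "set (concat us) \<subseteq> N" by auto
  have "morley (B \<union> set y) us"
  proof (rule morley_add[OF def yN Cons(2,3) m(1)])
    fix P assume "definable_pred L M (B \<union> set (concat us)) ss P" "P y"
    then show "\<exists>a\<in>tuples M A ss. P a" using realizes_on_fs m(2) usN Cons(3) by (meson Un_least)
  qed
  then have "morley (B \<union> set y) (us @ vs)"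
    using m(3) by (simp add: morley_append Un_ac)
  moreover have "A \<subseteq> B \<union> set y" "B \<union> set y \<subseteq> N"
    using Cons(2,3) yN by (auto simp: tuples_iff)
  moreover have "mset (us @ vs) = mset ys" using Cons(5) by (simp add: xs)
  ultimately have "morley (B \<union> set y) ys" using Cons(1) by blast
  moreover have "realizes_on B y" using m(2) by (rule realizes_on_mono) simp
  ultimately show ?case by simp
qed simp

section \<open>Realizations of restrictions and existence of Morley lists\<close>

lemma realizes_onI:
  assumes "B \<subseteq> N" "x \<in> tuples M N ss"
    "\<And>\<phi> b. (\<phi>, b) \<in> q \<Longrightarrow> set b \<subseteq> B \<Longrightarrow> sat M (x @ b) \<phi>"
  shows "realizes_on B x"
  unfolding realizes_on_def
proof (intro conjI allI impI assms(2))
  fix P assume P: "definable_pred L M B ss P" "in_type P"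
  obtain \<phi> b where b: "set b \<subseteq> B" "wff L (ss @ map (sort_of M) b) \<phi>"
    "\<And>a. a \<in> tuples M (universe M) ss \<Longrightarrow> sat M (a @ b) \<phi> \<longleftrightarrow> P a"
    using P(1) unfolding definable_pred_def formulas_over_def by auto
  have "(\<phi>, b) \<in> formulas_over L M ss N" using b assms(1) by (auto simp: formulas_over_iff)
  from in_type_iff[OF this b(3)] P(2) have "(\<phi>, b) \<in> q" by simp
  from assms(3)[OF this b(1)] show "P x" using b(3)[OF tuples_mono[OF assms(2) N_U]] by simp
qed

lemma realizes_on_sat:
  assumes "realizes_on B x" "(\<phi>, b) \<in> q" "set b \<subseteq> B"
  shows "sat M (x @ b) \<phi>"
proof -
  have "(\<phi>, b) \<in> formulas_over L M ss N" using q_formulas assms(2) by blast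
  then have "definable_pred L M B ss (\<lambda>a. sat M (a @ b) \<phi>)"
    using assms(3) by (intro definable_predI[of b]) (auto simp: formulas_over_iff)
  moreover have "in_type (\<lambda>a. sat M (a @ b) \<phi>)" using assms(2) by (rule in_typeI) simp
  ultimately show ?thesis by (rule realizes_onD[OF assms(1)])
qed

lemma morley_realizes: "morley B xs \<Longrightarrow> x \<in> set xs \<Longrightarrow> realizes_on B x"
proof (induct xs arbitrary: B)
  case (Cons y xs)
  then show ?case using realizes_on_mono[of "B \<union> set y" x B] by auto
qed simp

lemma morley_nths: "morley B xs \<Longrightarrow> morley B (nths xs I)"
proof (induct xs arbitrary: B I)
  case (Cons x xs)
  have "morley (B \<union> set x) (nths xs {j. Suc j \<in> I})" using Cons by simp
  then show ?case using Cons(2) morley_mono[of "B \<union> set x" _ B] by (simp add: nths_Cons)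
qed simp

lemma morley_exists:
  assumes inf: "Cinfinite \<kappa>"
    and ex: "\<And>B. B \<subseteq> N \<Longrightarrow> |B| <o \<kappa> \<Longrightarrow> \<exists>x. realizes_on B x"
  shows "B \<subseteq> N \<Longrightarrow> |B| <o \<kappa> \<Longrightarrow> \<exists>xs. length xs = n \<and> morley B xs"
proof (induct n arbitrary: B)
  case (Suc n)
  obtain x where x: "realizes_on B x" using ex[OF Suc(2,3)] ..
  have "B \<union> set x \<subseteq> N" using Suc(2) realizes_on_tuple[OF x] by (simp add: tuples_iff)
  from Suc(1)[OF this Cinfinite_Un_set[OF inf Suc(3)]]
  obtain xs where "length xs = n" "morley (B \<union> set x) xs" by (elim exE conjE)
  then show ?case using x by (intro exI[of _ "x # xs"]) simp
qed simp

end

lemma (in fs_type) realizes_on_exists: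
  assumes sat: "saturated \<kappa> L M" and inf: "Cinfinite \<kappa>" and N: "N = universe M"
    and B: "B \<subseteq> N" "|B| <o \<kappa>"
  shows "\<exists>x. realizes_on B x"
proof -
  let ?\<Gamma> = "q \<inter> formulas_over L M ss B"
  have "\<exists>a. realizes M ss a ?\<Gamma>"
  proof (rule saturated_tuple[OF sat inf _ B(2)])
    show "B \<subseteq> universe M" using B N by simp
    show "?\<Gamma> \<subseteq> formulas_over L M ss B" by simp
    fix F assume "F \<subseteq> ?\<Gamma>" "finite F"
    then obtain a where "a \<in> tuples M (universe M) ss" "\<And>\<phi> b. (\<phi>, b) \<in> F \<Longrightarrow> sat M (a @ b) \<phi>"
      using q_finite[of F] by (metis Int_subset_iff)
    then show "\<exists>a\<in>tuples M (universe M) ss. \<forall>(\<phi>, b)\<in>F. sat M (a @ b) \<phi>"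
      by (intro bexI[of _ a]) auto
  qed
  then obtain a where a: "realizes M ss a ?\<Gamma>" ..
  have "realizes_on B a"
  proof (rule realizes_onI[OF B(1)])
    show "a \<in> tuples M N ss" using a N by (simp add: realizes_def)
    fix \<phi> b assume b: "(\<phi>, b) \<in> q" "set b \<subseteq> B"
    then have "(\<phi>, b) \<in> formulas_over L M ss N" using q_formulas by blast
    then have "(\<phi>, b) \<in> ?\<Gamma>" using b by (simp add: formulas_over_iff)
    then show "sat M (a @ b) \<phi>" using a unfolding realizes_def by auto
  qed
  then show ?thesis ..
qed

section \<open>Dependence\<close>

definition block :: "nat \<Rightarrow> nat \<Rightarrow> 'a list \<Rightarrow> 'a list" where
  "block m i e = take m (drop (i * m) e)"

lemma block_concat:
  "\<forall>x\<in>set xs. length x = m \<Longrightarrow> i < length xs \<Longrightarrow> block m i (concat xs) = xs ! i"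
proof (induct xs arbitrary: i)
  case (Cons x xs)
  then show ?case by (cases i) (auto simp: block_def)
qed simp

lemma block_replicate: "i < n \<Longrightarrow> block (length s) i (concat (replicate n s)) = s"
  using block_concat[of "replicate n s" "length s" i] by simp

lemma length_concat_replicate: "length (concat (replicate n s)) = n * length s"
  by (induct n) auto

lemma block_index:
  assumes "i < n" "j < (m::nat)"
  shows "i * m + j < n * m"
proof -
  have "i * m + j < Suc i * m" using assms(2) by simp
  also have "\<dots> \<le> n * m" using assms(1) by (intro mult_le_mono1) simp
  finally show ?thesis .
qed

lemma nth_concat_replicate:
  assumes "i < n" "j < length s"
  shows "concat (replicate n s) ! (i * length s + j) = s ! j"
proof -
  have "block (length s) i (concat (replicate n s)) ! j = s ! j"
    using assms(1) by (simp add: block_replicate)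
  then show ?thesis
    using assms block_index[OF assms] by (simp add: block_def length_concat_replicate)
qed

lemma block_tuples:
  assumes "e \<in> tuples M X (concat (replicate n ss))" "i < n"
  shows "block (length ss) i e \<in> tuples M X ss"
proof -
  have "map (sort_of M) (block (length ss) i e) = block (length ss) i (map (sort_of M) e)"
    by (simp add: block_def take_map drop_map)
  also have "\<dots> = ss" using assms block_replicate by (auto simp: tuples_iff)
  finally show ?thesis
    using assms(1) by (auto simp: tuples_iff block_def dest!: in_set_takeD in_set_dropD)
qed

text \<open>The tuple for \<open>ts\<close> stands before the blocks because it is to be quantified,
  and \<open>definable_Ex\<close> quantifies the leading variables.\<close>

lemma definable_block:
  assumes P: "definable_pred L M B (ss @ ts) P" and i: "i < n"
  shows "definable_pred L M B (ts @ concat (replicate n ss))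
    (\<lambda>e. P (block (length ss) i (drop (length ts) e) @ take (length ts) e))"
proof (rule definable_reindex[OF P])
  let ?C = "concat (replicate n ss)"
  let ?g = "\<lambda>e. block (length ss) i (drop (length ts) e) @ take (length ts) e"
  {
    fix e assume e: "e \<in> tuples M (universe M) (ts @ ?C)"
    have "drop (length ts) e \<in> tuples M (universe M) ?C" "take (length ts) e \<in> tuples M (universe M) ts"
      using e by (auto simp: tuples_iff drop_map[symmetric] take_map[symmetric]
          dest!: in_set_dropD in_set_takeD)
    then show "?g e \<in> tuples M (universe M) (ss @ ts)"
      using block_tuples[OF _ i] tuples_append by blast
  }
  note g = this
  fix j assume j: "j < length (ss @ ts)"
  let ?k = "if j < length ss then length ts + (i * length ss + j) else j - length ss"
  show "(\<exists>k<length (ts @ ?C). (ts @ ?C) ! k = (ss @ ts) ! j \<and>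
      (\<forall>e\<in>tuples M (universe M) (ts @ ?C). ?g e ! j = e ! k)) \<or>
      (\<exists>m\<in>B. sort_of M m = (ss @ ts) ! j \<and>
      (\<forall>e\<in>tuples M (universe M) (ts @ ?C). ?g e ! j = m))"
  proof (rule disjI1, rule exI[of _ ?k], intro conjI ballI)
    show "?k < length (ts @ ?C)"
      using j i block_index[OF i, of j "length ss"] by (auto simp: length_concat_replicate)
    show "(ts @ ?C) ! ?k = (ss @ ts) ! j"
      using j i by (auto simp: nth_append nth_concat_replicate)
    fix e assume e: "e \<in> tuples M (universe M) (ts @ ?C)"
    have l: "length e = length ts + n * length ss"
      using tuples_length[OF e] by (simp add: length_concat_replicate)
    have "length (?g e) = length ss + length ts" using tuples_length[OF g[OF e]] by simp
    then have lb: "length (block (length ss) i (drop (length ts) e)) = length ss" using l by simp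
    show "?g e ! j = e ! ?k"
    proof (cases "j < length ss")
      case True
      have "length ts + i * length ss \<le> length e" using l i by simp
      then show ?thesis using True lb by (simp add: nth_append) (simp add: block_def add_ac)
    next
      case False
      then show ?thesis using lb j l by (simp add: nth_append)
    qed
  qed
qed

text \<open>That some \<open>b\<close> gives the truth values \<open>W\<close> on the blocks is a
  single first-order condition on their concatenation. Hence it passes between sequences with the
  same type.\<close>

lemma definable_pattern:
  assumes P: "definable_pred L M B (ss @ ts) P" and B: "B \<subseteq> universe M"
  shows "definable_pred L M B (concat (replicate n ss))
    (\<lambda>e. \<exists>b\<in>tuples M (universe M) ts. \<forall>i<n. P (block (length ss) i e @ b) \<longleftrightarrow> W i)"
proof -
  let ?Q = "\<lambda>i e. P (block (length ss) i (drop (length ts) e) @ take (length ts) e)"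
  have d: "definable_pred L M B (ts @ concat (replicate n ss)) (\<lambda>e. ?Q i e \<longleftrightarrow> W i)"
    if "i \<in> {..<n}" for i
    using definable_block[OF P, of i n] definable_not[OF definable_block[OF P, of i n]] that
    by (cases "W i") simp_all
  have "definable_pred L M B (ts @ concat (replicate n ss)) (\<lambda>e. \<forall>i\<in>{..<n}. ?Q i e \<longleftrightarrow> W i)"
    by (rule definable_Ball[OF _ d B]) auto
  then have "definable_pred L M B (concat (replicate n ss))
    (\<lambda>e. \<exists>b\<in>tuples M (universe M) ts. \<forall>i\<in>{..<n}. ?Q i (b @ e) \<longleftrightarrow> W i)"
    by (rule definable_Ex)
  then show ?thesis
    by (rule definable_cong) (auto simp: tuples_length intro!: bex_cong)
qed

section \<open>Truth patterns along indiscernible sets\<close>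

definition pattern :: "('s, 'f, 'r, 'm) struct \<Rightarrow> 's list \<Rightarrow> ('m list \<Rightarrow> bool) \<Rightarrow> (nat \<Rightarrow> bool) \<Rightarrow>
    'm list list \<Rightarrow> bool" where
  "pattern M ts P W xs \<longleftrightarrow>
     (\<exists>b\<in>tuples M (universe M) ts. \<forall>i<length xs. P (xs ! i @ b) \<longleftrightarrow> W i)"

lemma concat_tuples:
  "\<forall>x\<in>set xs. x \<in> tuples M X ss \<Longrightarrow> concat xs \<in> tuples M X (concat (replicate (length xs) ss))"
proof (induct xs)
  case (Cons x xs)
  then have "x @ concat xs \<in> tuples M X (ss @ concat (replicate (length xs) ss))"
    by (intro tuples_append) auto
  then show ?case by simp
qed (simp add: tuples_iff)

lemma tp_eqD:
  assumes "tp L M u B = tp L M v B" "definable_pred L M B us P"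
    "u \<in> tuples M (universe M) us" "v \<in> tuples M (universe M) us"
  shows "P u \<longleftrightarrow> P v"
  using tp_eq_iff[OF assms(3,4), THEN iffD1, OF assms(1), rule_format, OF assms(2)] .

lemma pattern_transfer:
  assumes P: "definable_pred L M B (ss @ ts) P" and B: "B \<subseteq> universe M"
    and xs: "\<forall>x\<in>set xs. x \<in> tuples M (universe M) ss"
    and ys: "\<forall>y\<in>set ys. y \<in> tuples M (universe M) ss"
    and len: "length xs = length ys" and t: "tp L M (concat xs) B = tp L M (concat ys) B"
  shows "pattern M ts P W xs \<longleftrightarrow> pattern M ts P W ys"
proof -
  let ?n = "length xs"
  let ?R = "\<lambda>e. \<exists>b\<in>tuples M (universe M) ts. \<forall>i<?n. P (block (length ss) i e @ b) \<longleftrightarrow> W i"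
  have d: "definable_pred L M B (concat (replicate ?n ss)) ?R" using P B by (rule definable_pattern)
  have "concat xs \<in> tuples M (universe M) (concat (replicate ?n ss))"
    "concat ys \<in> tuples M (universe M) (concat (replicate ?n ss))"
    using concat_tuples[OF xs] concat_tuples[OF ys] len by simp_all
  with t d have "?R (concat xs) \<longleftrightarrow> ?R (concat ys)" by (rule tp_eqD)
  moreover have R: "pattern M ts P W zs \<longleftrightarrow> ?R (concat zs)"
    if "length zs = ?n" "\<forall>z\<in>set zs. z \<in> tuples M (universe M) ss" for zs
  proof -
    have "\<forall>z\<in>set zs. length z = length ss" using that(2) tuples_length by blast
    then show ?thesis using that(1) by (simp add: pattern_def block_concat)
  qed
  ultimately show ?thesis using R[OF refl xs] R[OF len[symmetric] ys] by simp
qed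

text \<open>A parameter that splits \<open>2 * k\<close> terms into halves offers at each position
  \<open>i < k\<close> two terms, \<open>a i\<close> and \<open>a (k + i)\<close>, with opposite
  truth values. Choosing between them gives any pattern on \<open>k\<close> terms of an
  indiscernible set, whichever half is the true one. If such a splitting existed for every
  \<open>k\<close>, compactness would make \<open>\<phi>\<close> shatter the whole sequence.\<close>

lemma dependent_bound:
  assumes dep: "dependent L M" and sat: "saturated \<kappa> L M" and inf: "Cinfinite \<kappa>"
    and nat: "natLeq <o \<kappa>" and B: "B \<subseteq> universe M"
    and a: "\<And>i. a i \<in> tuples M (universe M) ss" and ind: "indiscernible_set L M B a"
    and \<phi>: "wff L (ss @ ts) \<phi>"
  shows "\<exists>k. \<forall>v. \<not> pattern M ts (\<lambda>e. sat M e \<phi>) (\<lambda>i. (i < k) = v) (map a [0..<2 * k])"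
proof (rule ccontr)
  assume "\<not> ?thesis"
  then have n: "\<exists>v. pattern M ts (\<lambda>e. sat M e \<phi>) (\<lambda>i. (i < k) = v) (map a [0..<2 * k])" for k
    by blast
  have d: "definable_pred L M B (ss @ ts) (\<lambda>e. sat M e \<phi>)" using \<phi> by (rule definable_sat)
  have all: "pattern M ts (\<lambda>e. sat M e \<phi>) (\<lambda>i. i \<in> I) (map a [0..<k])" for I k
  proof -
    obtain v where "pattern M ts (\<lambda>e. sat M e \<phi>) (\<lambda>i. (i < k) = v) (map a [0..<2 * k])"
      using n by (rule exE)
    then obtain b where b: "b \<in> tuples M (universe M) ts"
      and v: "\<forall>i<length (map a [0..<2 * k]). sat M (map a [0..<2 * k] ! i @ b) \<phi> \<longleftrightarrow> (i < k) = v"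
      unfolding pattern_def by (rule bexE)
    have v: "sat M (a i @ b) \<phi> \<longleftrightarrow> (i < k) = v" if "i < 2 * k" for i
      using v[rule_format, of i] that by simp
    let ?s = "\<lambda>i. if (i \<in> I) = v then i else k + i"
    have "pattern M ts (\<lambda>e. sat M e \<phi>) (\<lambda>i. i \<in> I) (map a (map ?s [0..<k]))"
      unfolding pattern_def
    proof (intro bexI[OF _ b] allI impI)
      fix i assume "i < length (map a (map ?s [0..<k]))"
      then have "i < k" by simp
      then show "sat M (map a (map ?s [0..<k]) ! i @ b) \<phi> \<longleftrightarrow> i \<in> I"
        using v[of i] v[of "k + i"] by auto
    qed
    moreover have "distinct (map ?s [0..<k])"
      by (auto simp: distinct_map inj_on_def split: if_splits)
    then have "tp L M (concat (map a (map ?s [0..<k]))) B = tp L M (concat (map a [0..<k])) B"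
      by (intro ind[unfolded indiscernible_set_def, rule_format] conjI) simp_all
    ultimately show ?thesis
      using pattern_transfer[OF d B, of "map a (map ?s [0..<k])" "map a [0..<k]"] a by auto
  qed
  \<comment> \<open>The terms of the sequence contribute countably many parameters; they form a
    small set because \<open>\<kappa>\<close> is uncountable.\<close>
  let ?B = "\<Union>i. set (a i)"
  have "|?B| \<le>o |UNIV :: nat set|"
  proof (rule card_of_UNION_ordLeq_infinite)
    show "\<forall>i\<in>UNIV. |set (a i)| \<le>o |UNIV :: nat set|"
      by (simp add: ordLess_imp_ordLeq set_ordLess_Cinfinite cinfinite_def Field_card_of
          card_of_card_order_on)
  qed (simp_all add: card_of_mono1)
  then have Bk: "|?B| <o \<kappa>"
    using nat card_of_nat ordLeq_ordIso_trans ordLeq_ordLess_trans by blast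
  have BU: "?B \<subseteq> universe M" using a by (auto simp: tuples_iff)
  have "\<exists>b\<in>tuples M (universe M) ts. \<forall>i. sat M (a i @ b) \<phi> \<longleftrightarrow> i \<in> I" for I
  proof -
    let ?Q = "\<lambda>i b. sat M (a i @ b) \<phi> \<longleftrightarrow> i \<in> I"
    have "\<exists>b\<in>tuples M (universe M) ts. \<forall>P\<in>range ?Q. P b"
    proof (rule definable_compact[OF sat inf BU Bk])
      fix P assume "P \<in> range ?Q"
      then obtain i where P: "P = ?Q i" by (rule rangeE)
      have "a i \<in> tuples M ?B ss" using a[of i] by (auto simp: tuples_iff)
      with definable_sat[OF \<phi>, of M ?B] have "definable_pred L M ?B ts (\<lambda>b. sat M (a i @ b) \<phi>)"
        using BU by (rule definable_left_section)
      from this definable_not[OF this] show "definable_pred L M ?B ts P"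
        unfolding P by (cases "i \<in> I") simp_all
    next
      fix \<F> assume F: "\<F> \<subseteq> range ?Q" "finite \<F>"
      from finite_subset_image[OF F(2,1)] obtain J where J: "finite J" "\<F> = ?Q ` J" by (elim exE conjE)
      obtain k where k: "J \<subseteq> {..<k}" using J(1) by (auto simp: finite_nat_set_iff_bounded)
      obtain b where b: "b \<in> tuples M (universe M) ts"
        and "\<forall>i<length (map a [0..<k]). sat M (map a [0..<k] ! i @ b) \<phi> \<longleftrightarrow> i \<in> I"
        using all[of I k] unfolding pattern_def by (rule bexE)
      then have Qb: "?Q i b" if "i < k" for i using that by simp
      show "\<exists>b\<in>tuples M (universe M) ts. \<forall>P\<in>\<F>. P b"
        using Qb k unfolding J(2) by (intro bexI[OF _ b]) auto
    qed
    then show ?thesis by simp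
  qed
  then have "\<exists>b. \<forall>I. b I \<in> tuples M (universe M) ts \<and> (\<forall>i. sat M (a i @ b I) \<phi> \<longleftrightarrow> i \<in> I)"
    by (intro choice) (simp add: Bex_def)
  then obtain b where "\<forall>I. b I \<in> tuples M (universe M) ts \<and> (\<forall>i. sat M (a i @ b I) \<phi> \<longleftrightarrow> i \<in> I)" ..
  then have "wff L (ss @ ts) \<phi> \<and> (\<forall>i. a i \<in> tuples M (universe M) ss) \<and>
    (\<forall>I. b I \<in> tuples M (universe M) ts) \<and> (\<forall>i I. sat M (a i @ b I) \<phi> \<longleftrightarrow> i \<in> I)"
    using \<phi> a by simp
  then show False using dep[unfolded dependent_def] by (elim notE) (intro exI)
qed

text \<open>
  By dependence, \<open>q\<close> is given by the majority vote of any long enough Morley list over \<open>A\<close>.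
  This defines \<open>q\<close> with parameters from the list; invariance moves the parameters to \<open>A\<close>.
\<close>

lemma (in fs_type) definable_type_of_indiscernible_set:
  assumes dep: "dependent L M" and sat: "saturated \<kappa> L M" and inf: "Cinfinite \<kappa>"
    and nat: "natLeq <o \<kappa>" and N: "N = universe M" and A: "|A| <o \<kappa>"
    and a: "\<And>i. a i \<in> tuples M (universe M) ss" and ind: "indiscernible_set L M A a"
    and mor: "\<And>xs. morley A xs \<Longrightarrow> tp L M (concat xs) A = tp L M (concat (map a [0..<length xs])) A"
  shows definable_type
  unfolding definable_type_def
proof (intro allI impI)
  fix ts \<phi> assume \<phi>: "wff L (ss @ ts) \<phi>"
  let ?P = "\<lambda>e. sat M e \<phi>"
  have ex: "\<exists>xs. length xs = n \<and> morley B xs" if "B \<subseteq> N" "|B| <o \<kappa>" for B n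
    by (rule morley_exists[OF inf _ that]) (rule realizes_on_exists[OF sat inf N])
  have P: "definable_pred L M A (ss @ ts) ?P" using \<phi> by (rule definable_sat)
  obtain k where k: "\<forall>v. \<not> pattern M ts ?P (\<lambda>i. (i < k) = v) (map a [0..<2 * k])"
    using dependent_bound[OF dep sat inf nat A_U a ind \<phi>] by (rule exE)
  \<comment> \<open>By \<open>mor\<close>, Morley lists over \<open>A\<close> have the types of
    initial segments of \<open>a\<close>, so the ban on splittings passes to them.\<close>
  have nopat: "\<not> pattern M ts ?P (\<lambda>i. (i < k) = v) xs" if xs: "morley A xs" "length xs = 2 * k" for xs v
  proof -
    have "\<forall>x\<in>set xs. x \<in> tuples M (universe M) ss" using morley_tuples[OF xs(1)] N by simp
    then show ?thesis
      using pattern_transfer[OF P A_U, of xs "map a [0..<2 * k]"] spec[OF k, of v] a xs(2)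
        mor[OF xs(1)] by simp
  qed
  \<comment> \<open>Among \<open>2 * k\<close> votes some truth value occurs at least
    \<open>k\<close> times.\<close>
  obtain c where c: "length c = 2 * k" "morley A c" using ex[OF A_N A, of "2 * k"] by (elim exE conjE)
  have cs: "x \<in> tuples M (universe M) ss" if "x \<in> set c" for x
    using morley_tuples[OF c(2) that] N by simp
  let ?B = "A \<union> set (concat c)"
  have BU: "?B \<subseteq> universe M" using A_U cs by (auto simp: tuples_iff)
  have Bk: "|?B| <o \<kappa>" using inf A by (rule Cinfinite_Un_set)
  define D where "D b \<longleftrightarrow> in_type (\<lambda>x. sat M (x @ b) \<phi>)" for b
  \<comment> \<open>Suppose \<open>k\<close> members of \<open>c\<close> agree on \<open>v\<close>
    against \<open>D b\<close>. Realizations \<open>d\<close> of the type over \<open>c\<close> and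
    \<open>b\<close> all vote as \<open>D b\<close> does, so \<open>k\<close> of them appended to
    these \<open>k\<close> members give the excluded splitting.\<close>
  have vote: "D b = v" if b: "b \<in> tuples M (universe M) ts" and w: "w \<subseteq> {..<2 * k}" "card w = k"
    and v: "\<And>i. i \<in> w \<Longrightarrow> ?P (c ! i @ b) = v" for b w v
  proof (rule ccontr)
    assume "D b \<noteq> v"
    have "?B \<union> set b \<subseteq> N" using BU b N by (simp add: tuples_iff)
    from ex[where n = k, OF this Cinfinite_Un_set[OF inf Bk]]
    obtain d where d: "length d = k" "morley (?B \<union> set b) d" by (elim exE conjE)
    have dv: "?P (y @ b) \<longleftrightarrow> \<not> v" if "y \<in> set d" for y
    proof -
      have "b \<in> tuples M (?B \<union> set b) ts" using b by (simp add: tuples_iff)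
      with definable_sat[OF \<phi>, of M "?B \<union> set b"]
      have "definable_pred L M (?B \<union> set b) ss (\<lambda>x. sat M (x @ b) \<phi>)"
        using \<open>?B \<union> set b \<subseteq> N\<close> N by (intro definable_section) auto
      from realizes_on_iff[OF morley_realizes[OF d(2) that] \<open>?B \<union> set b \<subseteq> N\<close> this]
      show ?thesis using \<open>D b \<noteq> v\<close> by (auto simp: D_def)
    qed
    let ?xs = "nths c w @ d"
    have "set (nths c w) \<subseteq> set c" by (rule set_nths_subset)
    then have "A \<union> set (concat (nths c w)) \<subseteq> ?B \<union> set b" by auto
    then have m: "morley A ?xs"
      unfolding morley_append using morley_nths[OF c(2)] morley_mono[OF d(2)] by simp
    have "{i. i < length c \<and> i \<in> w} = w" using w c by auto
    then have l: "length (nths c w) = k" using w by (simp add: length_nths)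
    have cv: "?P (y @ b) \<longleftrightarrow> v" if "y \<in> set (nths c w)" for y
      using that v by (auto simp: set_nths)
    have "pattern M ts ?P (\<lambda>i. (i < k) = v) ?xs"
      unfolding pattern_def
    proof (intro bexI[OF _ b] allI impI)
      fix i assume i: "i < length ?xs"
      show "?P (?xs ! i @ b) \<longleftrightarrow> (i < k) = v"
      proof (cases "i < k")
        case True
        then show ?thesis using cv[of "nths c w ! i"] l by (simp add: nth_append)
      next
        case False
        then show ?thesis using dv[of "d ! (i - k)"] i l d by (simp add: nth_append)
      qed
    qed
    then show False using nopat[OF m] l d by simp
  qed
  \<comment> \<open>A majority is expressed by a finite disjunction over the possible sets of
    \<open>k\<close> agreeing positions.\<close>
  let ?W = "{w. w \<subseteq> {..<2 * k} \<and> card w = k}"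
  have D_iff: "D b \<longleftrightarrow> (\<exists>w\<in>?W. \<forall>i\<in>w. ?P (c ! i @ b))" if b: "b \<in> tuples M (universe M) ts" for b
  proof
    assume Db: "D b"
    let ?T = "{i\<in>{..<2 * k}. ?P (c ! i @ b)}" and ?F = "{i\<in>{..<2 * k}. \<not> ?P (c ! i @ b)}"
    have "card ?T + card ?F = card (?T \<union> ?F)" by (rule card_Un_disjoint[symmetric]) auto
    also have "?T \<union> ?F = {..<2 * k}" by auto
    finally have "card ?T + card ?F = 2 * k" by simp
    then have "k \<le> card ?T \<or> k \<le> card ?F" by linarith
    then show "\<exists>w\<in>?W. \<forall>i\<in>w. ?P (c ! i @ b)"
    proof
      assume "k \<le> card ?T"
      then obtain w where "w \<subseteq> ?T" "card w = k" by (meson obtain_subset_with_card_n)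
      then show ?thesis by (intro bexI[of _ w]) auto
    next
      assume "k \<le> card ?F"
      then obtain w where w: "w \<subseteq> ?F" "card w = k" by (meson obtain_subset_with_card_n)
      have "D b = False" by (rule vote[OF b _ w(2)]) (use w(1) in auto)
      then show ?thesis using Db by simp
    qed
  next
    assume "\<exists>w\<in>?W. \<forall>i\<in>w. ?P (c ! i @ b)"
    then obtain w where w: "w \<in> ?W" "\<forall>i\<in>w. ?P (c ! i @ b)" by (rule bexE)
    have "D b = True" by (rule vote[OF b, of w]) (use w in auto)
    then show "D b" by simp
  qed
  have "definable_pred L M ?B ts (\<lambda>b. \<exists>w\<in>?W. \<forall>i\<in>w. ?P (c ! i @ b))"
  proof (intro definable_Bex definable_Ball BU)
    fix w i assume "w \<in> ?W" "i \<in> w"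
    then have "c ! i \<in> set c" using c by auto
    then have "c ! i \<in> tuples M ?B ss" using cs[of "c ! i"] by (auto simp: tuples_iff)
    with definable_sat[OF \<phi>, of M ?B] show "definable_pred L M ?B ts (\<lambda>b. ?P (c ! i @ b))"
      using BU by (rule definable_left_section)
  next
    fix w assume "w \<in> ?W"
    then show "finite w" by (auto intro: finite_subset)
  qed simp
  then have "definable_pred L M ?B ts D" by (rule definable_cong) (simp add: D_iff)
  from sat inf BU Bk Un_upper1 this have "definable_pred L M A ts D"
  proof (rule definable_of_invariant)
    fix u v assume "u \<in> tuples M (universe M) ts" "v \<in> tuples M (universe M) ts"
      "tp L M u A = tp L M v A" "D u"
    then show "D v" using in_type_invariant[of u ts v, OF _ _ _ P] N by (simp add: D_def)
  qed
  then show "\<exists>D. definable_pred L M A ts D \<and>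
    (\<forall>b\<in>tuples M N ts. in_type (\<lambda>a. sat M (a @ b) \<phi>) \<longleftrightarrow> D b)"
    by (intro exI[of _ D]) (simp add: D_def)
qed

section \<open>Morley sequences\<close>

lemma tp_complete:
  assumes "a \<in> tuples M (universe M) ss"
  shows "tp L M a B \<in> complete_types L M ss B"
proof -
  have s: "map (sort_of M) a = ss" using assms by (simp add: tuples_iff)
  show ?thesis
    unfolding complete_types_def
  proof (intro CollectI conjI allI impI)
    show "tp L M a B \<subseteq> formulas_over L M ss B" by (auto simp: tp_def s)
    show "\<forall>(\<phi>, b)\<in>formulas_over L M ss B. (\<phi>, b) \<in> tp L M a B \<or> (Neg \<phi>, b) \<in> tp L M a B"
      by (auto simp: tp_def s formulas_over_iff)
    fix F assume "F \<subseteq> tp L M a B" "finite F"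
    then have "\<forall>(\<phi>, b)\<in>F. sat M (a @ b) \<phi>" by (auto simp: tp_def)
    then show "\<exists>a\<in>tuples M (universe M) ss. \<forall>(\<phi>, b)\<in>F. sat M (a @ b) \<phi>"
      using assms by (rule bexI)
  qed
qed

lemma (in fs_type) tp_subset_realizes:
  assumes B: "B \<subseteq> N" and x: "x \<in> tuples M N ss" and sub: "tp L M x B \<subseteq> q"
  shows "realizes_on B x"
proof (rule realizes_onI[OF B x])
  fix \<phi> b assume b: "(\<phi>, b) \<in> q" "set b \<subseteq> B"
  show "sat M (x @ b) \<phi>"
  proof (rule ccontr)
    assume n: "\<not> sat M (x @ b) \<phi>"
    have "(\<phi>, b) \<in> formulas_over L M ss N" using b(1) q_formulas by blast
    then have "(Neg \<phi>, b) \<in> tp L M x B"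
      using n b(2) x by (simp add: tp_def formulas_over_iff tuples_iff)
    then have "{(\<phi>, b), (Neg \<phi>, b)} \<subseteq> q" using sub b(1) by blast
    then obtain a where "\<And>\<chi> d. (\<chi>, d) \<in> {(\<phi>, b), (Neg \<phi>, b)} \<Longrightarrow> sat M (a @ d) \<chi>"
      using q_finite[of "{(\<phi>, b), (Neg \<phi>, b)}"] by (metis finite.emptyI finite.insertI)
    from this[of \<phi> b] this[of "Neg \<phi>" b] show False by simp
  qed
qed

text \<open>Completing \<open>\<Gamma>\<close> with witnesses confined to \<open>A\<close>, that is,
  with the tuples of \<open>A\<close> as the set \<open>X\<close> of
  \<open>complete_types_extend\<close>, leaves the completion finitely satisfiable in
  \<open>A\<close>.\<close>

lemma coheir_exists:
  assumes A: "A \<subseteq> universe M" and \<Gamma>: "\<Gamma> \<subseteq> formulas_over L M ss (universe M)"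
    and fin: "\<And>F. F \<subseteq> \<Gamma> \<Longrightarrow> finite F \<Longrightarrow> \<exists>a\<in>tuples M A ss. \<forall>(\<phi>, b)\<in>F. sat M (a @ b) \<phi>"
  shows "\<exists>q. fs_type L M ss A (universe M) q \<and> \<Gamma> \<subseteq> q"
proof -
  have "tuples M A ss \<subseteq> tuples M (universe M) ss" using A by (auto intro: tuples_mono)
  then have "\<exists>q. q \<in> complete_types L M ss (universe M) \<and> \<Gamma> \<subseteq> q \<and>
    (\<forall>F\<subseteq>q. finite F \<longrightarrow> (\<exists>a\<in>tuples M A ss. \<forall>(\<phi>, b)\<in>F. sat M (a @ b) \<phi>))"
    using \<Gamma> fin by (intro complete_types_extend)
  then obtain q where q: "q \<in> complete_types L M ss (universe M)" "\<Gamma> \<subseteq> q"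
    and fs: "\<forall>F\<subseteq>q. finite F \<longrightarrow> (\<exists>a\<in>tuples M A ss. \<forall>(\<phi>, b)\<in>F. sat M (a @ b) \<phi>)"
    by (elim exE conjE)
  have "finitely_satisfiable_in M ss q A"
    unfolding finitely_satisfiable_in_def
  proof clarify
    fix \<phi> b assume "(\<phi>, b) \<in> q"
    then have "\<exists>a\<in>tuples M A ss. \<forall>(\<phi>, b)\<in>{(\<phi>, b)}. sat M (a @ b) \<phi>"
      by (intro fs[rule_format]) auto
    then show "\<exists>a\<in>tuples M A ss. sat M (a @ b) \<phi>" by simp
  qed
  then have "fs_type L M ss A (universe M) q"
    using A q(1) by unfold_locales auto
  then show ?thesis using q(2) by (intro exI[of _ q] conjI)
qed

text \<open>A formula true of \<open>a i\<close> over its predecessors has as parameters only their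
  entries and elements of \<open>A\<close>. Indiscernibility compares the terms at
  \<open>0, ..., i - 1, i\<close> with those at \<open>0, ..., i - 1, i'\<close>, so the formula is
  true of \<open>a i'\<close> as well.\<close>

lemma indiscernible_tp_mono:
  assumes A: "A \<subseteq> universe M" and a: "\<And>i. a i \<in> tuples M (universe M) ss"
    and ind: "indiscernible_sequence L M A a" and "i \<le> i'"
  shows "tp L M (a i) (A \<union> (\<Union>j<i. set (a j))) \<subseteq> tp L M (a i') (A \<union> (\<Union>j<i'. set (a j)))"
proof clarify
  let ?c = "concat (map a [0..<i])"
  let ?us = "concat (replicate i ss)"
  have sc: "set ?c = (\<Union>j<i. set (a j))" by auto
  have s: "map (sort_of M) (a i) = ss" for i using a[of i] by (simp add: tuples_iff)
  have c: "?c \<in> tuples M (universe M) ?us"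
    using concat_tuples[of "map a [0..<i]" M "universe M" ss] a by simp
  fix \<phi> b assume "(\<phi>, b) \<in> tp L M (a i) (A \<union> (\<Union>j<i. set (a j)))"
  then have b: "set b \<subseteq> A \<union> set ?c" "wff L (ss @ map (sort_of M) b) \<phi>" "sat M (a i @ b) \<phi>"
    by (auto simp: tp_def formulas_over_iff s)
  have "definable_pred L M (A \<union> set ?c) ss (\<lambda>x. sat M (x @ b) \<phi>)"
    using b by (intro definable_predI[of b]) auto
  then obtain P where P: "definable_pred L M A (ss @ ?us) P"
    and PP: "\<And>x. x \<in> tuples M (universe M) ss \<Longrightarrow> sat M (x @ b) \<phi> \<longleftrightarrow> P (x @ ?c)"
    using definable_unsection[OF _ c A] by metis
  let ?P = "\<lambda>e. P (drop (length ?us) e @ take (length ?us) e)"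
  have l: "length ?c = length ?us" using c by (rule tuples_length)
  have ev: "?P (concat (map a ([0..<i] @ [k]))) \<longleftrightarrow> sat M (a k @ b) \<phi>" for k
    using PP[OF a] l by simp
  have "tp L M (concat (map a ([0..<i] @ [i]))) A = tp L M (concat (map a ([0..<i] @ [i']))) A"
    by (rule ind[unfolded indiscernible_sequence_def, rule_format])
      (use \<open>i \<le> i'\<close> in \<open>auto simp: sorted_wrt_append\<close>)
  moreover have "definable_pred L M A (?us @ ss) ?P" using P by (rule definable_swap)
  moreover have "concat (map a ([0..<i] @ [k])) \<in> tuples M (universe M) (?us @ ss)" for k
    using tuples_append[OF c a[of k]] by simp
  ultimately have "?P (concat (map a ([0..<i] @ [i]))) \<longleftrightarrow> ?P (concat (map a ([0..<i] @ [i'])))"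
    by (intro tp_eqD[where us = "?us @ ss"])
  then have "sat M (a i' @ b) \<phi>" using b(3) unfolding ev by simp
  moreover have "set b \<subseteq> A \<union> (\<Union>j<i'. set (a j))"
    using b(1) \<open>i \<le> i'\<close> unfolding sc by (force simp: subset_eq)
  ultimately show "(\<phi>, b) \<in> tp L M (a i') (A \<union> (\<Union>j<i'. set (a j)))"
    using b(2) by (simp add: tp_def formulas_over_iff s)
qed

lemma (in fs_type) morley_map:
  assumes "\<And>i. realizes_on (A \<union> (\<Union>j<i. set (a j))) (a i)"
  shows "morley A (map a [0..<n])"
proof (induct n)
  case (Suc n)
  have "set (concat (map a [0..<n])) = (\<Union>j<n. set (a j))" by auto
  then show ?case using Suc assms[of n] by (simp add: morley_append)
qed simp

text \<open>The types of the terms over their predecessors increase, so a finite part of their union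
  lies in one of them, which is finitely satisfiable in \<open>A\<close>. Hence the union extends to
  a global coheir.\<close>

lemma Morley_sequence_type:
  assumes A: "A \<subseteq> universe M" and a: "\<And>i. a i \<in> tuples M (universe M) ss"
    and ind: "indiscernible_sequence L M A a"
    and fs: "\<And>i. finitely_satisfiable_in M ss (tp L M (a i) (A \<union> (\<Union>j<i. set (a j)))) A"
  shows "\<exists>q. fs_type L M ss A (universe M) q \<and>
    (\<forall>i. tp L M (a i) (A \<union> (\<Union>j<i. set (a j))) \<subseteq> q)"
proof -
  let ?B = "\<lambda>i. A \<union> (\<Union>j<i. set (a j))"
  let ?t = "\<lambda>i. tp L M (a i) (?B i)"
  have BU: "?B i \<subseteq> universe M" for i using A a by (auto simp: tuples_iff)
  have fst: "fs_type L M ss A (?B i) (?t i)" for i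
    using A BU[of i] tp_complete[OF a] fs by unfold_locales auto
  have "\<exists>q. fs_type L M ss A (universe M) q \<and> (\<Union>i. ?t i) \<subseteq> q"
  proof (rule coheir_exists[OF A])
    have "?t i \<subseteq> formulas_over L M ss (universe M)" for i
      using BU[of i] a[of i] unfolding tp_def formulas_over_def tuples_iff by blast
    then show "(\<Union>i. ?t i) \<subseteq> formulas_over L M ss (universe M)" by blast
    fix F assume F: "F \<subseteq> (\<Union>i. ?t i)" "finite F"
    from F(2,1) have "\<exists>i. F \<subseteq> ?t i"
    proof (induct F rule: finite_induct)
      case (insert x F)
      then obtain i j where ij: "F \<subseteq> ?t i" "x \<in> ?t j" by blast
      have "?t i \<subseteq> ?t (max i j)" "?t j \<subseteq> ?t (max i j)"
        by (rule indiscernible_tp_mono[OF A a ind], simp)+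
      then show ?case using ij by (intro exI[of _ "max i j"]) blast
    qed simp
    then obtain i where "F \<subseteq> ?t i" ..
    with F(2) show "\<exists>a\<in>tuples M A ss. \<forall>(\<phi>, b)\<in>F. sat M (a @ b) \<phi>"
      by (rule fs_type.q_finite_in_A[OF fst])
  qed
  then show ?thesis by (simp add: UN_subset_iff)
qed

text \<open>Here \<open>\<kappa>\<close> is merely a bound on the parameter sets over which the type
  is realized in \<open>N\<close>; it will be the degree of saturation of a submodel, not that of
  the monster model.\<close>

lemma (in fs_type) Shelah_stable_if_definable:
  assumes def: definable_type and p: "p \<subseteq> q" "p \<subseteq> formulas_over L M ss A"
    and inf: "Cinfinite \<kappa>" and A: "|A| <o \<kappa>"
    and ex: "\<And>B. B \<subseteq> N \<Longrightarrow> |B| <o \<kappa> \<Longrightarrow> \<exists>x. realizes_on B x"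
  shows "Shelah_stable L M ss A p"
proof -
  \<comment> \<open>Dependent choice is made on initial segments, each extending the previous one,
    since the next element depends on all of its predecessors.\<close>
  have "\<exists>f. \<forall>n. (length (f n) = n \<and> morley A (f n)) \<and> (\<exists>x. f (Suc n) = f n @ [x])"
  proof (rule dependent_nat_choice)
    show "\<exists>xs. length xs = 0 \<and> morley A xs" by simp
    fix xs n assume xs: "length xs = n \<and> morley A xs"
    have "concat xs \<in> tuples M N (concat (replicate (length xs) ss))"
      using conjunct2[OF xs] by (rule morley_concat)
    then have "A \<union> set (concat xs) \<subseteq> N" using A_N by (simp add: tuples_iff)
    then obtain x where "realizes_on (A \<union> set (concat xs)) x"
      using ex Cinfinite_Un_set[OF inf A] by blast
    then show "\<exists>ys. (length ys = Suc n \<and> morley A ys) \<and> (\<exists>x. ys = xs @ [x])"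
      using xs by (intro exI[of _ "xs @ [x]"]) (simp add: morley_append)
  qed
  then obtain f where f: "\<And>n. length (f n) = n" "\<And>n. morley A (f n)" "\<And>n. \<exists>x. f (Suc n) = f n @ [x]"
    by blast
  define a where "a n = f (Suc n) ! n" for n
  have fa: "f n = map a [0..<n]" for n
  proof (induct n)
    case 0
    then show ?case using f(1)[of 0] by simp
  next
    case (Suc n)
    obtain x where x: "f (Suc n) = f n @ [x]" using f(3) by blast
    then have "a n = x" using f(1)[of n] by (simp add: a_def nth_append)
    then show ?case using x Suc by simp
  qed
  have mor: "morley A (map a [0..<n])" for n using f(2)[of n] fa by simp
  have r: "realizes_on (A \<union> (\<Union>j<i. set (a j))) (a i)" for i
  proof -
    have "set (concat (map a [0..<i])) = (\<Union>j<i. set (a j))" by auto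
    then show ?thesis using mor[of "Suc i"] by (simp add: morley_append)
  qed
  have aN: "a i \<in> tuples M N ss" for i using r by (rule realizes_on_tuple)
  have BN: "A \<union> (\<Union>j<i. set (a j)) \<subseteq> N" for i using A_N aN by (auto simp: tuples_iff)
  have mor_distinct: "morley A (map a is)" if "distinct is" for "is"
  proof -
    obtain n where n: "set is \<subseteq> {..<n}" using finite_nat_set_iff_bounded[of "set is"] by auto
    \<comment> \<open>The indices below \<open>n\<close> that are missing from \<open>is\<close> are
      put behind it. The result permutes the first \<open>n\<close> terms, so it is again a Morley
      list, and \<open>is\<close> is an initial part of it.\<close>
    let ?js = "filter (\<lambda>i. i \<notin> set is) [0..<n]"
    have "mset [0..<n] = mset (is @ ?js)"
      using that n by (subst set_eq_iff_mset_eq_distinct[symmetric]) auto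
    then have "mset (map a [0..<n]) = mset (map a is @ map a ?js)"
      by (metis map_append mset_map)
    with mor have "morley A (map a is @ map a ?js)"
      by (rule morley_perm[OF def order_refl A_N])
    then show ?thesis by (simp add: morley_append)
  qed
  have set: "indiscernible_set L M A a"
    unfolding indiscernible_set_def using mor_distinct morley_unique by simp
  show ?thesis
    unfolding Shelah_stable_def
  proof (intro exI[of _ a] conjI allI set)
    fix i
    show "realizes M ss (a i) p"
      unfolding realizes_def
    proof (intro conjI)
      show "a i \<in> tuples M (universe M) ss" using aN N_U by (rule tuples_mono)
      show "\<forall>(\<phi>, b)\<in>p. sat M (a i @ b) \<phi>"
      proof clarify
        fix \<phi> b assume "(\<phi>, b) \<in> p"
        then have "(\<phi>, b) \<in> q" "set b \<subseteq> A" using p unfolding formulas_over_def by auto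
        then show "sat M (a i @ b) \<phi>" using realizes_on_sat[OF r] by blast
      qed
    qed
    show "finitely_satisfiable_in M ss (tp L M (a i) (A \<union> (\<Union>j<i. set (a j)))) A"
      unfolding finitely_satisfiable_in_def
    proof clarify
      fix \<phi> b assume "(\<phi>, b) \<in> tp L M (a i) (A \<union> (\<Union>j<i. set (a j)))"
      then have b: "set b \<subseteq> A \<union> (\<Union>j<i. set (a j))" "wff L (ss @ map (sort_of M) b) \<phi>"
        "sat M (a i @ b) \<phi>"
        using aN[of i] by (auto simp: tp_def formulas_over_iff tuples_iff)
      have "definable_pred L M (A \<union> (\<Union>j<i. set (a j))) ss (\<lambda>x. sat M (x @ b) \<phi>)"
        using b(1,2) by (intro definable_predI[of b]) auto
      from realizes_on_fs[OF BN r this b(3)] show "\<exists>a\<in>tuples M A ss. sat M (a @ b) \<phi>" .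
    qed
  next
    show "indiscernible_sequence L M A a"
      using set unfolding indiscernible_set_def indiscernible_sequence_def
      by (simp add: strict_sorted_iff)
  qed
qed

lemma Shelah_stable_imp_definable:
  assumes stable: "Shelah_stable L M ss A p" and p: "p \<in> complete_types L M ss A"
    and dep: "dependent L M" and sat: "saturated \<kappa> L M" and inf: "Cinfinite \<kappa>"
    and nat: "natLeq <o \<kappa>" and A: "A \<subseteq> universe M" "|A| <o \<kappa>"
    and q: "fs_type L M ss A (universe M) q" "p \<subseteq> q"
  shows "definable_over L M ss (universe M) q A"
proof -
  obtain a where real: "\<And>i. realizes M ss (a i) p" and seq: "indiscernible_sequence L M A a"
    and fs: "\<And>i. finitely_satisfiable_in M ss (tp L M (a i) (A \<union> (\<Union>j<i. set (a j)))) A"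
    and set: "indiscernible_set L M A a"
    using stable unfolding Shelah_stable_def by auto
  have a: "a i \<in> tuples M (universe M) ss" for i using real by (simp add: realizes_def)
  obtain r where r: "fs_type L M ss A (universe M) r"
    and tr: "\<forall>i. tp L M (a i) (A \<union> (\<Union>j<i. set (a j))) \<subseteq> r"
    using Morley_sequence_type[OF A(1) a seq fs] by (elim exE conjE)
  interpret Q: fs_type L M ss A "universe M" q by (rule q)
  interpret R: fs_type L M ss A "universe M" r by (rule r)
  have "A \<union> (\<Union>j<i. set (a j)) \<subseteq> universe M" for i using A a by (auto simp: tuples_iff)
  from R.tp_subset_realizes[OF this a spec[OF tr]]
  have mor: "R.morley A (map a [0..<n])" for n by (rule R.morley_map)
  have R_tp: "tp L M (concat xs) A = tp L M (concat (map a [0..<length xs])) A"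
    if "R.morley A xs" for xs
    using that mor by (rule R.morley_unique) simp
  have R_def: R.definable_type
    using dep sat inf nat refl A(2) a set R_tp by (rule R.definable_type_of_indiscernible_set)
  have "p \<subseteq> r"
  proof clarify
    fix \<phi> b assume b: "(\<phi>, b) \<in> p"
    then have "(\<phi>, b) \<in> formulas_over L M ss A" using p by (auto simp: complete_types_def)
    moreover have "sat M (a 0 @ b) \<phi>" using b real[of 0] unfolding realizes_def by auto
    ultimately have "(\<phi>, b) \<in> tp L M (a 0) (A \<union> (\<Union>j<0. set (a j)))"
      using a[of 0] by (simp add: tp_def tuples_iff)
    then show "(\<phi>, b) \<in> r" using spec[OF tr, of 0] by blast
  qed
  \<comment> \<open>The type of the last entry \<open>c\<close> over the preceding ones is finitely
    satisfiable in \<open>A\<close>, so \<open>R.morley_add\<close> keeps \<open>xs\<close> a Morley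
    list of \<open>r\<close> over \<open>c\<close>. Over \<open>A\<close> alone \<open>c\<close>
    realizes \<open>p\<close> and hence \<open>r\<close>. Thus \<open>c # xs\<close> is a Morley
    list of \<open>r\<close>, and permutability restores the order.\<close>
  have "R.morley A xs" if "Q.morley A xs" for xs
    using that
  proof (induct xs rule: rev_induct)
    case (snoc c xs)
    have c: "Q.morley A xs" "Q.realizes_on (A \<union> set (concat xs)) c"
      using snoc(2) by (auto simp: Q.morley_append)
    have cU: "c \<in> tuples M (universe M) ss" using c(2) by (rule Q.realizes_on_tuple)
    have "concat xs \<in> tuples M (universe M) (concat (replicate (length xs) ss))"
      using c(1) by (rule Q.morley_concat)
    then have sub: "A \<union> set (concat xs) \<subseteq> universe M" using A by (simp add: tuples_iff)
    have "R.morley (A \<union> set c) xs"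
      by (rule R.morley_add[OF R_def cU order_refl A(1) snoc(1)[OF c(1)]])
        (rule Q.realizes_on_fs[OF sub c(2)])
    moreover have "R.realizes_on A c"
    proof (rule R.tp_subset_realizes[OF A(1) cU], clarify)
      fix \<phi> b assume b: "(\<phi>, b) \<in> tp L M c A"
      then have f: "(\<phi>, b) \<in> formulas_over L M ss A" and s: "sat M (c @ b) \<phi>"
        using cU by (auto simp: tp_def tuples_iff)
      have "(Neg \<phi>, b) \<notin> p"
      proof
        assume "(Neg \<phi>, b) \<in> p"
        then have "sat M (c @ b) (Neg \<phi>)"
          using q(2) f by (intro Q.realizes_on_sat[OF c(2)]) (auto simp: formulas_over_iff)
        then show False using s by simp
      qed
      then have "(\<phi>, b) \<in> p" using f p unfolding complete_types_def by auto
      then show "(\<phi>, b) \<in> r" using \<open>p \<subseteq> r\<close> by blast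
    qed
    ultimately have "R.morley A (c # xs)" by simp
    then show ?case by (rule R.morley_perm[OF R_def order_refl A(1)]) simp
  qed simp
  then have Q_tp: "tp L M (concat xs) A = tp L M (concat (map a [0..<length xs])) A"
    if "Q.morley A xs" for xs
    using that R_tp by blast
  have Q.definable_type
    using dep sat inf nat refl A(2) a set Q_tp by (rule Q.definable_type_of_indiscernible_set)
  then show ?thesis by (simp add: Q.definable_over_iff)
qed

section \<open>Small saturated elementary submodels\<close>

lemma card_of_Pow_mono:
  assumes "|A| \<le>o |B|"
  shows "|Pow A| \<le>o |Pow B|"
proof -
  obtain f where f: "inj_on f A" "f ` A \<subseteq> B" using assms card_of_ordLeq by metis
  have "inj_on (image f) (Pow A)" "image f ` Pow A \<subseteq> Pow B"
    using f by (auto intro: inj_on_image_Pow)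
  then show ?thesis using card_of_ordLeq by metis
qed

lemma card_of_Pow_Times_infinite:
  assumes "infinite K"
  shows "|Pow (K \<times> K)| \<le>o |Pow K|"
  using card_of_Times_same_infinite[OF assms] by (intro card_of_Pow_mono ordIso_imp_ordLeq)

lemma card_of_Times_ordLeq_infinite:
  assumes "infinite K" "|A| \<le>o |K|" "|B| \<le>o |K|"
  shows "|A \<times> B| \<le>o |K|"
  using card_of_Sigma_ordLeq_infinite[OF assms(1,2), of "\<lambda>_. B"] assms(3) by simp

text \<open>
  The cardinal identity \<open>(2 ^ K) ^ K = 2 ^ K\<close>: a small \<open>B\<close> is coded by its image \<open>H\<close> in \<open>K\<close>
  together with the graph of the subsets of \<open>K\<close> that code its elements.
\<close>

lemma card_of_small_subsets:
  fixes K :: "'k set" and X :: "'m set"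
  assumes K: "infinite K" and X: "|X| \<le>o |Pow K|"
  shows "|{B. B \<subseteq> X \<and> |B| \<le>o |K|}| \<le>o |Pow K|"
proof -
  obtain g where g: "inj_on g X" "g ` X \<subseteq> Pow K" using X card_of_ordLeq by metis
  \<comment> \<open>The rows of \<open>Z\<close> indexed by \<open>H\<close> are the codes under
    \<open>g\<close> of the members of the decoded set.\<close>
  define dec where "dec = (\<lambda>(H :: 'k set, Z :: ('k \<times> 'k) set). {x\<in>X. \<exists>k\<in>H. g x = {l. (k, l) \<in> Z}})"
  have "{B. B \<subseteq> X \<and> |B| \<le>o |K|} \<subseteq> dec ` (Pow K \<times> Pow (K \<times> K))"
  proof clarify
    fix B assume B: "B \<subseteq> X" "|B| \<le>o |K|"
    obtain h where h: "inj_on h B" "h ` B \<subseteq> K" using B(2) card_of_ordLeq by metis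
    let ?Z = "{(h x, l) | x l. x \<in> B \<and> l \<in> g x}"
    have Z: "{l. (h x, l) \<in> ?Z} = g x" if "x \<in> B" for x
      using that h(1) by (auto simp: inj_on_def)
    have "dec (h ` B, ?Z) = {x\<in>X. \<exists>y\<in>B. g x = g y}"
      unfolding dec_def using Z by auto
    also have "\<dots> = B" using B(1) g(1) by (auto simp: inj_on_def)
    finally have "B = dec (h ` B, ?Z)" ..
    moreover have "?Z \<subseteq> K \<times> K" using B(1) g(2) h(2) by blast
    ultimately show "B \<in> dec ` (Pow K \<times> Pow (K \<times> K))" using h(2) by blast
  qed
  then have "|{B. B \<subseteq> X \<and> |B| \<le>o |K|}| \<le>o |Pow K \<times> Pow (K \<times> K)|" by (rule surj_imp_ordLeq)
  also have "|Pow K \<times> Pow (K \<times> K)| \<le>o |Pow K|"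
    using K card_of_Pow_Times_infinite[OF K]
    by (intro card_of_Times_ordLeq_infinite) (simp_all add: card_of_mono1)
  finally show ?thesis .
qed

lemma card_of_lists_infinite:
  assumes K: "infinite K" and B: "|B| \<le>o |K|"
  shows "|{xs. set xs \<subseteq> B}| \<le>o |K|"
proof -
  have "|{xs. set xs \<subseteq> B \<and> length xs = n}| \<le>o |K|" for n
  proof (induct n)
    case 0
    have "{xs. set xs \<subseteq> B \<and> length xs = 0} = {[]}" by auto
    moreover have "|{[] :: 'b list}| \<le>o |K|"
      using K by (intro card_of_singl_ordLeq) auto
    ultimately show ?case by simp
  next
    case (Suc n)
    have "{xs. set xs \<subseteq> B \<and> length xs = Suc n} \<subseteq>
      (\<lambda>(x, xs). x # xs) ` (B \<times> {xs. set xs \<subseteq> B \<and> length xs = n})"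
    proof clarify
      fix xs assume "set xs \<subseteq> B" "length xs = Suc n"
      then show "xs \<in> (\<lambda>(x, xs). x # xs) ` (B \<times> {xs. set xs \<subseteq> B \<and> length xs = n})"
        by (cases xs) auto
    qed
    then have "|{xs. set xs \<subseteq> B \<and> length xs = Suc n}| \<le>o
      |B \<times> {xs. set xs \<subseteq> B \<and> length xs = n}|" by (rule surj_imp_ordLeq)
    also have "|B \<times> {xs. set xs \<subseteq> B \<and> length xs = n}| \<le>o |K|"
      using K B Suc by (rule card_of_Times_ordLeq_infinite)
    finally show ?case .
  qed
  moreover have "|UNIV :: nat set| \<le>o |K|"
    using K infinite_iff_card_of_nat by blast
  ultimately have "|\<Union>n. {xs. set xs \<subseteq> B \<and> length xs = n}| \<le>o |K|"
    using K by (intro card_of_UNION_ordLeq_infinite) auto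
  moreover have "(\<Union>n. {xs. set xs \<subseteq> B \<and> length xs = n}) = {xs. set xs \<subseteq> B}" by auto
  ultimately show ?thesis by simp
qed

text \<open>Stage \<open>i\<close> consists of \<open>A\<close> and of \<open>R B\<close> for every
  small \<open>B\<close> inside an earlier stage. The inductive form avoids a recursion along the
  ordering \<open>r\<close>.\<close>

inductive stage :: "'i rel \<Rightarrow> 'm set \<Rightarrow> ('m set \<Rightarrow> 'm set) \<Rightarrow> ('m set \<Rightarrow> bool) \<Rightarrow> 'i \<Rightarrow> 'm \<Rightarrow> bool"
  for r A R small where
  stage_base: "x \<in> A \<Longrightarrow> stage r A R small i x"
| stage_step: "(j, i) \<in> r \<Longrightarrow> j \<noteq> i \<Longrightarrow> small B \<Longrightarrow> \<forall>y\<in>B. stage r A R small j y \<Longrightarrow> x \<in> R B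
    \<Longrightarrow> stage r A R small i x"

text \<open>Iterating \<open>R\<close> along the regular cardinal \<open>cardSuc |K|\<close>.\<close>

lemma small_closure:
  fixes K :: "'k set" and R :: "'m set \<Rightarrow> 'm set"
  assumes K: "infinite K" and A: "|A| \<le>o |K|"
    and R: "\<And>B. |B| \<le>o |K| \<Longrightarrow> |R B| \<le>o |Pow K|"
    and U: "A \<subseteq> U" "\<And>B. R B \<subseteq> U"
  shows "\<exists>X. A \<subseteq> X \<and> X \<subseteq> U \<and> |X| \<le>o |Pow K| \<and> (\<forall>B\<subseteq>X. |B| \<le>o |K| \<longrightarrow> R B \<subseteq> X)"
proof -
  define r where "r = cardSuc |K|"
  define small where "small B \<longleftrightarrow> |B| \<le>o |K|" for B :: "'m set"
  define S where "S i = {x. stage r A R small i x}" for i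
  have CK: "Card_order |K|" by (rule card_of_Card_order)
  have r: "Card_order r" unfolding r_def using CK by (rule cardSuc_Card_order)
  have wo: "Well_order r" using r unfolding card_order_on_def by simp
  have infr: "infinite (Field r)"
    using K by (simp add: r_def card_of_cardSuc_finite)
  have infP: "infinite (Pow K)" using K by simp
  have KP: "|K| \<le>o |Pow K|" using card_of_Pow by (rule ordLess_imp_ordLeq)
  have rP: "r \<le>o |Pow K|"
    unfolding r_def using CK card_of_Card_order card_of_Pow by (rule cardSuc_least)
  have S_sub: "S i \<subseteq> A \<union> (\<Union>j\<in>underS r i. \<Union>B\<in>{B. B \<subseteq> S j \<and> |B| \<le>o |K|}. R B)" for i
  proof
    fix x assume "x \<in> S i"
    then have "stage r A R small i x" by (simp add: S_def)
    then show "x \<in> A \<union> (\<Union>j\<in>underS r i. \<Union>B\<in>{B. B \<subseteq> S j \<and> |B| \<le>o |K|}. R B)"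
    proof cases
      case (stage_step j B)
      then have "j \<in> underS r i" "B \<subseteq> S j" "|B| \<le>o |K|"
        by (auto simp: underS_def S_def small_def)
      then show ?thesis using stage_step by blast
    qed simp
  qed
  have mono: "S i \<subseteq> S j" if ij: "(i, j) \<in> r" for i j
  proof
    have tr: "trans r" and an: "antisym r"
      using wo unfolding order_on_defs well_order_on_def by blast+
    fix x assume "x \<in> S i"
    then have "stage r A R small i x" by (simp add: S_def)
    then have "stage r A R small j x"
    proof cases
      case (stage_step k B)
      have "(k, j) \<in> r" using tr stage_step(1) ij by (rule transD)
      moreover have "k \<noteq> j" using stage_step(1,2) ij an by (auto dest: antisymD)
      ultimately show ?thesis using stage_step by (intro stage.stage_step)
    qed (rule stage_base)
    then show "x \<in> S j" by (simp add: S_def)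
  qed
  have wf: "wf (r - Id)" using wo unfolding well_order_on_def by blast
  \<comment> \<open>Transfinite induction: besides \<open>A\<close>, stage \<open>i\<close> is made
    from at most 2^|K| earlier stages, each with at most 2^|K| small subsets \<open>B\<close>, and
    each \<open>R B\<close> has at most 2^|K| elements.\<close>
  have card: "i \<in> Field r \<Longrightarrow> |S i| \<le>o |Pow K|" for i
  proof (induct i rule: wf_induct_rule[OF wf])
    case (1 i)
    have "|underS r i| <o r" using r 1(2) by (rule card_of_underS)
    then have under: "|underS r i| \<le>o |Pow K|"
      using rP ordLess_imp_ordLeq ordLess_ordLeq_trans by blast
    have "|\<Union>j\<in>underS r i. \<Union>B\<in>{B. B \<subseteq> S j \<and> |B| \<le>o |K|}. R B| \<le>o |Pow K|"
    proof (rule card_of_UNION_ordLeq_infinite[OF infP under], rule ballI)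
      fix j assume "j \<in> underS r i"
      then have "(j, i) \<in> r - Id" "j \<in> Field r" by (auto simp: underS_def Field_def)
      then have "|S j| \<le>o |Pow K|" by (rule 1(1))
      from card_of_small_subsets[OF K this]
      show "|\<Union>B\<in>{B. B \<subseteq> S j \<and> |B| \<le>o |K|}. R B| \<le>o |Pow K|"
        using R by (intro card_of_UNION_ordLeq_infinite[OF infP]) auto
    qed
    moreover have "|A| \<le>o |Pow K|" using A KP by (rule ordLeq_transitive)
    ultimately have "|A \<union> (\<Union>j\<in>underS r i. \<Union>B\<in>{B. B \<subseteq> S j \<and> |B| \<le>o |K|}. R B)| \<le>o |Pow K|"
      using infP by (intro card_of_Un_ordLeq_infinite_Field)
        (simp_all add: Field_card_of card_of_card_order_on)
    with card_of_mono1[OF S_sub] show ?case by (rule ordLeq_transitive)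
  qed
  let ?X = "\<Union>i\<in>Field r. S i"
  have "Field r \<noteq> {}" using infr by auto
  then have "A \<subseteq> ?X" by (auto simp: S_def intro: stage_base)
  moreover have "?X \<subseteq> U"
  proof -
    have "stage r A R small i x \<Longrightarrow> x \<in> U" for i x
      by (induct rule: stage.induct) (use U in auto)
    then show ?thesis by (auto simp: S_def)
  qed
  moreover have "|?X| \<le>o |Pow K|"
  proof (rule card_of_UNION_ordLeq_infinite[OF infP])
    show "|Field r| \<le>o |Pow K|"
      using card_of_Field_ordIso[OF r] rP by (rule ordIso_ordLeq_trans)
  qed (use card in blast)
  moreover have "R B \<subseteq> ?X" if B: "B \<subseteq> ?X" "|B| \<le>o |K|" for B
  proof -
    \<comment> \<open>Regularity of the successor cardinal puts \<open>B\<close> inside a single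
      stage, and as \<open>r\<close> has no last element there is a later stage, which contains
      \<open>R B\<close>.\<close>
    have "relChain r S" using mono by (simp add: relChain_def)
    then obtain i where i: "i \<in> Field r" "B \<subseteq> S i"
      using cardSuc_UNION[OF CK, of S B] K B unfolding r_def by (auto simp: Field_card_of)
    obtain j where j: "j \<in> Field r" "i \<noteq> j" "(i, j) \<in> r"
      using infinite_Card_order_limit[OF r infr i(1)] by blast
    have "R B \<subseteq> S j"
      using i(2) B(2) j stage_step[of i j r small B A R] by (auto simp: S_def small_def)
    then show ?thesis using j(1) by blast
  qed
  ultimately show ?thesis by (intro exI[of _ ?X]) simp
qed

section \<open>Sets realizing all types over their small subsets are saturated elementary
  submodels\<close>

context
  fixes L :: "('s, 'f, 'r) language" and C :: "('s, 'f, 'r, 'm) struct"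
    and X :: "'m set" and K :: "'k set"
  assumes struct: "is_structure L C" and XU: "X \<subseteq> universe C" and K: "infinite K"
    and cl: "\<And>B m. B \<subseteq> X \<Longrightarrow> |B| \<le>o |K| \<Longrightarrow> m \<in> universe C \<Longrightarrow>
      \<exists>m'\<in>X. tp L C [m'] B = tp L C [m] B"
begin

lemma set_small: "|set a| \<le>o |K|"
  using K by (intro ordLess_imp_ordLeq set_ordLess_Cinfinite)
    (simp add: cinfinite_def Field_card_of card_of_card_order_on)

lemma closed_realize:
  assumes B: "B \<subseteq> X" "|B| \<le>o |K|" and m: "m \<in> universe C"
  obtains m' where "m' \<in> X" "sort_of C m' = sort_of C m"
    "\<And>\<phi> b. set b \<subseteq> B \<Longrightarrow> wff L (sort_of C m # map (sort_of C) b) \<phi> \<Longrightarrow>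
      sat C (m' # b) \<phi> \<longleftrightarrow> sat C (m # b) \<phi>"
proof -
  obtain m' where m': "m' \<in> X" "tp L C [m'] B = tp L C [m] B" using cl[OF B m] by (rule bexE)
  \<comment> \<open>A type carries the sorts of its tuple only through the well-formedness of its
    formulas. \<open>?e\<close> asserts that the element equals one of the sort of \<open>m\<close>,
    which forces equal sorts.\<close>
  let ?e = "Ex (sort_of C m) (Eq (Var 0) (Var (Suc 0)))"
  have "has_sort L [sort_of C m, sort_of C m] (Var 0) (sort_of C m)"
    "has_sort L [sort_of C m, sort_of C m] (Var (Suc 0)) (sort_of C m)"
    using has_sort_Var[of 0 "[sort_of C m, sort_of C m]" L]
      has_sort_Var[of "Suc 0" "[sort_of C m, sort_of C m]" L] by simp_all
  then have "(?e, []) \<in> tp L C [m] B"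
    using m by (auto simp: tp_def formulas_over_iff)
  then have "(?e, []) \<in> tp L C [m'] B" using m'(2) by simp
  then have s: "sort_of C m' = sort_of C m" by (auto simp: tp_def)
  show thesis
  proof (rule that[OF m'(1) s])
    fix \<phi> b assume "set b \<subseteq> B" "wff L (sort_of C m # map (sort_of C) b) \<phi>"
    then have "(\<phi>, b) \<in> tp L C [x] B \<longleftrightarrow> sat C (x # b) \<phi>" if "sort_of C x = sort_of C m" for x
      using that by (simp add: tp_def formulas_over_iff)
    from this[OF s] this[OF refl] show "sat C (m' # b) \<phi> \<longleftrightarrow> sat C (m # b) \<phi>"
      using m'(2) by simp
  qed
qed

lemma eval_universe_update: "eval_trm (C\<lparr>universe := X\<rparr>) e t = eval_trm C e t"
  by (induct t) (simp_all cong: map_cong)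

text \<open>The Tarski-Vaught test: a witness in \<open>C\<close> is replaced by an element of
  \<open>X\<close> with the same type over the finite set of parameters.\<close>

lemma sat_universe_update:
  "wff L ss \<phi> \<Longrightarrow> a \<in> tuples C X ss \<Longrightarrow> sat (C\<lparr>universe := X\<rparr>) a \<phi> \<longleftrightarrow> sat C a \<phi>"
proof (induct \<phi> arbitrary: ss a)
  case (Ex s \<phi>)
  have a: "set a \<subseteq> X" "map (sort_of C) a = ss" using Ex(3) by (auto simp: tuples_iff)
  have IH: "sat (C\<lparr>universe := X\<rparr>) (m # a) \<phi> \<longleftrightarrow> sat C (m # a) \<phi>" if "m \<in> X" "sort_of C m = s" for m
    using that a Ex(2) by (intro Ex(1)[of "s # ss"]) (auto simp: tuples_iff)
  show ?case
  proof
    assume "sat (C\<lparr>universe := X\<rparr>) a (Ex s \<phi>)"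
    then show "sat C a (Ex s \<phi>)" using IH XU by auto
  next
    assume "sat C a (Ex s \<phi>)"
    then obtain m where m: "m \<in> universe C" "sort_of C m = s" "sat C (m # a) \<phi>" by auto
    obtain m' where m': "m' \<in> X" "sort_of C m' = sort_of C m"
      and eq: "\<And>\<phi> b. set b \<subseteq> set a \<Longrightarrow> wff L (sort_of C m # map (sort_of C) b) \<phi> \<Longrightarrow>
        sat C (m' # b) \<phi> \<longleftrightarrow> sat C (m # b) \<phi>"
      using closed_realize[OF a(1) set_small m(1)] by metis
    have "sat C (m' # a) \<phi>" using eq[of a \<phi>] m Ex(2) a by simp
    then show "sat (C\<lparr>universe := X\<rparr>) a (Ex s \<phi>)" using IH[of m'] m' m(2) by auto
  qed
qed (auto simp: eval_universe_update cong: map_cong)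

lemma elementary_universe_update: "elementary_submodel L (C\<lparr>universe := X\<rparr>) C"
  unfolding elementary_submodel_def
proof (intro conjI allI ballI impI)
  show "\<exists>Y\<subseteq>universe C. C\<lparr>universe := X\<rparr> = C\<lparr>universe := Y\<rparr>" using XU by blast
  show "sat (C\<lparr>universe := X\<rparr>) a \<phi> \<longleftrightarrow> sat C a \<phi>"
    if "a \<in> tuples C (universe (C\<lparr>universe := X\<rparr>)) ss" "wff L ss \<phi>" for ss \<phi> a
    using that by (simp add: sat_universe_update)
  show "is_structure L (C\<lparr>universe := X\<rparr>)"
    unfolding is_structure_def
  proof (intro conjI allI impI ballI)
    fix s
    obtain m where m: "m \<in> universe C" "sort_of C m = s" using struct unfolding is_structure_def by metis
    obtain m' where "m' \<in> X" "sort_of C m' = sort_of C m"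
      using closed_realize[of "set []" m, OF _ set_small m(1)] by (metis empty_iff list.set(1) subsetI)
    then show "\<exists>m\<in>universe (C\<lparr>universe := X\<rparr>). sort_of (C\<lparr>universe := X\<rparr>) m = s" using m(2) by auto
  next
    fix f us s a
    assume f: "fun_sig L f = Some (us, s)"
      and "a \<in> tuples (C\<lparr>universe := X\<rparr>) (universe (C\<lparr>universe := X\<rparr>)) us"
    then have a: "set a \<subseteq> X" "map (sort_of C) a = us" by (auto simp: tuples_iff)
    then have "a \<in> tuples C (universe C) us" using XU by (auto simp: tuples_iff)
    then have m: "fun_int C f a \<in> universe C" "sort_of C (fun_int C f a) = s"
      using struct f unfolding is_structure_def by blast+
    \<comment> \<open>Variable \<open>0\<close> stands for the value and variables from
      \<open>1\<close> on for the arguments, so \<open>?e\<close> defines the value of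
      \<open>f\<close> at \<open>a\<close>. An element of \<open>X\<close> with the type of that
      value over \<open>a\<close> must be the value itself.\<close>
    let ?ts = "map Var [1..<Suc (length a)]"
    let ?e = "Eq (Var 0) (App f ?ts)"
    have len: "length a = length us" using a(2) by auto
    have "list_all2 (has_sort L (s # us)) ?ts us"
      unfolding list_all2_conv_all_nth
    proof (intro conjI allI impI)
      fix i assume "i < length ?ts"
      then have "i < length us" by (simp add: len del: upt_Suc)
      then show "has_sort L (s # us) (?ts ! i) (us ! i)"
        using has_sort_Var[of "Suc i" "s # us" L] len by (simp del: upt_Suc)
    qed (simp add: len del: upt_Suc)
    then have w: "wff L (s # us) ?e"
      using has_sort_Var[of 0 "s # us" L] has_sort_App[OF f] by auto
    have ev: "sat C (x # a) ?e \<longleftrightarrow> x = fun_int C f a" for x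
    proof -
      have "map (eval_trm C (x # a)) ?ts = a" by (rule nth_equalityI) (simp_all del: upt_Suc)
      then show ?thesis by (simp del: upt_Suc map_map)
    qed
    obtain m' where m': "m' \<in> X"
      and eq: "\<And>\<phi> b. set b \<subseteq> set a \<Longrightarrow>
        wff L (sort_of C (fun_int C f a) # map (sort_of C) b) \<phi> \<Longrightarrow>
        sat C (m' # b) \<phi> \<longleftrightarrow> sat C (fun_int C f a # b) \<phi>"
      using closed_realize[OF a(1) set_small m(1)] by metis
    have "m' = fun_int C f a"
      using eq[of a ?e] w m(2) a(2) unfolding ev by (simp del: upt_Suc)
    then show "fun_int (C\<lparr>universe := X\<rparr>) f a \<in> universe (C\<lparr>universe := X\<rparr>)"
      "sort_of (C\<lparr>universe := X\<rparr>) (fun_int (C\<lparr>universe := X\<rparr>) f a) = s" using m' m(2) by auto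
  qed
qed

text \<open>A set of size below the successor of |K| has size at most |K|. A type over it is
  realized in \<open>C\<close>, and \<open>cl\<close> then supplies an element of \<open>X\<close>
  with the same type over that set.\<close>

lemma saturated_universe_update:
  assumes sat: "saturated \<kappa> L C" and K\<kappa>: "|K| <o \<kappa>"
  shows "saturated (cardSuc |K| ) L (C\<lparr>universe := X\<rparr>)"
  unfolding saturated_def
proof (intro allI impI ballI)
  let ?N = "C\<lparr>universe := X\<rparr>"
  fix B s p assume "B \<subseteq> universe ?N" "|B| <o cardSuc |K|" and p: "p \<in> complete_types L ?N [s] B"
  then have B: "B \<subseteq> X" "|B| \<le>o |K|"
    by (auto simp: cardSuc_ordLeq_ordLess card_of_Card_order)
  have fo: "formulas_over L ?N [s] B = formulas_over L C [s] B" by (simp add: formulas_over_def)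
  have pf: "p \<subseteq> formulas_over L C [s] B" using p unfolding complete_types_def fo by blast
  have sat_eq: "sat ?N (a @ b) \<phi> \<longleftrightarrow> sat C (a @ b) \<phi>"
    if "(\<phi>, b) \<in> p" "a \<in> tuples C X [s]" for \<phi> b a
  proof (rule sat_universe_update)
    have "(\<phi>, b) \<in> formulas_over L C [s] B" using that(1) pf by blast
    then show "wff L ([s] @ map (sort_of C) b) \<phi>"
      "a @ b \<in> tuples C X ([s] @ map (sort_of C) b)"
      using that(2) B(1) by (auto simp: formulas_over_iff tuples_iff)
  qed
  have "p \<in> complete_types L C [s] B"
    unfolding complete_types_def
  proof (intro CollectI conjI pf allI impI)
    show "\<forall>(\<phi>, b)\<in>formulas_over L C [s] B. (\<phi>, b) \<in> p \<or> (Neg \<phi>, b) \<in> p"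
      using p unfolding complete_types_def fo by blast
    fix F assume F: "F \<subseteq> p" "finite F"
    then have "\<exists>a\<in>tuples ?N (universe ?N) [s]. \<forall>(\<phi>, b)\<in>F. sat ?N (a @ b) \<phi>"
      using p unfolding complete_types_def by simp
    then obtain a where a: "a \<in> tuples ?N (universe ?N) [s]" "\<forall>(\<phi>, b)\<in>F. sat ?N (a @ b) \<phi>"
      by (rule bexE)
    then have aX: "a \<in> tuples C X [s]" by (simp add: tuples_iff)
    have "\<forall>(\<phi>, b)\<in>F. sat C (a @ b) \<phi>"
    proof clarify
      fix \<phi> b assume "(\<phi>, b) \<in> F"
      then have "sat ?N (a @ b) \<phi>" "(\<phi>, b) \<in> p" using a(2) F(1) by auto
      then show "sat C (a @ b) \<phi>" using sat_eq[OF _ aX] by simp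
    qed
    then show "\<exists>a\<in>tuples C (universe C) [s]. \<forall>(\<phi>, b)\<in>F. sat C (a @ b) \<phi>"
      using tuples_mono[OF aX XU] by (rule bexI)
  qed
  then have "\<exists>a. realizes C [s] a p"
    using sat[unfolded saturated_def, rule_format, of B] B XU ordLeq_ordLess_trans[OF B(2) K\<kappa>] by simp
  then obtain a where a: "realizes C [s] a p" ..
  then obtain m where m: "a = [m]" "m \<in> universe C" "sort_of C m = s"
    unfolding realizes_def tuples_iff by auto
  obtain m' where m': "m' \<in> X" "sort_of C m' = sort_of C m"
    and eq: "\<And>\<phi> b. set b \<subseteq> B \<Longrightarrow> wff L (sort_of C m # map (sort_of C) b) \<phi> \<Longrightarrow>
      sat C (m' # b) \<phi> \<longleftrightarrow> sat C (m # b) \<phi>"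
    using closed_realize[OF B m(2)] by metis
  have mt: "[m'] \<in> tuples C X [s]" using m' m by (simp add: tuples_iff)
  have "realizes ?N [s] [m'] p"
    unfolding realizes_def
  proof (intro conjI)
    show "[m'] \<in> tuples ?N (universe ?N) [s]" using mt by (simp add: tuples_iff)
    show "\<forall>(\<phi>, b)\<in>p. sat ?N ([m'] @ b) \<phi>"
    proof clarify
      fix \<phi> b assume b: "(\<phi>, b) \<in> p"
      then have "(\<phi>, b) \<in> formulas_over L C [s] B" using pf by blast
      moreover have "sat C (m # b) \<phi>" using a b m(1) unfolding realizes_def by auto
      ultimately have "sat C ([m'] @ b) \<phi>" using eq[of b \<phi>] m(3) by (simp add: formulas_over_iff)
      then show "sat ?N ([m'] @ b) \<phi>" using sat_eq[OF b mt] by simp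
    qed
  qed
  then show "\<exists>a. realizes ?N [s] a p" ..
qed

end

text \<open>Iterated negations of one equation are infinitely many formulas of any language, so |A|
  + |T| is an infinite cardinal.\<close>

lemma infinite_L_formulas: "infinite (L_formulas L)"
proof -
  fix s :: 'a
  let ?f = "\<lambda>n. (Neg ^^ n) (Eq (Var 0) (Var 0) :: ('a, 'b, 'c) fm)"
  have "wff L [s] (?f n)" for n
    using has_sort_Var[of 0 "[s]" L] by (induct n) auto
  then have "range ?f \<subseteq> L_formulas L" by (auto simp: L_formulas_def)
  moreover have "size (?f n) = n + size (?f 0)" for n by (induct n) auto
  then have "inj ?f" by (intro injI) (metis add_right_cancel)
  then have "infinite (range ?f)" using finite_imageD by blast
  ultimately show ?thesis by (meson infinite_super)
qed

lemma monster_Cinfinite: "monster_model \<kappa> L T C \<Longrightarrow> Cinfinite \<kappa>"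
  unfolding monster_model_def strong_limit_def
  using cinfinite_mono[OF ordLess_imp_ordLeq natLeq_cinfinite] by blast

text \<open>The definition of \<open>strong_limit\<close> mentions only sets of the element type of
  \<open>\<kappa>\<close>, so a set of another type is first copied into the field of
  \<open>\<kappa>\<close>.\<close>

lemma strong_limit_Pow:
  assumes "strong_limit \<kappa>" "|K| <o \<kappa>"
  shows "|Pow K| <o \<kappa>"
proof -
  have k: "Card_order \<kappa>" using assms(1) by (simp add: strong_limit_def)
  have "|K| \<le>o |Field \<kappa>|"
    by (rule ordLeq_ordIso_trans[OF ordLess_imp_ordLeq[OF assms(2)]
          ordIso_symmetric[OF card_of_Field_ordIso[OF k]]])
  then obtain f where f: "inj_on f K" and "f ` K \<subseteq> Field \<kappa>"
    unfolding card_of_ordLeq[symmetric] by (elim exE conjE)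
  have KK: "|f ` K| \<le>o |K|" by (rule card_of_image)
  then have "|f ` K| <o \<kappa>" using assms(2) by (rule ordLeq_ordLess_trans)
  then have P: "|Pow (f ` K)| <o \<kappa>" using assms(1) by (simp add: strong_limit_def)
  have "|K| \<le>o |f ` K|"
    unfolding card_of_ordLeq[symmetric] using f by (intro exI[of _ f]) simp
  then have "|Pow K| \<le>o |Pow (f ` K)|" by (rule card_of_Pow_mono)
  then show ?thesis using P by (rule ordLeq_ordLess_trans)
qed

text \<open>Over a set of size at most |A| + |T| there are at most 2^(|A| + |T|) types of single
  elements, each being a set of formulas paired with finite parameter lists. Closing
  \<open>A\<close> under realizations of such types therefore stays within that size, hence below
  \<open>\<kappa>\<close>.\<close>

lemma saturated_submodel_exists:
  fixes C :: "('s, 'f, 'r, 'm) struct"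
  assumes mon: "monster_model \<kappa> L T C" and A: "A \<subseteq> universe C" "|A| <o \<kappa>"
  shows "\<exists>N. elementary_submodel L N C \<and> |universe N| <o \<kappa> \<and> A \<subseteq> universe N \<and>
    saturated (cardSuc ( |A| +c |L_formulas L| )) L N"
proof -
  let ?K = "A <+> L_formulas L"
  have csum: "|A| +c |L_formulas L| = |?K|" by (simp add: csum_def Field_card_of)
  have inf\<kappa>: "Cinfinite \<kappa>" using mon by (rule monster_Cinfinite)
  have sl: "strong_limit \<kappa>" and L\<kappa>: "|L_formulas L| <o \<kappa>" and st: "is_structure L C"
    and sat: "saturated \<kappa> L C"
    using mon by (auto simp: monster_model_def)
  have K\<kappa>: "|?K| <o \<kappa>"
    using inf\<kappa> A(2) L\<kappa> unfolding cinfinite_def by (intro card_of_Plus_ordLess_infinite_Field) auto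
  have K: "infinite ?K" using infinite_L_formulas[of L] by simp
  have infP: "infinite (Pow ?K)" using K by simp
  have LK: "|L_formulas L| \<le>o |?K|" by (rule card_of_Plus2)
  have AK: "|A| \<le>o |?K|" by (rule card_of_Plus1)
  \<comment> \<open>\<open>rep\<close> sees an element only through its type, so \<open>R B\<close>
    has at most as many elements as there are types over \<open>B\<close>.\<close>
  define rep where "rep B t = (SOME m. m \<in> universe C \<and> tp L C [m] B = t)" for B t
  define R where "R B = rep B ` (\<lambda>m. tp L C [m] B) ` universe C" for B
  have rep: "rep B (tp L C [m] B) \<in> universe C \<and> tp L C [rep B (tp L C [m] B)] B = tp L C [m] B"
    if "m \<in> universe C" for m B
    unfolding rep_def by (rule someI_ex) (use that in blast)
  have "|R B| \<le>o |Pow ?K|" if B: "|B| \<le>o |?K|" for B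
  proof -
    let ?F = "L_formulas L \<times> {b. set b \<subseteq> B}"
    have "tp L C [m] B \<in> Pow ?F" for m
      by (auto simp: tp_def formulas_over_iff L_formulas_def)
    then have "R B \<subseteq> rep B ` Pow ?F" unfolding R_def by blast
    then have "|R B| \<le>o |Pow ?F|" by (rule surj_imp_ordLeq)
    also have "|?F| \<le>o |?K|"
      using K LK card_of_lists_infinite[OF K B] by (rule card_of_Times_ordLeq_infinite)
    then have "|Pow ?F| \<le>o |Pow ?K|" by (rule card_of_Pow_mono)
    finally show ?thesis .
  qed
  moreover have "R B \<subseteq> universe C" for B using rep by (auto simp: R_def)
  ultimately have "\<exists>X. A \<subseteq> X \<and> X \<subseteq> universe C \<and> |X| \<le>o |Pow ?K| \<and>
    (\<forall>B\<subseteq>X. |B| \<le>o |?K| \<longrightarrow> R B \<subseteq> X)"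
    using K AK A(1) by (intro small_closure)
  then obtain X where X: "A \<subseteq> X" "X \<subseteq> universe C" "|X| \<le>o |Pow ?K|"
    and cl: "\<forall>B\<subseteq>X. |B| \<le>o |?K| \<longrightarrow> R B \<subseteq> X" by (elim exE conjE)
  have tp: "\<exists>m'\<in>X. tp L C [m'] B = tp L C [m] B"
    if "B \<subseteq> X" "|B| \<le>o |?K|" "m \<in> universe C" for B m
  proof
    show "rep B (tp L C [m] B) \<in> X" using cl that unfolding R_def by blast
    show "tp L C [rep B (tp L C [m] B)] B = tp L C [m] B" using rep that(3) by blast
  qed
  have "|X| <o \<kappa>" using X(3) strong_limit_Pow[OF sl K\<kappa>] by (rule ordLeq_ordLess_trans)
  moreover have "elementary_submodel L (C\<lparr>universe := X\<rparr>) C"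
    using st X(2) K tp by (rule elementary_universe_update)
  moreover have "saturated (cardSuc |?K| ) L (C\<lparr>universe := X\<rparr>)"
    using st X(2) K tp sat K\<kappa> by (rule saturated_universe_update)
  ultimately show ?thesis
    unfolding csum using X(1) by (intro exI[of _ "C\<lparr>universe := X\<rparr>"]) simp
qed

section \<open>Passing between the monster model and a submodel\<close>

lemma elementary_formulas_over:
  assumes "elementary_submodel L N C"
  shows "formulas_over L N ss B = formulas_over L C ss B" "tuples N X ss = tuples C X ss"
    "universe N \<subseteq> universe C"
  using assms by (auto simp: elementary_submodel_def formulas_over_def tuples_def)

text \<open>In \<open>N\<close>, finite satisfiability in \<open>A\<close> replaces the consistency of \<open>q\<close>.\<close>

lemma realizes_on_exists_submodel:
  assumes el: "elementary_submodel L N C" and sat: "saturated \<mu> L N" and inf: "Cinfinite \<mu>"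
    and q: "fs_type L C ss A (universe N) q"
    and B: "B \<subseteq> universe N" "|B| <o \<mu>"
  shows "\<exists>x. fs_type.realizes_on L C ss (universe N) q B x"
proof -
  interpret Q: fs_type L C ss A "universe N" q by (rule q)
  note fo = elementary_formulas_over[OF el]
  have sat_eq: "sat N a \<phi> \<longleftrightarrow> sat C a \<phi>" if "a \<in> tuples C (universe N) us" "wff L us \<phi>" for a us \<phi>
    using el that unfolding elementary_submodel_def by blast
  let ?\<Gamma> = "q \<inter> formulas_over L C ss B"
  have eq: "sat N (a @ b) \<phi> \<longleftrightarrow> sat C (a @ b) \<phi>"
    if "(\<phi>, b) \<in> ?\<Gamma>" "a \<in> tuples C (universe N) ss" for a b \<phi>
  proof (rule sat_eq)
    have b: "set b \<subseteq> B" "wff L (ss @ map (sort_of C) b) \<phi>" using that(1) by (auto simp: formulas_over_iff)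
    show "wff L (ss @ map (sort_of C) b) \<phi>" by (rule b)
    show "a @ b \<in> tuples C (universe N) (ss @ map (sort_of C) b)"
      using that(2) b(1) B(1) by (auto simp: tuples_iff)
  qed
  have "\<exists>a. realizes N ss a ?\<Gamma>"
  proof (rule saturated_tuple[OF sat inf B])
    show "?\<Gamma> \<subseteq> formulas_over L N ss B" by (simp add: fo)
    fix F assume F: "F \<subseteq> ?\<Gamma>" "finite F"
    have "\<exists>a\<in>tuples C A ss. \<forall>(\<phi>, b)\<in>F. sat C (a @ b) \<phi>"
      using F by (intro Q.q_finite_in_A) auto
    then obtain a where a: "a \<in> tuples C A ss" "\<forall>(\<phi>, b)\<in>F. sat C (a @ b) \<phi>" by (rule bexE)
    have aN: "a \<in> tuples C (universe N) ss" using a(1) Q.A_N by (rule tuples_mono)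
    have "\<forall>(\<phi>, b)\<in>F. sat N (a @ b) \<phi>"
    proof clarify
      fix \<phi> b assume "(\<phi>, b) \<in> F"
      then have "(\<phi>, b) \<in> ?\<Gamma>" "sat C (a @ b) \<phi>" using F(1) a(2) by auto
      then show "sat N (a @ b) \<phi>" using eq[OF _ aN] by blast
    qed
    then show "\<exists>a\<in>tuples N (universe N) ss. \<forall>(\<phi>, b)\<in>F. sat N (a @ b) \<phi>"
      using aN unfolding fo by (rule bexI)
  qed
  then obtain a where a: "realizes N ss a ?\<Gamma>" ..
  then have aN: "a \<in> tuples C (universe N) ss" by (simp add: realizes_def fo)
  have "Q.realizes_on B a"
  proof (rule Q.realizes_onI[OF B(1) aN])
    fix \<phi> b assume b: "(\<phi>, b) \<in> q" "set b \<subseteq> B"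
    then have "(\<phi>, b) \<in> formulas_over L C ss (universe N)" using Q.q_formulas by blast
    then have g: "(\<phi>, b) \<in> ?\<Gamma>" using b by (simp add: formulas_over_iff)
    then have "sat N (a @ b) \<phi>" using a unfolding realizes_def by auto
    then show "sat C (a @ b) \<phi>" using eq[OF g aN] by simp
  qed
  then show ?thesis ..
qed

lemma coheir_restrict:
  assumes "coheir L M ss A p B q" "A \<subseteq> B'" "B' \<subseteq> B" and p: "p \<in> complete_types L M ss A"
  shows "coheir L M ss A p B' (q \<inter> formulas_over L M ss B')"
proof -
  have q: "q \<in> complete_types L M ss B" "p \<subseteq> q" "finitely_satisfiable_in M ss q A"
    using assms(1) by (auto simp: coheir_def)
  have fo: "formulas_over L M ss X \<subseteq> formulas_over L M ss Y" if "X \<subseteq> Y" for X Y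
    using that by (auto simp: formulas_over_def)
  have "q \<inter> formulas_over L M ss B' \<in> complete_types L M ss B'"
    unfolding complete_types_def
  proof (intro CollectI conjI allI impI)
    fix F assume "F \<subseteq> q \<inter> formulas_over L M ss B'" "finite F"
    then show "\<exists>a\<in>tuples M (universe M) ss. \<forall>(\<phi>, b)\<in>F. sat M (a @ b) \<phi>"
      using q(1) by (simp add: complete_types_def)
  next
    have "(\<phi>, b) \<in> q \<inter> formulas_over L M ss B' \<or> (Neg \<phi>, b) \<in> q \<inter> formulas_over L M ss B'"
      if b: "(\<phi>, b) \<in> formulas_over L M ss B'" for \<phi> b
    proof -
      have "(\<phi>, b) \<in> formulas_over L M ss B" "(Neg \<phi>, b) \<in> formulas_over L M ss B'"
        using b assms(3) by (auto simp: formulas_over_iff)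
      then show ?thesis using b q(1) unfolding complete_types_def by auto
    qed
    then show "\<forall>(\<phi>, b)\<in>formulas_over L M ss B'. (\<phi>, b) \<in> q \<inter> formulas_over L M ss B' \<or>
      (Neg \<phi>, b) \<in> q \<inter> formulas_over L M ss B'" by auto
  qed simp
  moreover have "p \<subseteq> formulas_over L M ss B'"
    using p fo[OF assms(2)] unfolding complete_types_def by auto
  moreover have "finitely_satisfiable_in M ss (q \<inter> formulas_over L M ss B') A"
    using q(3) unfolding finitely_satisfiable_in_def by auto
  ultimately show ?thesis using q(2) assms(2) by (simp add: coheir_def)
qed

lemma definable_over_restrict:
  assumes "definable_over L M ss B q A" "B' \<subseteq> B"
  shows "definable_over L M ss B' (q \<inter> formulas_over L M ss B') A"
  unfolding definable_over_def
proof (intro allI impI)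
  fix ts \<phi> assume \<phi>: "wff L (ss @ ts) \<phi>"
  from assms(1)[unfolded definable_over_def, rule_format, OF this]
  obtain x where x: "x \<in> formulas_over L M ts A"
    "case x of (d, c) \<Rightarrow> \<forall>b\<in>tuples M B ts. (\<phi>, b) \<in> q \<longleftrightarrow> sat M (b @ c) d" by (rule bexE)
  have "(\<phi>, b) \<in> formulas_over L M ss B'" "b \<in> tuples M B ts" if "b \<in> tuples M B' ts" for b
    using that \<phi> assms(2) by (auto simp: formulas_over_iff tuples_iff)
  then show "\<exists>(d, c)\<in>formulas_over L M ts A.
      \<forall>b\<in>tuples M B' ts. (\<phi>, b) \<in> q \<inter> formulas_over L M ss B' \<longleftrightarrow> sat M (b @ c) d"
    using x by (intro bexI[OF _ x(1)]) auto
qed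

theorem theorem5p6:
  fixes \<kappa> :: "'k rel"
    and L :: "('s, 'f, 'r) language"
    and T :: "('s, 'f, 'r) fm set"
    and C :: "('s, 'f, 'r, 'm) struct"
    and A :: "'m set"
    and ss :: "'s list"
    and p :: "(('s, 'f, 'r) fm \<times> 'm list) set"
  assumes "complete_theory L T"
    and "monster_model \<kappa> L T C"
    and "dependent L C"
    and "eq_closed L C"
    and "A \<subseteq> universe C" and "|A| <o \<kappa>"
    and "p \<in> complete_types L C ss A"
    and "finitely_satisfiable_in C ss p A"
  shows "(Shelah_stable L C ss A p \<longleftrightarrow>
            (\<forall>q. coheir L C ss A p (universe C) q \<longrightarrow> definable_over L C ss (universe C) q A)) \<and>
         (Shelah_stable L C ss A p \<longleftrightarrow>
            (\<exists>N q. elementary_submodel L N C \<and> |universe N| <o \<kappa> \<and> A \<subseteq> universe N \<and>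
               saturated (cardSuc ( |A| +c |L_formulas L| )) L N \<and>
               coheir L C ss A p (universe N) q \<and> definable_over L C ss (universe N) q A))"
    (is "(?i \<longleftrightarrow> ?ii) \<and> (?i \<longleftrightarrow> ?iii)")
proof -
  let ?\<mu> = "cardSuc ( |A| +c |L_formulas L| )"
  have inf: "Cinfinite \<kappa>" using assms(2) by (rule monster_Cinfinite)
  have nat: "natLeq <o \<kappa>" and sat: "saturated \<kappa> L C"
    using assms(2) by (auto simp: monster_model_def strong_limit_def)
  have pA: "fs_type L C ss A A p" using assms(5,7,8) by unfold_locales auto
  have i_ii: "?i \<Longrightarrow> ?ii"
  proof (intro allI impI)
    fix q assume "?i" and q: "coheir L C ss A p (universe C) q"
    then have "fs_type L C ss A (universe C) q" "p \<subseteq> q"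
      by (simp_all add: coheir_def fs_type_def)
    with \<open>?i\<close> assms(7,3) sat inf nat assms(5,6)
    show "definable_over L C ss (universe C) q A" by (rule Shelah_stable_imp_definable)
  qed
  have ii_iii: ?iii if ?ii
  proof -
    \<comment> \<open>A global coheir exists because \<open>p\<close> itself is finitely satisfiable
      in \<open>A\<close>; (ii) can then be applied to it.\<close>
    have "\<exists>q. fs_type L C ss A (universe C) q \<and> p \<subseteq> q"
    proof (rule coheir_exists[OF assms(5)])
      show "p \<subseteq> formulas_over L C ss (universe C)"
        using fs_type.q_formulas[OF pA] assms(5) by (auto simp: formulas_over_def)
      fix F assume "F \<subseteq> p" "finite F"
      then show "\<exists>a\<in>tuples C A ss. \<forall>(\<phi>, b)\<in>F. sat C (a @ b) \<phi>"
        by (intro fs_type.q_finite_in_A[OF pA])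
    qed
    then obtain q where "fs_type L C ss A (universe C) q" "p \<subseteq> q" by (elim exE conjE)
    then have "coheir L C ss A p (universe C) q" by (simp add: coheir_def fs_type_def)
    with that have q: "coheir L C ss A p (universe C) q" "definable_over L C ss (universe C) q A"
      by auto
    obtain N where N: "elementary_submodel L N C" "|universe N| <o \<kappa>" "A \<subseteq> universe N"
      "saturated ?\<mu> L N"
      using saturated_submodel_exists[OF assms(2,5,6)] by (elim exE conjE)
    note NC = elementary_formulas_over(3)[OF N(1)]
    show ?iii
      using N coheir_restrict[OF q(1) N(3) NC assms(7)] definable_over_restrict[OF q(2) NC]
      by (intro exI[of _ N] exI[of _ "q \<inter> formulas_over L C ss (universe N)"] conjI)
  qed
  have iii_i: ?i if ?iii
  proof -
    from that obtain N q where N: "elementary_submodel L N C" "saturated ?\<mu> L N"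
      and q: "coheir L C ss A p (universe N) q" "definable_over L C ss (universe N) q A"
      by (elim exE conjE)
    have fs: "fs_type L C ss A (universe N) q"
      using q(1) elementary_formulas_over(3)[OF N(1)] by (simp add: coheir_def fs_type_def)
    have pq: "p \<subseteq> q" using q(1) by (simp add: coheir_def)
    have pf: "p \<subseteq> formulas_over L C ss A" using assms(7) by (simp add: complete_types_def)
    have def: "fs_type.definable_type L C ss A (universe N) q"
      using q(2) fs_type.definable_over_iff[OF fs] by simp
    have "Cinfinite |L_formulas L|"
      using infinite_L_formulas[of L]
      by (simp add: cinfinite_def Field_card_of card_of_card_order_on)
    then have infc: "Cinfinite ( |A| +c |L_formulas L| )" by (intro Cinfinite_csum disjI2)
    then have inf\<mu>: "Cinfinite ?\<mu>" by (rule Cinfinite_cardSuc)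
    have "|A| \<le>o |A| +c |L_formulas L|" by (intro ordLeq_csum1 card_of_Card_order)
    then have A\<mu>: "|A| <o ?\<mu>"
      using infc by (simp add: cardSuc_ordLeq_ordLess card_of_Card_order)
    \<comment> \<open>The Morley sequence is built inside \<open>N\<close>: each step has as
      parameters \<open>A\<close> and finitely many tuples, which are fewer than the degree of
      saturation of \<open>N\<close>.\<close>
    show ?i
      using fs def pq pf inf\<mu> A\<mu>
      by (rule fs_type.Shelah_stable_if_definable)
        (rule realizes_on_exists_submodel[OF N inf\<mu> fs])
  qed
  show ?thesis using i_ii ii_iii iii_i by blast
qed

end
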